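(* Let $d,e,r\ge1$ be integers with $de>1$ (and $d\neq1$ if $r=1$), and let $k\subset\mathbb{C}$ be a number field stable under complex conjugation and containing $\zeta_{de}$. Given a family $\mathcal F_r=\{\mathfrak a,\mathfrak b_0,\mathfrak b_1\}$ of fractional ideals of $\mathbb{Z}_k$, where $\mathfrak b_0=\mathfrak b_1=\mathbb{Z}_k$ unless $r=2$ and $de=2p^l$ with $p$ prime and $l\ge1$, define $$\mathfrak R_{\mathcal F_r}(de,e,r):=\mathfrak a\cdot\mathfrak R_1^1(d,r)\cup\mathfrak b_0\cdot\mathfrak R_2^0(de,r)\cup\mathfrak b_1\cdot\mathfrak R_2^1(de,r).$$ Then every genus of distinguished $\mathbb{Z}_k$-root systems for $G(de,e,r)$ contains exactly one root system $\mathfrak R_{\mathcal F_r}(de,e,r)$ where $\mathcal F_r$ satisfies the additional conditions: - $\mathfrak a$, $\mathfrak b_0$ and $\mathfrak b_1$ are integral; - $\mathfrak b_0$ and $\mathfrak b_1$ are relatively prime divisors of $(1+\zeta_{de})\mathbb{Z}_k$; - $\mathfrak a$ divides $(1-\zeta_d)\mathbb{Z}_k$; - $\mathfrak b_0$ and $\mathfrak b_1$ divide $\mathfrak a$.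
   Context: $\zeta_n=\exp(2\pi i/n)$; $\lambda\mapsto\lambda^*$ is complex conjugation; $\mathbb{Z}_k$ is the ring of integers of $k$; for a (nonzero) fractional ideal $\mathfrak a$, $\mathfrak a^{-*}=(\mathfrak a^{-1})^*$. $V$ is a $k$-vector space with basis $e_1,\dots,e_r$ and $W$ a $k$-vector space with a Hermitian pairing $\langle\cdot,\cdot\rangle:V\times W\to k$ (linear in $V$, semi-linear in $W$, non-degenerate) and dual basis $e'_1,\dots,e'_r$. $G(de,e,r)\subset\mathrm{GL}(V)$ is the group of monomial matrices (in the basis $e_i$) with nonzero entries in the group of $de$-th roots of unity and product of nonzero entries in the group of $d$-th roots of unity. For $g\in\mathrm{GL}(V)$, $g^\vee\in\mathrm{GL}(W)$ is the unique element with $\langle gv,g^\vee w\rangle=\langle v,w\rangle$. A $\mathbb{Z}_k$-root is a triple $\mathfrak r=(I,J,\zeta)$ with $I\subset V$, $J\subset W$ rank one finitely generated $\mathbb{Z}_k$-submodules, $\zeta\ne1$ a root of unity in $k$, and $\langle I,J\rangle=(1-\zeta)\mathbb{Z}_k$ (where $\langle I,J\rangle$ is the fractional ideal generated by all $\langle\alpha,\beta\rangle$, $\alpha\in I$, $\beta\in J$). Its reflection is $s_{\mathfrak r}(x)=x-\langle x,w\rangle v$ for $v\in kI,w\in kJ$ with $\langle v,w\rangle=1-\zeta$. Put $g\cdot(I,J,\zeta)=(g(I),g^\vee(J),\zeta)$ for $g\in\mathrm{GL}(V)$, and $\mathfrak a\cdot(I,J,\zeta)=(\mathfrak aI,\mathfrak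 a^{-*}J,\zeta)$ for a fractional ideal $\mathfrak a$; for a set $\mathfrak R$ of roots, $\mathfrak a\cdot\mathfrak R=\{\mathfrak a\cdot\mathfrak r\mid\mathfrak r\in\mathfrak R\}$. A $\mathbb{Z}_k$-root system is a finite set $\mathfrak R$ of $\mathbb{Z}_k$-roots whose $I_{\mathfrak r}$ generate $V$, with $s_{\mathfrak r}\cdot\mathfrak R=\mathfrak R$ for $\mathfrak r\in\mathfrak R$ and $\langle I_{\mathfrak r_1},J_{\mathfrak r_2}\rangle\subseteq\mathbb{Z}_k$ for $\mathfrak r_1,\mathfrak r_2\in\mathfrak R$. It is a root system for $G$ if the $s_{\mathfrak r}$ generate $G$. A reflection $s\in G$ with hyperplane $H$ is distinguished if $\det s=\exp(2\pi i/c)$, $c$ being the order of the pointwise stabilizer of $H$ in $G$. A root system $\mathfrak R$ for $G$ is distinguished if $\mathfrak r\mapsto s_{\mathfrak r}$ is injective and every $s_{\mathfrak r}$ is distinguished in $G$. Two root systems are of the same genus if $\mathfrak R_2=\mathfrak a\cdot\mathfrak R_1$ for some fractional ideal $\mathfrak a$. For $1\le m\le r$ let $\mathfrak r_m^1=(\mathbb{Z}_ke_m,\ (1-\zeta_d^{-1})\mathbb{Z}_ke'_m,\ \zeta_d)$ (if $d>1$), and for $1\le m<n\le r$, $0\le j\le de-1$ let $\mathfrak r_{m,n}^{(j)}=(\mathbb{Z}_k(e_m-\zeta_{de}^je_n),\ \mathbb{Z}_k(e'_m-\zeta_{de}^je'_n),\ -1)$. Then $\mathfrak R_1^1(d,r)=\{\mathfrak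 r_m^1\mid1\le m\le r\}$ (empty if $d=1$, in which case $\mathfrak a$ and the conditions on it are absent), and $\mathfrak R_2^0(de,r)$ (resp. $\mathfrak R_2^1(de,r)$) is the set of all $\mathfrak r_{m,n}^{(j)}$ with $0\le j\le de-1$ even (resp. odd); these are empty if $r=1$.
   Formalization: The cases r=1 with d a prime power (where a=(1) and a=(1-ζ_d) give two systems in the same genus) and (d,e,r)=(1,2,2) (where the roots are orthogonal, so b_0, b_1 are unrelated and a representative may not exist) are excluded, since the claim fails there. *)

theory Defs
  imports
    Complex_Main
    "HOL-Computational_Algebra.Polynomial"
    "HOL-Number_Theory.Prime_Powers"
    "HOL-Algebra.Generated_Groups"
    "HOL-Combinatorics.Permutations"
    "Jordan_Normal_Form.Determinant"
begin

section \<open>Number fields and modules over subsets of the complex numbers\<close>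

definition number_field :: "complex set \<Rightarrow> bool" where
  "number_field K \<longleftrightarrow>
     1 \<in> K \<and> (\<forall>x\<in>K. \<forall>y\<in>K. x - y \<in> K) \<and> (\<forall>x\<in>K. \<forall>y\<in>K. x * y \<in> K) \<and>
     (\<forall>x\<in>K. inverse x \<in> K) \<and>
     (\<exists>B. finite B \<and> Modules.module.span (\<lambda>(q::rat) (x::complex). of_rat q * x) B = K)"

definition ints_of :: "complex set \<Rightarrow> complex set" where
  "ints_of K = {x \<in> K. algebraic_int x}"

definition zeta :: "nat \<Rightarrow> complex" where
  "zeta n = exp (2 * of_real pi * \<i> / of_nat n)"

text \<open>The field is a subset \<open>K\<close> of the complex numbers and not a type. A vector space over it
  is therefore an abelian group type with a scaling that is only meaningful for scalars in \<open>K\<close>.\<close>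

locale vector_space_over =
  fixes K :: "complex set" and scale :: "complex \<Rightarrow> 'v::ab_group_add \<Rightarrow> 'v"
  assumes scale_add_right: "a \<in> K \<Longrightarrow> scale a (x + y) = scale a x + scale a y"
    and scale_add_left: "a \<in> K \<Longrightarrow> b \<in> K \<Longrightarrow> scale (a + b) x = scale a x + scale b x"
    and scale_scale: "a \<in> K \<Longrightarrow> b \<in> K \<Longrightarrow> scale a (scale b x) = scale (a * b) x"
    and scale_one: "scale 1 x = x"

text \<open>The scalars \<open>R\<close> are \<open>K\<close> (subspaces) or its ring of integers (submodules);
  with \<open>scale = (*)\<close> the latter describes submodules of \<open>K\<close> itself.\<close>

definition submod :: "complex set \<Rightarrow> (complex \<Rightarrow> 'v::ab_group_add \<Rightarrow> 'v) \<Rightarrow> 'v set \<Rightarrow> bool" where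
  "submod R scale M \<longleftrightarrow>
     0 \<in> M \<and> (\<forall>x\<in>M. \<forall>y\<in>M. x + y \<in> M) \<and> (\<forall>a\<in>R. \<forall>x\<in>M. scale a x \<in> M)"

definition gen :: "complex set \<Rightarrow> (complex \<Rightarrow> 'v::ab_group_add \<Rightarrow> 'v) \<Rightarrow> 'v set \<Rightarrow> 'v set" where
  "gen R scale S = submod R scale hull S"

definition fin_gen :: "complex set \<Rightarrow> (complex \<Rightarrow> 'v::ab_group_add \<Rightarrow> 'v) \<Rightarrow> 'v set \<Rightarrow> bool" where
  "fin_gen R scale M \<longleftrightarrow> (\<exists>S. finite S \<and> M = gen R scale S)"

definition multiples :: "complex set \<Rightarrow> (complex \<Rightarrow> 'v::ab_group_add \<Rightarrow> 'v) \<Rightarrow> 'v \<Rightarrow> 'v set" where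
  "multiples R scale v = {scale a v | a. a \<in> R}"

text \<open>The rank of a submodule \<open>M\<close> over the ring of integers is the dimension of the \<open>K\<close>-space
  it spans.\<close>

definition rank_one :: "complex set \<Rightarrow> (complex \<Rightarrow> 'v::ab_group_add \<Rightarrow> 'v) \<Rightarrow> 'v set \<Rightarrow> bool" where
  "rank_one K scale M \<longleftrightarrow> (\<exists>v. v \<noteq> 0 \<and> gen K scale M = multiples K scale v)"

definition basis_of :: "complex set \<Rightarrow> (complex \<Rightarrow> 'v::ab_group_add \<Rightarrow> 'v) \<Rightarrow> nat \<Rightarrow> (nat \<Rightarrow> 'v) \<Rightarrow> bool"
  where
  "basis_of K scale r b \<longleftrightarrow>
     (\<forall>c. (\<forall>i\<in>{1..r}. c i \<in> K) \<and> (\<Sum>i=1..r. scale (c i) (b i)) = 0 \<longrightarrow> (\<forall>i\<in>{1..r}. c i = 0)) \<and>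
     gen K scale (b ` {1..r}) = UNIV"

definition GL :: "complex set \<Rightarrow> (complex \<Rightarrow> 'v::ab_group_add \<Rightarrow> 'v) \<Rightarrow> ('v \<Rightarrow> 'v) monoid" where
  "GL K scale =
     \<lparr>carrier = {g. bij g \<and> (\<forall>x y. g (x + y) = g x + g y) \<and> (\<forall>a\<in>K. \<forall>x. g (scale a x) = scale a (g x))},
      monoid.mult = (\<circ>), one = id\<rparr>"


section \<open>Fractional ideals\<close>

definition fractional_ideal :: "complex set \<Rightarrow> complex set \<Rightarrow> bool" where
  "fractional_ideal K A \<longleftrightarrow> A \<subseteq> K \<and> fin_gen (ints_of K) (*) A \<and> A \<noteq> {0}"

definition principal :: "complex set \<Rightarrow> complex \<Rightarrow> complex set" where
  "principal K x = multiples (ints_of K) (*) x"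

text \<open>The product of an ideal with a submodule; for \<open>scale = (*)\<close> it is the product of ideals.\<close>

definition ideal_mult ::
  "complex set \<Rightarrow> (complex \<Rightarrow> 'v::ab_group_add \<Rightarrow> 'v) \<Rightarrow> complex set \<Rightarrow> 'v set \<Rightarrow> 'v set" where
  "ideal_mult K scale A M = gen (ints_of K) scale {scale a x | a x. a \<in> A \<and> x \<in> M}"

definition ideal_inverse :: "complex set \<Rightarrow> complex set \<Rightarrow> complex set" where
  "ideal_inverse K A = {x \<in> K. \<forall>a\<in>A. x * a \<in> ints_of K}"

definition ideal_inverse_cnj :: "complex set \<Rightarrow> complex set \<Rightarrow> complex set" where
  "ideal_inverse_cnj K A = cnj ` ideal_inverse K A"

definition integral :: "complex set \<Rightarrow> complex set \<Rightarrow> bool" where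
  "integral K A \<longleftrightarrow> A \<subseteq> ints_of K"

text \<open>The cofactor \<open>C\<close> may be the zero ideal, so that every integral ideal divides the zero
  ideal; this matters for \<open>1 + zeta 2 = 0\<close>.\<close>

definition ideal_dvd :: "complex set \<Rightarrow> complex set \<Rightarrow> complex set \<Rightarrow> bool" where
  "ideal_dvd K A B \<longleftrightarrow>
     (\<exists>C. submod (ints_of K) (*) C \<and> integral K C \<and> B = ideal_mult K (*) A C)"

definition relatively_prime :: "complex set \<Rightarrow> complex set \<Rightarrow> complex set \<Rightarrow> bool" where
  "relatively_prime K A B \<longleftrightarrow> gen (ints_of K) (*) (A \<union> B) = ints_of K"


section \<open>Roots and root systems\<close>

type_synonym ('v, 'w) root = "'v set \<times> 'w set \<times> complex"

locale hermitian_pairing =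
  V: vector_space_over K sV + W: vector_space_over K sW
  for K :: "complex set"
    and sV :: "complex \<Rightarrow> 'v::ab_group_add \<Rightarrow> 'v"
    and sW :: "complex \<Rightarrow> 'w::ab_group_add \<Rightarrow> 'w" +
  fixes pr :: "'v \<Rightarrow> 'w \<Rightarrow> complex"
  assumes number_field: "number_field K"
    and cnj_stable: "x \<in> K \<Longrightarrow> cnj x \<in> K"
    and pr_in: "pr v w \<in> K"
    and pr_add_left: "pr (v + v') w = pr v w + pr v' w"
    and pr_add_right: "pr v (w + w') = pr v w + pr v w'"
    and pr_scale_left: "a \<in> K \<Longrightarrow> pr (sV a v) w = a * pr v w"
    and pr_scale_right: "a \<in> K \<Longrightarrow> pr v (sW a w) = cnj a * pr v w"
    and nondegenerate_left: "(\<And>w. pr v w = 0) \<Longrightarrow> v = 0"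
    and nondegenerate_right: "(\<And>v. pr v w = 0) \<Longrightarrow> w = 0"
begin

definition pair_ideal :: "'v set \<Rightarrow> 'w set \<Rightarrow> complex set" where
  "pair_ideal I J = gen (ints_of K) (*) {pr x y | x y. x \<in> I \<and> y \<in> J}"

definition contragredient :: "('v \<Rightarrow> 'v) \<Rightarrow> 'w \<Rightarrow> 'w" where
  "contragredient g = (THE h. h \<in> carrier (GL K sW) \<and> (\<forall>v w. pr (g v) (h w) = pr v w))"

definition is_root :: "('v, 'w) root \<Rightarrow> bool" where
  "is_root = (\<lambda>(I, J, z).
     fin_gen (ints_of K) sV I \<and> rank_one K sV I \<and>
     fin_gen (ints_of K) sW J \<and> rank_one K sW J \<and>
     z \<in> K \<and> z \<noteq> 1 \<and> (\<exists>n>0. z ^ n = 1) \<and>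
     pair_ideal I J = principal K (1 - z))"

text \<open>The reflection does not depend on the chosen vectors \<open>v\<close> and \<open>w\<close>.\<close>

definition reflection :: "('v, 'w) root \<Rightarrow> 'v \<Rightarrow> 'v" where
  "reflection = (\<lambda>(I, J, z).
     THE s. \<exists>v\<in>gen K sV I. \<exists>w\<in>gen K sW J. pr v w = 1 - z \<and> s = (\<lambda>x. x - sV (pr x w) v))"

definition act :: "('v \<Rightarrow> 'v) \<Rightarrow> ('v, 'w) root \<Rightarrow> ('v, 'w) root" where
  "act g = (\<lambda>(I, J, z). (g ` I, contragredient g ` J, z))"

definition ideal_act :: "complex set \<Rightarrow> ('v, 'w) root \<Rightarrow> ('v, 'w) root" where
  "ideal_act A = (\<lambda>(I, J, z). (ideal_mult K sV A I, ideal_mult K sW (ideal_inverse_cnj K A) J, z))"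

definition root_system :: "('v, 'w) root set \<Rightarrow> bool" where
  "root_system \<R> \<longleftrightarrow>
     finite \<R> \<and> (\<forall>\<rho>\<in>\<R>. is_root \<rho>) \<and>
     gen K sV (\<Union>\<rho>\<in>\<R>. fst \<rho>) = UNIV \<and>
     (\<forall>\<rho>\<in>\<R>. act (reflection \<rho>) ` \<R> = \<R>) \<and>
     (\<forall>\<rho>\<in>\<R>. \<forall>\<sigma>\<in>\<R>. pair_ideal (fst \<rho>) (fst (snd \<sigma>)) \<subseteq> ints_of K)"

definition root_system_for :: "('v \<Rightarrow> 'v) set \<Rightarrow> ('v, 'w) root set \<Rightarrow> bool" where
  "root_system_for G \<R> \<longleftrightarrow> root_system \<R> \<and> generate (GL K sV) (reflection ` \<R>) = G"

definition is_hyperplane :: "'v set \<Rightarrow> bool" where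
  "is_hyperplane H \<longleftrightarrow> submod K sV H \<and> H \<noteq> UNIV \<and> (\<exists>v. gen K sV (insert v H) = UNIV)"

end

locale hermitian_pairing_basis = hermitian_pairing K sV sW pr
  for K :: "complex set"
    and sV :: "complex \<Rightarrow> 'v::ab_group_add \<Rightarrow> 'v"
    and sW :: "complex \<Rightarrow> 'w::ab_group_add \<Rightarrow> 'w"
    and pr :: "'v \<Rightarrow> 'w \<Rightarrow> complex" +
  fixes r :: nat and eV :: "nat \<Rightarrow> 'v" and eW :: "nat \<Rightarrow> 'w"
  assumes basis_V: "basis_of K sV r eV"
    and basis_W: "basis_of K sW r eW"
    and dual: "i \<in> {1..r} \<Longrightarrow> j \<in> {1..r} \<Longrightarrow> pr (eV i) (eW j) = (if i = j then 1 else 0)"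
begin

text \<open>By duality, \<open>pr (g (eV j)) (eW i)\<close> is the \<open>i\<close>-th coordinate of \<open>g (eV j)\<close>.\<close>

definition det_of :: "('v \<Rightarrow> 'v) \<Rightarrow> complex" where
  "det_of g = Determinant.det (mat r r (\<lambda>(i, j). pr (g (eV (Suc j))) (eW (Suc i))))"

definition distinguished_reflection :: "('v \<Rightarrow> 'v) set \<Rightarrow> ('v \<Rightarrow> 'v) \<Rightarrow> bool" where
  "distinguished_reflection G s \<longleftrightarrow>
     s \<in> G \<and> is_hyperplane {x. s x = x} \<and>
     det_of s = zeta (card {g \<in> G. \<forall>x. s x = x \<longrightarrow> g x = x})"

definition distinguished_systems :: "('v \<Rightarrow> 'v) set \<Rightarrow> ('v, 'w) root set set" where
  "distinguished_systems G =
     {\<R>. root_system_for G \<R> \<and> inj_on reflection \<R> \<and>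
          (\<forall>\<rho>\<in>\<R>. distinguished_reflection G (reflection \<rho>))}"

definition same_genus :: "('v \<Rightarrow> 'v) set \<Rightarrow> (('v, 'w) root set \<times> ('v, 'w) root set) set" where
  "same_genus G =
     {(\<R>, \<S>). \<R> \<in> distinguished_systems G \<and> \<S> \<in> distinguished_systems G \<and>
              (\<exists>A. fractional_ideal K A \<and> \<S> = ideal_act A ` \<R>)}"

definition genera :: "('v \<Rightarrow> 'v) set \<Rightarrow> ('v, 'w) root set set set" where
  "genera G = distinguished_systems G // same_genus G"

text \<open>The monomial group \<open>G(de, e, r)\<close>.\<close>

definition monomial_group :: "nat \<Rightarrow> nat \<Rightarrow> ('v \<Rightarrow> 'v) set" where
  "monomial_group d e =
     {g \<in> carrier (GL K sV).
        \<exists>\<pi> c. \<pi> permutes {1..r} \<and> (\<forall>i\<in>{1..r}. c i \<in> K \<and> c i ^ (d * e) = 1) \<and>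
              (\<Prod>i=1..r. c i) ^ d = 1 \<and> (\<forall>i\<in>{1..r}. g (eV i) = sV (c i) (eV (\<pi> i)))}"

definition diag_root :: "nat \<Rightarrow> nat \<Rightarrow> ('v, 'w) root" where
  "diag_root d m =
     (multiples (ints_of K) sV (eV m),
      multiples (ints_of K) sW (sW (1 - inverse (zeta d)) (eW m)),
      zeta d)"

definition perm_root :: "nat \<Rightarrow> nat \<Rightarrow> nat \<Rightarrow> nat \<Rightarrow> ('v, 'w) root" where
  "perm_root de j m n =
     (multiples (ints_of K) sV (eV m - sV (zeta de ^ j) (eV n)),
      multiples (ints_of K) sW (eW m - sW (zeta de ^ j) (eW n)),
      - 1)"

definition diag_roots :: "nat \<Rightarrow> ('v, 'w) root set" where
  "diag_roots d = (if d = 1 then {} else {diag_root d m | m. 1 \<le> m \<and> m \<le> r})"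

definition even_roots :: "nat \<Rightarrow> ('v, 'w) root set" where
  "even_roots de = {perm_root de j m n | j m n. 1 \<le> m \<and> m < n \<and> n \<le> r \<and> j \<le> de - 1 \<and> even j}"

definition odd_roots :: "nat \<Rightarrow> ('v, 'w) root set" where
  "odd_roots de = {perm_root de j m n | j m n. 1 \<le> m \<and> m < n \<and> n \<le> r \<and> j \<le> de - 1 \<and> odd j}"

definition family_system ::
  "nat \<Rightarrow> nat \<Rightarrow> complex set \<Rightarrow> complex set \<Rightarrow> complex set \<Rightarrow> ('v, 'w) root set" where
  "family_system d e A B\<^sub>0 B\<^sub>1 =
     ideal_act A ` diag_roots d \<union> ideal_act B\<^sub>0 ` even_roots (d * e) \<union> ideal_act B\<^sub>1 ` odd_roots (d * e)"

definition ideal_family :: "nat \<Rightarrow> nat \<Rightarrow> complex set \<Rightarrow> complex set \<Rightarrow> complex set \<Rightarrow> bool" where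
  "ideal_family d e A B\<^sub>0 B\<^sub>1 \<longleftrightarrow>
     fractional_ideal K A \<and> fractional_ideal K B\<^sub>0 \<and> fractional_ideal K B\<^sub>1 \<and>
     (\<not> (r = 2 \<and> (\<exists>p l. prime p \<and> l \<ge> 1 \<and> d * e = 2 * p ^ l)) \<longrightarrow>
        B\<^sub>0 = ints_of K \<and> B\<^sub>1 = ints_of K)"

text \<open>For \<open>d = 1\<close> there are no diagonal roots; the ideal \<open>A\<close> is then a dummy and nothing is
  required of it.\<close>

definition normalized_family :: "nat \<Rightarrow> nat \<Rightarrow> complex set \<Rightarrow> complex set \<Rightarrow> complex set \<Rightarrow> bool" where
  "normalized_family d e A B\<^sub>0 B\<^sub>1 \<longleftrightarrow>
     integral K B\<^sub>0 \<and> integral K B\<^sub>1 \<and> relatively_prime K B\<^sub>0 B\<^sub>1 \<and>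
     ideal_dvd K B\<^sub>0 (principal K (1 + zeta (d * e))) \<and>
     ideal_dvd K B\<^sub>1 (principal K (1 + zeta (d * e))) \<and>
     (d \<noteq> 1 \<longrightarrow>
        integral K A \<and> ideal_dvd K A (principal K (1 - zeta d)) \<and>
        ideal_dvd K B\<^sub>0 A \<and> ideal_dvd K B\<^sub>1 A)"

end

text \<open>Parameters for which the classification fails.

  For \<open>r = 1\<close> all the systems \<open>{a \<cdot> r\<^sub>1}\<close> form a single genus, so every integral
  divisor \<open>a\<close> of \<open>1 - zeta d\<close> gives a normalized representative; there is only one such divisor
  iff \<open>1 - zeta d\<close> is a unit, i.e. iff \<open>d\<close> is not a prime power (\<open>d = 1\<close> being excluded anyway).

  For \<open>G(2,2,2)\<close> the two roots are orthogonal, hence \<open>b\<^sub>0\<close> and \<open>b\<^sub>1\<close> are unrelated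
  arbitrary fractional ideals, whereas \<open>ideal_family\<close> only allows \<open>b\<^sub>0 = b\<^sub>1\<close>; the genus with
  \<open>b\<^sub>0 = (1)\<close> and \<open>b\<^sub>1 = (3)\<close> has no representative.\<close>

definition degenerate :: "nat \<Rightarrow> nat \<Rightarrow> nat \<Rightarrow> bool" where
  "degenerate d e r \<longleftrightarrow> (r = 1 \<and> primepow d) \<or> (d = 1 \<and> e = 2 \<and> r = 2)"

end

theory Submission
  imports Defs "Jordan_Normal_Form.Char_Poly"
begin

text \<open>
  In a distinguished root system \<open>\<R>\<close> for \<open>G(de, e, r)\<close> every root is determined by its
  reflection up to a fractional ideal, because \<open>\<langle>I, J\<rangle>\<close> is principal. The generation of \<open>G\<close>
  forces all distinguished reflections to occur, and since \<open>G\<close> acts on \<open>\<R>\<close>, the ideal is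
  constant on conjugacy classes of reflections; there are at most three of them, which gives
  \<open>a\<close>, \<open>b\<^sub>0\<close>, \<open>b\<^sub>1\<close>. Changing the representative of the genus multiplies the three ideals by a
  common ideal, so \<open>b\<^sub>0 + b\<^sub>1 = (1)\<close> can be achieved in exactly one way. All the other conditions
  then express the integrality of the pairings between the roots.

  Arithmetic enters through the invertibility of fractional ideals and through the fact that
  \<open>1 - \<zeta>\<close> is a unit for a root of unity \<open>\<zeta> \<noteq> 1\<close> whose order is not a prime power.
\<close>

section \<open>Algebraic integers\<close>

text \<open>A monomial map with entries \<open>c\<close> multiplies the parameter \<open>x\<close>
  of the root with vector \<open>eV m - x eV n\<close> by \<open>c n / c m\<close> (and permutes the
  indices). Diagonal elements always realize the squares of roots of unity as factors, and all
  factors if r >= 3 or e is odd. So only r = 2 with e even leaves an invariant, the parity of the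
  exponent of \<open>x\<close>, and only then can b0 and b1 differ. Roots of opposite parity pair to
  \<open>1 + zeta (d * e)\<close> up to a unit, and this is itself a unit if de/2 > 1 is not a prime
  power; hence the exception de = 2 p^l. For de/2 = 1 it vanishes and the pairing says nothing.

  That every class of reflections occurs is shown by invariants: if a class were missing, all
  generators and therefore all of G would share a property (product of entries 1, trivial
  permutation, a prescribed sign) that some element of G violates.

  The field is a set of complex numbers, so the ring theory is done with explicit generators:
  inverses of ideals come from primitive integer polynomials, and units from coprime integers
  divisible by \<open>1 - \<zeta>\<close>; prime ideals do not appear.\<close>

definition int_span :: "complex set \<Rightarrow> complex set" where
  "int_span B = {\<Sum>b\<in>B. of_int (f b) * b | f. True}"

lemma int_span_0: "0 \<in> int_span B"
  unfolding int_span_def by (rule CollectI, rule exI[of _ "\<lambda>_. 0"]) simp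

lemma int_span_add:
  assumes "x \<in> int_span B" "y \<in> int_span B" shows "x + y \<in> int_span B"
proof -
  obtain f g where "x = (\<Sum>b\<in>B. of_int (f b) * b)" "y = (\<Sum>b\<in>B. of_int (g b) * b)"
    using assms by (auto simp: int_span_def)
  then have "x + y = (\<Sum>b\<in>B. of_int (f b + g b) * b)"
    by (simp add: sum.distrib distrib_right)
  then show ?thesis unfolding int_span_def by (intro CollectI exI[of _ "\<lambda>b. f b + g b"]) simp
qed

lemma int_span_int:
  assumes "x \<in> int_span B" shows "of_int k * x \<in> int_span B"
proof -
  obtain f where "x = (\<Sum>b\<in>B. of_int (f b) * b)"
    using assms by (auto simp: int_span_def)
  then have "of_int k * x = (\<Sum>b\<in>B. of_int (k * f b) * b)"
    by (simp add: sum_distrib_left mult.assoc)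
  then show ?thesis unfolding int_span_def by (intro CollectI exI[of _ "\<lambda>b. k * f b"]) simp
qed

lemma int_span_uminus: "x \<in> int_span B \<Longrightarrow> - x \<in> int_span B"
  using int_span_int[of x B "-1"] by simp

lemma int_span_sum: "(\<And>i. i \<in> I \<Longrightarrow> f i \<in> int_span B) \<Longrightarrow> sum f I \<in> int_span B"
  by (induction I rule: infinite_finite_induct) (auto intro: int_span_0 int_span_add)

lemma int_span_base:
  assumes "finite B" "b \<in> B" shows "b \<in> int_span B"
proof -
  have "(\<Sum>c\<in>B. of_int (if c = b then 1 else 0) * c) = (\<Sum>c\<in>B. if c = b then c else 0)"
    by (intro sum.cong) auto
  also have "\<dots> = b"
    using assms by simp
  finally have "b = (\<Sum>c\<in>B. of_int (if c = b then 1 else 0) * c)" ..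
  then show ?thesis
    unfolding int_span_def by (intro CollectI exI[of _ "\<lambda>c. if c = b then 1 else 0"]) simp
qed

lemma int_span_mult:
  assumes "finite B" "finite C" "x \<in> int_span B" "y \<in> int_span C"
  shows "x * y \<in> int_span ((\<lambda>(b, c). b * c) ` (B \<times> C))"
proof -
  obtain f g where "x = (\<Sum>b\<in>B. of_int (f b) * b)" "y = (\<Sum>c\<in>C. of_int (g c) * c)"
    using assms by (auto simp: int_span_def)
  then have "x * y = (\<Sum>b\<in>B. \<Sum>c\<in>C. of_int (f b * g c) * (b * c))"
    by (simp add: sum_product mult_ac)
  also have "\<dots> \<in> int_span ((\<lambda>(b, c). b * c) ` (B \<times> C))"
    using assms by (intro int_span_sum int_span_int int_span_base) auto
  finally show ?thesis .
qed

text \<open>These rings carry the proof that algebraic integers are closed under sums and products: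
  any finitely many of them fit into one such ring, and all its elements are integral.\<close>

definition finite_ring :: "complex set \<Rightarrow> bool" where
  "finite_ring M \<longleftrightarrow> (\<exists>B. finite B \<and> M = int_span B) \<and> 1 \<in> M \<and> (\<forall>x\<in>M. \<forall>y\<in>M. x * y \<in> M)"

lemma finite_ring_0: "finite_ring M \<Longrightarrow> 0 \<in> M"
  and finite_ring_1: "finite_ring M \<Longrightarrow> 1 \<in> M"
  and finite_ring_add: "finite_ring M \<Longrightarrow> x \<in> M \<Longrightarrow> y \<in> M \<Longrightarrow> x + y \<in> M"
  and finite_ring_uminus: "finite_ring M \<Longrightarrow> x \<in> M \<Longrightarrow> - x \<in> M"
  and finite_ring_mult: "finite_ring M \<Longrightarrow> x \<in> M \<Longrightarrow> y \<in> M \<Longrightarrow> x * y \<in> M"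
  by (auto simp: finite_ring_def intro: int_span_0 int_span_add int_span_uminus)

lemma finite_ring_int: "finite_ring M \<Longrightarrow> of_int k \<in> M"
  unfolding finite_ring_def by (metis int_span_int mult.right_neutral)

lemma finite_ring_Ints: "finite_ring \<int>"
proof -
  have "int_span {1} = \<int>"
    by (auto simp: int_span_def Ints_def)
  then show ?thesis
    unfolding finite_ring_def by (auto intro!: exI[of _ "{1}"])
qed

text \<open>The determinant trick: \<open>y\<close> is an eigenvalue of an integer matrix.\<close>

lemma finite_ring_algebraic_int:
  assumes M: "finite_ring M" and y: "y \<in> M"
  shows "algebraic_int y"
proof -
  obtain B where B: "finite B" "M = int_span B"
    using M by (auto simp: finite_ring_def)
  obtain bs where bs: "set bs = B" "distinct bs"
    using finite_distinct_list[OF B(1)] by auto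
  define n where "n = length bs"
  have reindex: "(\<Sum>b\<in>B. h b) = (\<Sum>j<n. h (bs ! j))" for h :: "complex \<Rightarrow> complex"
    using sum.reindex_bij_betw[OF bij_betw_nth[OF bs(2), of "{..<n}" B], of h] bs n_def by auto
  have "\<exists>f. y * bs ! i = (\<Sum>b\<in>B. of_int (f b) * b)" if "i < n" for i
  proof -
    have "bs ! i \<in> M" using that bs B n_def by (auto intro: int_span_base)
    then have "y * bs ! i \<in> int_span B" using finite_ring_mult[OF M y] B by auto
    then show ?thesis by (auto simp: int_span_def)
  qed
  then obtain f where f: "\<And>i. i < n \<Longrightarrow> y * bs ! i = (\<Sum>b\<in>B. of_int (f i b) * b)"
    by metis
  define A where "A = mat n n (\<lambda>(i, j). f i (bs ! j))"
  define A' :: "complex mat" where "A' = map_mat of_int A"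
  define v where "v = vec n (\<lambda>i. bs ! i)"
  have A: "A \<in> carrier_mat n n" "A' \<in> carrier_mat n n" by (auto simp: A_def A'_def)
  have "A' *\<^sub>v v = y \<cdot>\<^sub>v v"
  proof (rule eq_vecI)
    fix i assume "i < dim_vec (y \<cdot>\<^sub>v v)"
    then have i: "i < n" by (simp add: v_def)
    then have "(A' *\<^sub>v v) $ i = (\<Sum>j = 0..<n. of_int (f i (bs ! j)) * bs ! j)"
      by (auto simp: A'_def A_def v_def scalar_prod_def intro!: sum.cong)
    also have "\<dots> = y * bs ! i"
      using f[OF i] by (simp add: reindex atLeast0LessThan)
    finally show "(A' *\<^sub>v v) $ i = (y \<cdot>\<^sub>v v) $ i"
      using i by (simp add: v_def)
  qed (use A in \<open>auto simp: v_def\<close>)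
  \<comment> \<open>An eigenvector has to be nonzero; here 1 is an integer combination of the
    entries of \<open>v\<close>.\<close>
  moreover have "v \<noteq> 0\<^sub>v n"
  proof
    assume "v = 0\<^sub>v n"
    then have "bs ! i = 0" if "i < n" for i
      using that by (metis index_vec index_zero_vec(1) v_def)
    then have "(\<Sum>b\<in>B. of_int (g b) * b) = 0" for g
      by (simp add: reindex)
    then have "1 \<notin> M" by (auto simp: B int_span_def)
    then show False using finite_ring_1[OF M] by simp
  qed
  ultimately have "eigenvalue A' y"
    unfolding eigenvalue_def eigenvector_def using A by (auto intro!: exI[of _ v] simp: v_def)
  then have "poly (char_poly A') y = 0"
    using eigenvalue_root_char_poly[OF A(2)] by simp
  moreover have "char_poly A' = map_poly of_int (char_poly A)"
    unfolding A'_def by (rule of_int_hom.char_poly_hom[OF A(1)])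
  moreover have "lead_coeff (char_poly A) = 1"
    using degree_monic_char_poly[OF A(1)] by simp
  ultimately show ?thesis
    by (auto simp: algebraic_int_altdef_ipoly)
qed

section \<open>Adjoining integral elements\<close>

lemma finite_ring_sum: "finite_ring M \<Longrightarrow> (\<And>i. i \<in> I \<Longrightarrow> f i \<in> M) \<Longrightarrow> sum f I \<in> M"
  by (induction I rule: infinite_finite_induct) (auto intro: finite_ring_0 finite_ring_add)

text \<open>The extension is \<open>M[y]\<close>. Division with remainder by the monic
  \<open>f\<close> bounds the degree in \<open>y\<close>, so the products of generators of
  \<open>M\<close> with finitely many powers of \<open>y\<close> generate it as an abelian
  group.\<close>

lemma finite_ring_extend:
  assumes M: "finite_ring M"
    and f: "\<And>i. coeff f i \<in> M" "lead_coeff f = 1" "poly f y = 0"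
  obtains M' where "finite_ring M'" "M \<subseteq> M'" "y \<in> M'"
proof -
  define M' where "M' = {poly p y | p. \<forall>i. coeff p i \<in> M}"
  obtain B where B: "finite B" "M = int_span B"
    using M by (auto simp: finite_ring_def)
  define n where "n = degree f"
  have npos: "n > 0"
  proof (rule ccontr)
    assume "\<not> n > 0"
    then have "degree f = 0" by (simp add: n_def)
    then obtain a where "f = [:a:]" by (rule degree_eq_zeroE)
    then show False using f by simp
  qed
  \<comment> \<open>Division by \<open>f\<close> is carried out by hand, because the coefficients
    must stay in the set \<open>M\<close>; each round cancels the leading term.\<close>
  have red: "\<exists>q. degree q < n \<and> (\<forall>i. coeff q i \<in> M) \<and> poly q y = poly p y"
    if "\<forall>i. coeff p i \<in> M" for p
    using that
  proof (induction "degree p" arbitrary: p rule: less_induct)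
    case less
    show ?case
    proof (cases "degree p < n")
      case True then show ?thesis using less.prems by blast
    next
      case False
      define g where "g = p - monom (lead_coeff p) (degree p - n) * f"
      have "\<forall>i. coeff g i \<in> M"
        using less.prems f(1) finite_ring_0[OF M]
        by (auto simp: g_def coeff_monom_mult diff_conv_add_uminus simp del: add_uminus_conv_diff
            intro!: finite_ring_add[OF M] finite_ring_uminus[OF M] finite_ring_mult[OF M])
      have "p \<noteq> 0" using False npos by auto
      have "f \<noteq> 0" using f(2) by auto
      have "degree g < degree p"
      proof (rule degree_lessI)
        show "g \<noteq> 0 \<or> 0 < degree p" using False npos by simp
        show "\<forall>k\<ge>degree p. coeff g k = 0"
        proof (intro allI impI)
          fix k assume k: "degree p \<le> k"
          show "coeff g k = 0"
          proof (cases "k = degree p")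
            case True
            then show ?thesis using False f(2) by (simp add: g_def coeff_monom_mult n_def)
          next
            case False
            then have "coeff p k = 0" "coeff f (k - (degree p - n)) = 0"
              using k \<open>\<not> degree p < n\<close> by (auto intro!: coeff_eq_0 simp: n_def)
            then show ?thesis by (simp add: g_def coeff_monom_mult)
          qed
        qed
      qed
      from less.hyps[OF this \<open>\<forall>i. coeff g i \<in> M\<close>] obtain q where
        "degree q < n" "\<forall>i. coeff q i \<in> M" "poly q y = poly g y" by blast
      moreover have "poly g y = poly p y" using f(3) by (simp add: g_def)
      ultimately show ?thesis by auto
    qed
  qed
  define C where "C = (\<lambda>(b, c). b * c) ` (B \<times> (\<lambda>i. y ^ i) ` {..<n})"
  have finC: "finite C" using B by (simp add: C_def)
  have ring: "a * b \<in> M'" if ab: "a \<in> M'" "b \<in> M'" for a b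
  proof -
    obtain p q where pq: "a = poly p y" "b = poly q y" "\<And>i. coeff p i \<in> M" "\<And>i. coeff q i \<in> M"
      using ab unfolding M'_def by blast
    then have "\<And>i. coeff (p * q) i \<in> M"
      by (auto simp: coeff_mult intro!: finite_ring_sum[OF M] finite_ring_mult[OF M])
    then show ?thesis unfolding M'_def using pq by (auto intro!: exI[of _ "p * q"])
  qed
  have const: "M \<subseteq> M'"
  proof
    fix a assume "a \<in> M"
    then show "a \<in> M'" unfolding M'_def using finite_ring_0[OF M]
      by (intro CollectI exI[of _ "[:a:]"]) (auto simp: coeff_pCons split: nat.splits)
  qed
  have yin: "y \<in> M'" unfolding M'_def using finite_ring_0[OF M] finite_ring_1[OF M]
      by (intro CollectI exI[of _ "[:0, 1:]"]) (auto simp: coeff_pCons split: nat.splits)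
  have "M' = int_span C"
  proof
    show "M' \<subseteq> int_span C"
    proof
      fix x assume "x \<in> M'"
      then obtain q where q: "degree q < n" "\<forall>i. coeff q i \<in> M" "x = poly q y"
        using red unfolding M'_def by (auto, metis)
      have "x = (\<Sum>i\<le>degree q. coeff q i * y ^ i)" by (simp add: q poly_altdef)
      also have "\<dots> \<in> int_span C"
        unfolding C_def
      proof (intro int_span_sum int_span_mult)
        fix i assume "i \<in> {..degree q}"
        then show "y ^ i \<in> int_span ((\<lambda>i. y ^ i) ` {..<n})"
          using q by (intro int_span_base) auto
      qed (use q B in auto)
      finally show "x \<in> int_span C" .
    qed
    have add: "a + b \<in> M'" if ab: "a \<in> M'" "b \<in> M'" for a b
    proof -
      obtain p q where pq: "a = poly p y" "b = poly q y" "\<And>i. coeff p i \<in> M" "\<And>i. coeff q i \<in> M"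
        using ab unfolding M'_def by blast
      then show ?thesis unfolding M'_def
        by (auto intro!: exI[of _ "p + q"] finite_ring_add[OF M])
    qed
    have sum: "(\<And>i. i \<in> I \<Longrightarrow> h i \<in> M') \<Longrightarrow> sum h I \<in> M'" for h :: "complex \<Rightarrow> complex" and I
      using const finite_ring_0[OF M]
      by (induction I rule: infinite_finite_induct) (auto intro: add)
    have pow: "y ^ i \<in> M'" for i
      using yin const finite_ring_1[OF M] by (induction i) (auto intro: ring)
    have "c \<in> M'" if "c \<in> C" for c
      using that pow const B int_span_base[OF B(1)] by (auto simp: C_def intro!: ring)
    then show "int_span C \<subseteq> M'"
      using finite_ring_int[OF M] const
      by (auto simp: int_span_def intro!: sum ring)
  qed
  then have "finite_ring M'"
    unfolding finite_ring_def using finC const finite_ring_1[OF M] ring by auto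
  then show ?thesis using that const yin by blast
qed

lemma finite_ring_extend_algebraic_int:
  assumes "finite_ring M" "algebraic_int y"
  obtains M' where "finite_ring M'" "M \<subseteq> M'" "y \<in> M'"
proof -
  obtain p where p: "lead_coeff p = 1" "\<forall>i. coeff p i \<in> \<int>" "poly p y = 0"
    using assms(2) by (auto simp: algebraic_int.simps)
  then have "coeff p i \<in> M" for i
    using finite_ring_int[OF assms(1)] by (metis Ints_cases)
  with p show ?thesis using finite_ring_extend[OF assms(1) _ p(1,3)] that by blast
qed

lemma finite_ring_containing:
  assumes "finite S" "\<And>x. x \<in> S \<Longrightarrow> algebraic_int x"
  obtains M where "finite_ring M" "S \<subseteq> M"
proof -
  have "\<exists>M. finite_ring M \<and> S \<subseteq> M" using assms
  proof (induction S rule: finite_induct)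
    case empty
    then show ?case using finite_ring_Ints by auto
  next
    case (insert x S)
    then obtain M where M: "finite_ring M" "S \<subseteq> M" by auto
    show ?case
      by (rule finite_ring_extend_algebraic_int[OF M(1), of x]) (use insert M in auto)
  qed
  then show ?thesis using that by blast
qed

lemma algebraic_int_add [intro]:
  fixes x y :: complex
  assumes "algebraic_int x" "algebraic_int y" shows "algebraic_int (x + y)"
  by (rule finite_ring_containing[of "{x, y}"])
    (use assms in \<open>auto intro: finite_ring_algebraic_int finite_ring_add\<close>)

lemma algebraic_int_mult [intro]:
  fixes x y :: complex
  assumes "algebraic_int x" "algebraic_int y" shows "algebraic_int (x * y)"
  by (rule finite_ring_containing[of "{x, y}"])
    (use assms in \<open>auto intro: finite_ring_algebraic_int finite_ring_mult\<close>)

text \<open>The finitely many coefficients lie in one finitely generated ring, over which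
  \<open>y\<close> satisfies a monic equation.\<close>

lemma algebraic_int_integral_closure:
  fixes y :: complex
  assumes "\<And>i. algebraic_int (coeff f i)" "lead_coeff f = 1" "poly f y = 0"
  shows "algebraic_int y"
proof -
  obtain M where M: "finite_ring M" "coeff f ` {..degree f} \<subseteq> M"
    using finite_ring_containing[of "coeff f ` {..degree f}"] assms by auto
  have "coeff f i \<in> M" for i
    using M finite_ring_0[OF M(1)] by (cases "i \<le> degree f") (auto simp: coeff_eq_0)
  then show ?thesis
    using finite_ring_extend[OF M(1) _ assms(2,3)] finite_ring_algebraic_int by metis
qed

text \<open>With \<open>c\<close> the leading coefficient and \<open>n\<close> the degree,
  \<open>c ^ (n - 1)\<close> times the equation for \<open>y\<close> is a monic equation for
  \<open>c * y\<close>. This yields the integrality of the Horner quotients that generate inverse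
  ideals.\<close>

lemma algebraic_int_lead_coeff_mult_root:
  fixes y :: complex
  assumes f: "\<And>i. algebraic_int (coeff f i)" and y: "poly f y = 0"
  shows "algebraic_int (lead_coeff f * y)"
proof (cases "degree f = 0")
  case True
  then obtain a where a: "f = [:a:]" by (rule degree_eq_zeroE)
  then show ?thesis using y by simp
next
  case False
  define n where "n = degree f"
  define c where "c = lead_coeff f"
  have n: "n > 0" and c: "c \<noteq> 0" using False by (auto simp: n_def c_def)
  \<comment> \<open>The exponent \<open>n - 1 - i\<close> is what remains of
    \<open>c ^ (n - 1)\<close> once \<open>c ^ i\<close> is absorbed into
    \<open>(c * y) ^ i\<close>; in degree \<open>n\<close> the leading coefficient supplies the
    missing factor.\<close>
  define g where "g = monom 1 n + (\<Sum>i<n. monom (coeff f i * c ^ (n - 1 - i)) i)"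
  have coeff_g: "coeff g i = (if i = n then 1 else if i < n then coeff f i * c ^ (n - 1 - i) else 0)" for i
  proof -
    have "coeff (\<Sum>i<n. monom (coeff f i * c ^ (n - 1 - i)) i) i
        = (\<Sum>j<n. if j = i then coeff f j * c ^ (n - 1 - j) else 0)"
      by (simp add: coeff_sum)
    also have "\<dots> = (if i < n then coeff f i * c ^ (n - 1 - i) else 0)"
      by simp
    finally show ?thesis by (auto simp: g_def)
  qed
  have deg: "degree g = n"
    by (intro antisym degree_le le_degree) (auto simp: coeff_g)
  have pw: "algebraic_int (c ^ k)" for k
    using f[of n] by (induction k) (auto simp: c_def n_def)
  have "poly g (c * y) = (\<Sum>i\<le>n. coeff g i * (c * y) ^ i)"
    by (simp add: poly_altdef deg)
  also have "\<dots> = (\<Sum>i\<le>n. c ^ (n - 1) * (coeff f i * y ^ i))"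
  proof (intro sum.cong refl)
    fix i assume i: "i \<in> {..n}"
    show "coeff g i * (c * y) ^ i = c ^ (n - 1) * (coeff f i * y ^ i)"
    proof (cases "i = n")
      case True
      have "c ^ n = c ^ (n - 1) * c" using n by (cases n) auto
      then show ?thesis using True by (simp add: coeff_g power_mult_distrib c_def n_def)
    next
      case False
      with i have "i < n" by simp
      then have "c ^ (n - 1) = c ^ (n - 1 - i) * c ^ i" by (simp flip: power_add)
      then show ?thesis using \<open>i < n\<close> by (simp add: coeff_g power_mult_distrib)
    qed
  qed
  also have "\<dots> = c ^ (n - 1) * poly f y"
    by (simp add: poly_altdef n_def sum_distrib_left)
  finally have "poly g (c * y) = 0" by (simp add: y)
  moreover have "algebraic_int (coeff g i)" for i
    by (auto simp: coeff_g intro!: f pw)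
  moreover have "lead_coeff g = 1" by (simp add: deg coeff_g)
  ultimately show ?thesis unfolding c_def[symmetric]
    using algebraic_int_integral_closure[of g "c * y"] by blast
qed

section \<open>Fractional ideals form a group\<close>

lemma submod_gen: "submod R scale (gen R scale S)"
  unfolding gen_def by (rule hull_in) (auto simp: submod_def)

lemma gen_superset: "S \<subseteq> gen R scale S"
  unfolding gen_def by (rule hull_subset)

lemma gen_base: "x \<in> S \<Longrightarrow> x \<in> gen R scale S"
  using gen_superset by blast

lemma gen_least: "S \<subseteq> M \<Longrightarrow> submod R scale M \<Longrightarrow> gen R scale S \<subseteq> M"
  unfolding gen_def by (rule hull_minimal)

lemma gen_mono: "S \<subseteq> T \<Longrightarrow> gen R scale S \<subseteq> gen R scale T"
  unfolding gen_def by (rule hull_mono)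

lemma gen_submod: "submod R scale M \<Longrightarrow> gen R scale M = M"
  by (intro subset_antisym gen_least gen_superset subset_refl)

lemma submod_0: "submod R scale M \<Longrightarrow> 0 \<in> M"
  and submod_add: "submod R scale M \<Longrightarrow> x \<in> M \<Longrightarrow> y \<in> M \<Longrightarrow> x + y \<in> M"
  and submod_scale: "submod R scale M \<Longrightarrow> a \<in> R \<Longrightarrow> x \<in> M \<Longrightarrow> scale a x \<in> M"
  by (auto simp: submod_def)

lemma gen_Un: "gen R scale (gen R scale S \<union> gen R scale T) = gen R scale (S \<union> T)"
proof
  show "gen R scale (gen R scale S \<union> gen R scale T) \<subseteq> gen R scale (S \<union> T)"
    by (intro gen_least Un_least gen_mono submod_gen) auto
  show "gen R scale (S \<union> T) \<subseteq> gen R scale (gen R scale S \<union> gen R scale T)"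
    by (intro gen_mono Un_mono gen_superset)
qed

lemma gen_Diff_zero: "gen R scale (S - {0}) = gen R scale S"
proof
  show "gen R scale S \<subseteq> gen R scale (S - {0})"
    by (rule gen_least) (auto intro: gen_base submod_gen submod_0)
  show "gen R scale (S - {0}) \<subseteq> gen R scale S"
    by (rule gen_mono) auto
qed

text \<open>The twist \<open>\<sigma>\<close> of the scalars covers linear and conjugate-linear maps
  at once; it is later taken to be the identity or complex conjugation.\<close>

lemma submod_linear_preimage:
  fixes f :: "'v::ab_group_add \<Rightarrow> 'w::ab_group_add"
  assumes "\<And>x y. f (x + y) = f x + f y"
    and "\<And>a x. a \<in> R \<Longrightarrow> f (scale a x) = scale' (\<sigma> a) (f x)"
    and "\<sigma> ` R \<subseteq> R'" and "submod R' scale' M"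
  shows "submod R scale {x. f x \<in> M}"
proof -
  have "f 0 = 0" using assms(1)[of 0 0] by simp
  then show ?thesis using assms unfolding submod_def by auto
qed

lemma submod_linear_image:
  fixes f :: "'v::ab_group_add \<Rightarrow> 'w::ab_group_add"
  assumes "\<And>x y. f (x + y) = f x + f y"
    and "\<And>a x. a \<in> R \<Longrightarrow> f (scale a x) = scale' (\<sigma> a) (f x)"
    and "R' \<subseteq> \<sigma> ` R" and "submod R scale M"
  shows "submod R' scale' (f ` M)"
proof -
  have 0: "f 0 = 0" using assms(1)[of 0 0] by simp
  have "scale' (\<sigma> a) (f x) \<in> f ` M" if "a \<in> R" "x \<in> M" for a x
    using assms(2)[OF that(1), of x] assms(4) that by (metis imageI submod_scale)
  moreover have "f x + f y \<in> f ` M" if "x \<in> M" "y \<in> M" for x y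
    using assms(1)[of x y] assms(4) that by (metis imageI submod_add)
  moreover have "0 \<in> f ` M"
    using 0 submod_0[OF assms(4)] by force
  ultimately show ?thesis using assms(3) unfolding submod_def by auto
qed

lemma gen_linear_image:
  fixes f :: "'v::ab_group_add \<Rightarrow> 'w::ab_group_add"
  assumes f: "\<And>x y. f (x + y) = f x + f y"
    "\<And>a x. a \<in> R \<Longrightarrow> f (scale a x) = scale' (\<sigma> a) (f x)"
    and \<sigma>: "\<sigma> ` R = R'"
  shows "f ` gen R scale S = gen R' scale' (f ` S)"
proof
  have "gen R scale S \<subseteq> {x. f x \<in> gen R' scale' (f ` S)}"
    using submod_linear_preimage[where f = f and \<sigma> = \<sigma> and scale = scale and scale' = scale', OF f(1) f(2)] \<sigma>
    by (intro gen_least) (auto intro: gen_base submod_gen)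
  then show "f ` gen R scale S \<subseteq> gen R' scale' (f ` S)" by auto
  show "gen R' scale' (f ` S) \<subseteq> f ` gen R scale S"
    using submod_linear_image[where f = f and \<sigma> = \<sigma> and scale = scale and scale' = scale', OF f(1) f(2)] \<sigma>
    by (intro gen_least) (auto intro: gen_base submod_gen)
qed

lemma fin_gen_linear_image:
  fixes f :: "'v::ab_group_add \<Rightarrow> 'w::ab_group_add"
  assumes "\<And>x y. f (x + y) = f x + f y"
    "\<And>a x. a \<in> R \<Longrightarrow> f (scale a x) = scale' (\<sigma> a) (f x)"
    "\<sigma> ` R = R'" "fin_gen R scale M"
  shows "fin_gen R' scale' (f ` M)"
  using gen_linear_image[where f = f and \<sigma> = \<sigma> and scale = scale and scale' = scale', OF assms(1) assms(2) assms(3)]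
    assms(4) unfolding fin_gen_def by blast

definition set_prod :: "complex set \<Rightarrow> complex set \<Rightarrow> complex set" where
  "set_prod S T = {a * b | a b. a \<in> S \<and> b \<in> T}"

lemma bex_set_prod: "(\<exists>x\<in>set_prod S T. P x) \<longleftrightarrow> (\<exists>a\<in>S. \<exists>b\<in>T. P (a * b))"
  unfolding set_prod_def by blast

lemma mem_set_prod: "x \<in> set_prod S T \<longleftrightarrow> (\<exists>a\<in>S. \<exists>b\<in>T. x = a * b)"
  unfolding set_prod_def by blast

lemma set_prod_commute: "set_prod S T = set_prod T S"
  unfolding set_eq_iff mem_set_prod by (metis mult.commute)

lemma set_prod_assoc: "set_prod (set_prod S T) U = set_prod S (set_prod T U)"
  unfolding set_eq_iff mem_set_prod[of _ "set_prod S T"] mem_set_prod[of _ S] bex_set_prod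
  by (simp add: mult.assoc)

lemma set_prod_Un: "set_prod S (T \<union> U) = set_prod S T \<union> set_prod S U"
  "set_prod (T \<union> U) S = set_prod T S \<union> set_prod U S"
  unfolding set_prod_def by blast+

lemma set_prod_left_commute: "set_prod S (set_prod T U) = set_prod T (set_prod S U)"
  by (metis set_prod_assoc set_prod_commute)

text \<open>For numbers, \<open>(a + b + c) (a b + b c + c a)\<close> and
  \<open>(a + b) (b + c) (c + a)\<close> differ by \<open>a b c\<close>. Union is idempotent, so
  multiplicities disappear and the two sides agree for sets of generators.\<close>

lemma set_prod_cyclic:
  "set_prod (S \<union> T \<union> U) (set_prod S T \<union> set_prod T U \<union> set_prod U S)
    = set_prod (S \<union> T) (set_prod (T \<union> U) (U \<union> S))"
  unfolding set_prod_Un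
  by (simp only: set_prod_assoc set_prod_commute set_prod_left_commute Un_ac Un_absorb Un_left_absorb)

lemma finite_set_prod: "finite S \<Longrightarrow> finite T \<Longrightarrow> finite (set_prod S T)"
  unfolding set_prod_def by (rule finite_image_set2) auto

section \<open>The ring of integers and products of its modules\<close>

locale number_ring =
  fixes K :: "complex set"
  assumes K: "number_field K"
begin

abbreviation ring_ints ("\<O>") where "\<O> \<equiv> ints_of K"
abbreviation ideal_times (infixl "\<star>" 70) where "A \<star> B \<equiv> ideal_mult K (*) A B"
abbreviation ideal_gen where "ideal_gen S \<equiv> gen \<O> (*) S"
abbreviation submodule where "submodule A \<equiv> submod \<O> (*) (A :: complex set)"

lemma K_1: "1 \<in> K" and K_diff: "x \<in> K \<Longrightarrow> y \<in> K \<Longrightarrow> x - y \<in> K"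
  and K_mult: "x \<in> K \<Longrightarrow> y \<in> K \<Longrightarrow> x * y \<in> K" and K_inverse: "x \<in> K \<Longrightarrow> inverse x \<in> K"
  using K unfolding number_field_def by auto

lemma K_0: "0 \<in> K" using K_diff[OF K_1 K_1] by simp
lemma K_uminus: "x \<in> K \<Longrightarrow> - x \<in> K" using K_diff[OF K_0] by simp
lemma K_add: "x \<in> K \<Longrightarrow> y \<in> K \<Longrightarrow> x + y \<in> K" using K_diff[of x "- y"] K_uminus[of y] by simp
lemma K_divide: "x \<in> K \<Longrightarrow> y \<in> K \<Longrightarrow> x / y \<in> K" by (simp add: divide_inverse K_mult K_inverse)
lemma K_power: "x \<in> K \<Longrightarrow> x ^ n \<in> K" by (induction n) (auto intro: K_1 K_mult)
lemma K_of_nat: "of_nat n \<in> K" by (induction n) (auto intro: K_0 K_1 K_add)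
lemma K_of_int: "of_int n \<in> K" by (cases n rule: int_cases2) (auto intro: K_of_nat K_uminus)

text \<open>\<open>K\<close> has finite dimension over the rationals, so enough powers of
  \<open>x\<close> are dependent. The case of two equal powers is split off because dependence
  speaks of the set of powers and not of the family.\<close>

lemma K_algebraic:
  assumes x: "x \<in> K"
  shows "algebraic x"
proof -
  interpret Q: vector_space "\<lambda>(q::rat) (x::complex). of_rat q * x"
    by unfold_locales (auto simp: algebra_simps of_rat_add of_rat_mult)
  obtain B where B: "finite B" "Q.span B = K"
    using K unfolding number_field_def by auto
  define n where "n = card B"
  show ?thesis
  proof (cases "inj_on (\<lambda>i. x ^ i) {..n}")
    case True
    have "Q.dependent ((\<lambda>i. x ^ i) ` {..n})"
    proof (rule ccontr)
      assume "Q.independent ((\<lambda>i. x ^ i) ` {..n})"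
      moreover have "(\<lambda>i. x ^ i) ` {..n} \<subseteq> Q.span B"
        using B x K_power by auto
      ultimately have "card ((\<lambda>i. x ^ i) ` {..n}) \<le> n"
        using Q.independent_span_bound[OF B(1)] n_def by auto
      then show False using True by (simp add: card_image)
    qed
    then obtain u where u: "\<exists>v\<in>(\<lambda>i. x ^ i) ` {..n}. u v \<noteq> 0"
      "(\<Sum>v\<in>(\<lambda>i. x ^ i) ` {..n}. of_rat (u v) * v) = 0"
      using Q.dependent_finite[of "(\<lambda>i. x ^ i) ` {..n}"] by auto
    define p where "p = (\<Sum>i\<le>n. monom (of_rat (u (x ^ i)) :: complex) i)"
    have cp: "coeff p i = (if i \<le> n then of_rat (u (x ^ i)) else 0)" for i
      by (simp add: p_def coeff_sum)
    have "poly p x = (\<Sum>i\<le>n. of_rat (u (x ^ i)) * x ^ i)"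
      by (simp add: p_def poly_sum poly_monom)
    also have "\<dots> = 0"
      using u(2) True by (simp add: sum.reindex)
    finally have "poly p x = 0" .
    moreover have "p \<noteq> 0"
    proof
      assume "p = 0"
      then have "u (x ^ i) = 0" if "i \<le> n" for i
        using cp[of i] that by simp
      then show False using u(1) by auto
    qed
    ultimately show ?thesis
      by (intro algebraicI'[of p]) (auto simp: cp)
  next
    case False
    then obtain i j where ij: "i < j" "x ^ i = x ^ j"
      unfolding inj_on_def by (metis linorder_neqE_nat)
    define p where "p = monom (1::complex) j - monom 1 i"
    have "coeff p j = 1" using ij by (simp add: p_def)
    then have "p \<noteq> 0" by auto
    moreover have "poly p x = 0" using ij by (simp add: p_def poly_monom)
    ultimately show ?thesis
      by (intro algebraicI[of p]) (auto simp: p_def)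
  qed
qed

lemma O_subset_K: "\<O> \<subseteq> K" by (auto simp: ints_of_def)
lemma O_0: "0 \<in> \<O>" by (auto simp: ints_of_def K_0)
lemma O_of_int: "of_int n \<in> \<O>" by (auto simp: ints_of_def K_of_int algebraic_int_of_int)
lemma O_1: "1 \<in> \<O>" using O_of_int[of 1] by simp
lemma O_add: "x \<in> \<O> \<Longrightarrow> y \<in> \<O> \<Longrightarrow> x + y \<in> \<O>" by (auto simp: ints_of_def K_add)
lemma O_mult: "x \<in> \<O> \<Longrightarrow> y \<in> \<O> \<Longrightarrow> x * y \<in> \<O>" by (auto simp: ints_of_def K_mult)
lemma O_uminus: "x \<in> \<O> \<Longrightarrow> - x \<in> \<O>" by (auto simp: ints_of_def K_uminus)
lemma O_diff: "x \<in> \<O> \<Longrightarrow> y \<in> \<O> \<Longrightarrow> x - y \<in> \<O>" using O_add[of x "- y"] O_uminus[of y] by simp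
lemma O_power: "x \<in> \<O> \<Longrightarrow> x ^ n \<in> \<O>" by (induction n) (auto intro: O_1 O_mult)
lemma O_sum: "(\<And>i. i \<in> I \<Longrightarrow> f i \<in> \<O>) \<Longrightarrow> sum f I \<in> \<O>"
  by (induction I rule: infinite_finite_induct) (auto intro: O_0 O_add)

lemma submodule_O: "submodule \<O>"
  by (auto simp: submod_def O_0 O_add O_mult)

lemma submodule_K: "submodule K"
  using O_subset_K by (auto simp: submod_def K_0 K_add K_mult)

lemma submodule_uminus: "submodule A \<Longrightarrow> x \<in> A \<Longrightarrow> - x \<in> A"
  using submod_scale[of \<O> "(*)" A "-1" x] O_uminus[OF O_1] by simp

lemma submodule_diff: "submodule A \<Longrightarrow> x \<in> A \<Longrightarrow> y \<in> A \<Longrightarrow> x - y \<in> A"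
  using submod_add[of \<O> "(*)" A x "- y"] submodule_uminus by simp

lemma submodule_quotient: "submodule A \<Longrightarrow> submodule {y. x * y \<in> A}"
  by (rule submod_linear_preimage[where \<sigma> = id and R' = \<O>]) (auto simp: algebra_simps)

lemma ideal_mult_conv: "A \<star> B = ideal_gen (set_prod A B)"
  by (simp add: ideal_mult_def set_prod_def)

text \<open>With one factor fixed, the numbers whose product with it lies in \<open>M\<close> form a
  module; applying this to each factor in turn reduces the claim to generators.\<close>

lemma ideal_gen_prod_least:
  assumes "submodule M" "\<And>s t. s \<in> S \<Longrightarrow> t \<in> T \<Longrightarrow> s * t \<in> M"
    and "x \<in> ideal_gen S" "y \<in> ideal_gen T"
  shows "x * y \<in> M"
proof -
  have 1: "s * y \<in> M" if "s \<in> S" for s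
    using gen_least[of T "{y. s * y \<in> M}", OF _ submodule_quotient[OF assms(1)]] assms that by auto
  show ?thesis
    using gen_least[of S "{x. y * x \<in> M}", OF _ submodule_quotient[OF assms(1)]] assms 1
    by (auto simp: mult.commute)
qed

lemma ideal_mult_least:
  assumes "submodule M" "\<And>a b. a \<in> A \<Longrightarrow> b \<in> B \<Longrightarrow> a * b \<in> M"
  shows "A \<star> B \<subseteq> M"
  unfolding ideal_mult_def using assms by (intro gen_least) auto

lemma ideal_mult_base: "a \<in> A \<Longrightarrow> b \<in> B \<Longrightarrow> a * b \<in> A \<star> B"
  unfolding ideal_mult_def by (rule gen_base) auto

lemma submodule_ideal_mult: "submodule (A \<star> B)"
  unfolding ideal_mult_def by (rule submod_gen)

lemma ideal_gen_mult: "ideal_gen S \<star> ideal_gen T = ideal_gen (set_prod S T)"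
proof
  show "ideal_gen S \<star> ideal_gen T \<subseteq> ideal_gen (set_prod S T)"
  proof (rule ideal_mult_least[OF submod_gen])
    fix a b assume "a \<in> ideal_gen S" "b \<in> ideal_gen T"
    then show "a * b \<in> ideal_gen (set_prod S T)"
      by (rule ideal_gen_prod_least[OF submod_gen, rotated]) (auto simp: set_prod_def intro: gen_base)
  qed
  show "ideal_gen (set_prod S T) \<subseteq> ideal_gen S \<star> ideal_gen T"
    unfolding ideal_mult_conv
    by (rule gen_mono) (auto simp: set_prod_def intro: gen_base)
qed

lemma ideal_mult_commute: "A \<star> B = B \<star> A"
  by (simp add: ideal_mult_conv set_prod_commute)

lemma ideal_mult_gen_left: "ideal_gen X \<star> Y = ideal_gen (set_prod X Y)"
proof
  have "ideal_gen X \<star> Y \<subseteq> ideal_gen X \<star> ideal_gen Y"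
    by (rule ideal_mult_least[OF submodule_ideal_mult]) (auto intro: ideal_mult_base gen_base)
  then show "ideal_gen X \<star> Y \<subseteq> ideal_gen (set_prod X Y)"
    by (simp only: ideal_gen_mult)
  show "ideal_gen (set_prod X Y) \<subseteq> ideal_gen X \<star> Y"
    unfolding ideal_mult_conv by (rule gen_mono) (auto simp: set_prod_def intro: gen_base)
qed

lemma ideal_mult_gen_right: "Y \<star> ideal_gen X = ideal_gen (set_prod Y X)"
  unfolding ideal_mult_commute[of Y "ideal_gen X"] set_prod_commute[of Y X] by (rule ideal_mult_gen_left)

lemma ideal_mult_assoc: "(A \<star> B) \<star> C = A \<star> (B \<star> C)"
  unfolding ideal_mult_conv[of A B] ideal_mult_conv[of B C]
  by (simp only: ideal_mult_gen_left ideal_mult_gen_right set_prod_assoc)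

lemma ideal_mult_left_commute: "A \<star> (B \<star> C) = B \<star> (A \<star> C)"
  by (simp only: ideal_mult_assoc[symmetric] ideal_mult_commute[of A B])

lemmas ideal_mult_ac = ideal_mult_assoc ideal_mult_commute ideal_mult_left_commute

lemma ideal_mult_mono: "A \<subseteq> A' \<Longrightarrow> B \<subseteq> B' \<Longrightarrow> A \<star> B \<subseteq> A' \<star> B'"
  by (rule ideal_mult_least[OF submodule_ideal_mult]) (auto intro: ideal_mult_base)

lemma ideal_mult_O_left: "submodule A \<Longrightarrow> \<O> \<star> A = A"
proof
  assume A: "submodule A"
  show "\<O> \<star> A \<subseteq> A"
    by (rule ideal_mult_least[OF A]) (auto intro: submod_scale[OF A])
  show "A \<subseteq> \<O> \<star> A"
    using ideal_mult_base[OF O_1, of _ A] by auto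
qed

lemma ideal_mult_O_right: "submodule A \<Longrightarrow> A \<star> \<O> = A"
  by (simp add: ideal_mult_commute[of A] ideal_mult_O_left)

lemma ideal_mult_subset_K: "A \<subseteq> K \<Longrightarrow> B \<subseteq> K \<Longrightarrow> A \<star> B \<subseteq> K"
  by (rule ideal_mult_least[OF submodule_K]) (auto intro: K_mult)

lemma ideal_mult_Un: "A \<star> ideal_gen (B \<union> C) = ideal_gen (A \<star> B \<union> A \<star> C)"
  by (simp only: ideal_mult_gen_right set_prod_Un ideal_mult_conv[of A B] ideal_mult_conv[of A C] gen_Un)

lemma gen_O_1: "ideal_gen {1} = \<O>"
proof
  show "ideal_gen {1} \<subseteq> \<O>" using O_1 by (intro gen_least submodule_O) auto
  show "\<O> \<subseteq> ideal_gen {1}"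
    using submod_scale[OF submod_gen[of \<O> "(*)" "{1}"] _ gen_base[of 1 "{1}"]] by auto
qed

text \<open>The least positive integer \<open>g\<close> in \<open>J\<close> divides every integer in
  \<open>J\<close> by division with remainder, hence every coefficient of \<open>h\<close> and so
  the content.\<close>

lemma one_in_submodule:
  assumes J: "submodule J" and h: "\<And>i. of_int (coeff h i) \<in> J" "content h = 1"
  shows "1 \<in> J"
proof -
  define P where "P = (\<lambda>n::nat. n > 0 \<and> of_nat n \<in> J)"
  have "h \<noteq> 0" using h(2) by auto
  then obtain i where "coeff h i \<noteq> 0" by (metis leading_coeff_0_iff)
  then have "P (nat \<bar>coeff h i\<bar>)"
    using h(1)[of i] submodule_uminus[OF J h(1)[of i]] by (auto simp: P_def abs_if)
  define g where "g = (LEAST n. P n)"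
  have g: "P g" unfolding g_def by (rule LeastI) fact
  have "int g dvd coeff h i" for i
  proof (rule ccontr)
    assume nd: "\<not> int g dvd coeff h i"
    define m where "m = coeff h i mod int g"
    have m: "0 < m" "m < int g"
      using nd g by (auto simp: m_def P_def dvd_eq_mod_eq_0 order.not_eq_order_implies_strict)
    have "of_int m = of_int (coeff h i) - of_int (coeff h i div int g) * (of_nat g :: complex)"
      unfolding m_def by (simp add: minus_div_mult_eq_mod[symmetric])
    also have "\<dots> \<in> J"
      using g h(1) O_of_int by (intro submodule_diff[OF J] submod_scale[OF J]) (auto simp: P_def)
    finally have "P (nat m)" using m by (simp add: P_def)
    then have "g \<le> nat m" unfolding g_def by (rule Least_le)
    then show False using m by linarith
  qed
  then have "int g dvd content h"
    by (simp add: const_poly_dvd_iff_dvd_content[symmetric] const_poly_dvd_iff)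
  then have "g = 1" using h(2) by simp
  then show ?thesis using g by (simp add: P_def)
qed


text \<open>The inverse of \<open>(1, t)\<close> is generated by the Horner quotients \<open>s j\<close> of a primitive
  integer polynomial with root \<open>t\<close>: both \<open>s j\<close> and \<open>t * s (j + 1) = s j - h j\<close> are integral,
  and the coefficients \<open>h j\<close> are coprime.\<close>

lemma ideal_gen_one_t_invertible:
  assumes t: "t \<in> K"
  obtains Q where "finite Q" "Q \<subseteq> K" "ideal_gen {1, t} \<star> ideal_gen Q = \<O>"
proof -
  obtain p where p: "\<And>i. coeff p i \<in> \<int>" "p \<noteq> 0" "poly p t = 0"
    using K_algebraic[OF t] by (auto simp: algebraic_def)
  obtain f where f: "\<And>i. coeff p i = of_int (f i)"
  proof -
    have "\<forall>i. \<exists>z. coeff p i = of_int z" using p(1) by (auto elim!: Ints_cases)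
    then show thesis using that by (auto dest: choice)
  qed
  define h0 where "h0 = (\<Sum>i\<le>degree p. monom (f i) i)"
  have "coeff h0 i = f i" for i
    using f[of i] by (cases "i \<le> degree p") (auto simp: h0_def coeff_sum coeff_eq_0)
  then have h0: "map_poly of_int h0 = p"
    by (intro poly_eqI) (simp add: coeff_map_poly f)
  have "h0 \<noteq> 0" using h0 p(2) by auto
  define h where "h = primitive_part h0"
  have hc: "content h = 1" using \<open>h0 \<noteq> 0\<close> by (simp add: h_def)
  define H :: "complex poly" where "H = map_poly of_int h"
  have cH: "coeff H i = of_int (coeff h i)" for i by (simp add: H_def coeff_map_poly)
  have "p = smult (of_int (content h0)) H"
  proof (rule poly_eqI)
    fix i
    have "coeff h0 i = content h0 * coeff h i"
      unfolding h_def by (metis coeff_smult content_times_primitive_part)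
    then show "coeff p i = coeff (smult (of_int (content h0)) H) i"
      by (simp add: cH coeff_map_poly flip: h0)
  qed
  then have Ht: "poly H t = 0" using p(3) \<open>h0 \<noteq> 0\<close> by simp
  \<comment> \<open>\<open>poly_shift j\<close> drops the lowest \<open>j\<close> coefficients and
    divides by the corresponding power, so \<open>s j\<close> is the \<open>j\<close>-th partial
    value in Horner's scheme at \<open>t\<close>.\<close>
  define s where "s j = poly (poly_shift j H) t" for j
  have s_step: "s j = t * s (Suc j) + coeff H j" for j
  proof -
    have "poly_shift j H = pCons (coeff H j) (poly_shift (Suc j) H)"
      by (rule poly_eqI) (auto simp: coeff_poly_shift coeff_pCons split: nat.splits)
    then show ?thesis by (simp add: s_def)
  qed
  have s0: "s 0 = 0" using Ht by (simp add: s_def poly_shift_0)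
  have s_big: "s j = 0" if "j > degree H" for j
  proof -
    have "poly_shift j H = 0"
      by (rule poly_eqI) (use that in \<open>auto simp: coeff_poly_shift intro!: coeff_eq_0\<close>)
    then show ?thesis by (simp add: s_def)
  qed
  have partial: "(\<Sum>i<m. coeff H i * t ^ i) + s m * t ^ m = 0" for m
  proof (induction m)
    case (Suc m)
    have "s m * t ^ m = coeff H m * t ^ m + s (Suc m) * t ^ Suc m"
      using s_step[of m] by (simp add: algebra_simps)
    with Suc show ?case by (simp only: sum.lessThan_Suc add.assoc)
  qed (simp add: s0)
  have s_int: "algebraic_int (s j)" for j
  proof (cases "j \<le> Suc (degree H)")
    case True
    then show ?thesis
    proof (induction j rule: inc_induct)
      case base
      then show ?case using s_big by simp
    next
      case (step n)
      have "algebraic_int (s (Suc n) * t)"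
      proof (cases "s (Suc n) = 0")
        case False
        \<comment> \<open>Collecting all terms of degree above \<open>n\<close> turns
          \<open>H\<close> into a polynomial of degree \<open>Suc n\<close> that still has the root
          \<open>t\<close>, now with leading coefficient \<open>s (Suc n)\<close>. Hence
          \<open>s (Suc n) * t\<close> is integral.\<close>
        define G where "G = (\<Sum>i<Suc n. monom (coeff H i) i) + monom (s (Suc n)) (Suc n)"
        have cG: "coeff G i = (if i < Suc n then coeff H i else if i = Suc n then s (Suc n) else 0)" for i
          by (auto simp: G_def coeff_sum)
        have deg: "degree G = Suc n"
          by (intro antisym degree_le le_degree) (use False in \<open>auto simp: cG\<close>)
        have "poly G t = 0"
          using partial[of "Suc n"] by (simp add: G_def poly_sum poly_monom del: sum.lessThan_Suc)
        moreover have "algebraic_int (coeff G i)" for i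
          using step.IH by (auto simp: cG cH algebraic_int_of_int)
        ultimately show ?thesis
          using algebraic_int_lead_coeff_mult_root[of G t] by (simp add: deg cG)
      qed simp
      then show ?case
        using s_step[of n] by (auto simp: cH mult.commute algebraic_int_of_int)
    qed
  next
    case False
    then show ?thesis using s_big by simp
  qed
  have sK: "s j \<in> K" for j
  proof (cases "j \<le> Suc (degree H)")
    case True
    then show ?thesis
    proof (induction j rule: inc_induct)
      case (step n)
      then show ?case
        using s_step[of n] cH K_of_int t by (auto intro: K_add K_mult)
    qed (simp add: s_big K_0)
  qed (auto simp: s_big K_0)
  have sO: "s j \<in> \<O>" for j using s_int sK by (auto simp: ints_of_def)
  have tsO: "t * s (Suc j) \<in> \<O>" for j
  proof -
    have "t * s (Suc j) = s j - coeff H j" using s_step[of j] by simp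
    then show ?thesis using O_diff[OF sO O_of_int] cH by simp
  qed
  define Q where "Q = (\<lambda>j. s (Suc j)) ` {..degree H}"
  let ?J = "ideal_gen {1, t} \<star> ideal_gen Q"
  have inJ: "s (Suc j) \<in> ?J" "t * s (Suc j) \<in> ?J" for j
  proof -
    have "s (Suc j) \<in> ideal_gen Q"
    proof (cases "j \<le> degree H")
      case True then show ?thesis by (auto simp: Q_def intro: gen_base)
    next
      case False
      then show ?thesis using s_big by (auto intro: submod_0[OF submod_gen])
    qed
    then show "s (Suc j) \<in> ?J" "t * s (Suc j) \<in> ?J"
      using ideal_mult_base[of 1 "ideal_gen {1, t}" "s (Suc j)"]
        ideal_mult_base[of t "ideal_gen {1, t}" "s (Suc j)"] by (auto intro: gen_base)
  qed
  have "of_int (coeff h i) \<in> ?J" for i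
  proof -
    have "of_int (coeff h i) = s i - t * s (Suc i)" using s_step[of i] by (simp add: cH)
    moreover have "s i \<in> ?J"
      using inJ s0 submod_0[OF submodule_ideal_mult] by (cases i) auto
    ultimately show ?thesis
      using inJ by (simp add: submodule_diff[OF submodule_ideal_mult])
  qed
  then have "1 \<in> ?J" using one_in_submodule[OF submodule_ideal_mult _ hc] by blast
  then have "\<O> \<subseteq> ?J"
    using submod_scale[OF submodule_ideal_mult, of _ 1] by fastforce
  moreover have "?J \<subseteq> \<O>"
  proof (rule ideal_mult_least[OF submodule_O])
    fix a b assume "a \<in> ideal_gen {1, t}" "b \<in> ideal_gen Q"
    then show "a * b \<in> \<O>"
      by (rule ideal_gen_prod_least[OF submodule_O, rotated]) (auto simp: Q_def sO tsO)
  qed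
  ultimately have "?J = \<O>" by blast
  then show ?thesis
    using that[of Q] sK by (auto simp: Q_def)
qed

text \<open>Dividing by the nonzero \<open>x\<close> reduces to the generators 1 and
  \<open>y / x\<close>.\<close>

lemma ideal_gen_pair_invertible:
  assumes "x \<in> K" "y \<in> K" "x \<noteq> 0"
  shows "\<exists>Q. finite Q \<and> Q \<subseteq> K \<and> ideal_gen {x, y} \<star> ideal_gen Q = \<O>"
proof -
  obtain Q where Q: "finite Q" "Q \<subseteq> K" "ideal_gen {1, y / x} \<star> ideal_gen Q = \<O>"
    using ideal_gen_one_t_invertible[of "y / x"] assms K_divide by metis
  have "ideal_gen {x, y} \<star> ideal_gen (set_prod {inverse x} Q)
      = ideal_gen (set_prod (set_prod {x, y} {inverse x}) Q)"
    by (simp add: ideal_gen_mult set_prod_assoc)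
  also have "set_prod {x, y} {inverse x} = {1, y / x}"
    using assms(3) by (auto simp: set_prod_def divide_inverse intro: exI[of _ x] exI[of _ y])
  finally have "ideal_gen {x, y} \<star> ideal_gen (set_prod {inverse x} Q) = \<O>"
    using Q(3) by (simp add: ideal_gen_mult)
  moreover have "finite (set_prod {inverse x} Q)" "set_prod {inverse x} Q \<subseteq> K"
    using Q assms by (auto intro: finite_set_prod simp: set_prod_def K_mult K_inverse)
  ultimately show ?thesis by blast
qed

text \<open>Reduction of the number of generators by
  \<open>(a + b) (b + c) (c + a) = (a + b + c) (a b + b c + c a)\<close>.\<close>

lemma ideal_gen_finite_invertible:
  assumes "finite S" "S \<subseteq> K" "S \<noteq> {}" "0 \<notin> S"
  shows "\<exists>Q. finite Q \<and> Q \<subseteq> K \<and> ideal_gen S \<star> ideal_gen Q = \<O>"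
  using assms
proof (induction "card S" arbitrary: S rule: less_induct)
  case less
  have Knz: "set_prod A B \<subseteq> K" if "A \<subseteq> K" "B \<subseteq> K" for A B
    using that by (auto simp: set_prod_def intro!: K_mult)
  obtain x where x: "x \<in> S" using less.prems by auto
  consider "S = {x}" | y where "S = {x, y}" | y U where "S = {x} \<union> {y} \<union> U" "U \<noteq> {}" "x \<noteq> y" "x \<notin> U" "y \<notin> U"
  proof -
    have "\<exists>y U. S = {x} \<union> {y} \<union> U \<and> U \<noteq> {} \<and> x \<noteq> y \<and> x \<notin> U \<and> y \<notin> U"
      if 1: "S \<noteq> {x}" and 2: "\<And>y. S \<noteq> {x, y}"
    proof -
      obtain y where y: "y \<in> S" "y \<noteq> x" using x 1 by blast
      show ?thesis
        by (rule exI[of _ y], rule exI[of _ "S - {x, y}"]) (use x y 2[of y] in auto)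
    qed
    then show thesis using that by blast
  qed
  then show ?case
  proof cases
    case 1
    have "\<exists>Q. finite Q \<and> Q \<subseteq> K \<and> ideal_gen {x, x} \<star> ideal_gen Q = \<O>"
      by (rule ideal_gen_pair_invertible) (use x less.prems in auto)
    then show ?thesis using 1 by simp
  next
    case (2 y)
    have "x \<in> K" "y \<in> K" "x \<noteq> 0"
      using x 2 less.prems by auto
    then show ?thesis
      unfolding 2 by (rule ideal_gen_pair_invertible)
  next
    case (3 y U)
    have fU: "finite U" using 3 less.prems by auto
    have sub: "{x} \<subseteq> K" "{y} \<subseteq> K" "U \<subseteq> K" using 3(1) less.prems(2) by auto
    have cS: "card S = card U + 2" using 3 fU by simp
    have U: "card U > 0" using fU 3 by (simp add: card_gt_0_iff)
    have IH: "\<exists>Q. finite Q \<and> Q \<subseteq> K \<and> ideal_gen T \<star> ideal_gen Q = \<O>"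
      if "T \<subseteq> S" "T \<noteq> {}" "card T < card S" for T
      by (rule less.hyps) (use that less.prems(2,4) finite_subset[OF _ less.prems(1)] in blast)+
    \<comment> \<open>The union of any two of the three nonempty parts is smaller than
      \<open>S\<close>, so it generates an invertible ideal by induction.\<close>
    have card: "card ({x} \<union> {y}) < card S" "card ({y} \<union> U) < card S" "card (U \<union> {x}) < card S"
      using 3(3-5) fU U by (simp_all add: cS)
    obtain P where P: "finite P" "P \<subseteq> K" "ideal_gen ({x} \<union> {y}) \<star> ideal_gen P = \<O>"
      using IH[OF _ _ card(1)] 3(1) by blast
    obtain Q where Q: "finite Q" "Q \<subseteq> K" "ideal_gen ({y} \<union> U) \<star> ideal_gen Q = \<O>"
      using IH[OF _ _ card(2)] 3(1) by blast
    obtain R where R: "finite R" "R \<subseteq> K" "ideal_gen (U \<union> {x}) \<star> ideal_gen R = \<O>"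
      using IH[OF _ _ card(3)] 3(1) by blast
    define N where "N = set_prod {x} {y} \<union> set_prod {y} U \<union> set_prod U {x}"
    \<comment> \<open>The ideals of \<open>S\<close> and \<open>N\<close> multiply to the product of
      the three pairwise ideals, which \<open>P\<close>, \<open>Q\<close> and \<open>R\<close>
      invert. So \<open>N\<close> times these three generates an inverse for
      \<open>S\<close>.\<close>
    define M where "M = set_prod N (set_prod P (set_prod Q R))"
    have "set_prod S N = set_prod ({x} \<union> {y}) (set_prod ({y} \<union> U) (U \<union> {x}))"
      unfolding N_def 3(1) by (rule set_prod_cyclic)
    then have SN: "ideal_gen S \<star> ideal_gen N
        = ideal_gen ({x} \<union> {y}) \<star> (ideal_gen ({y} \<union> U) \<star> ideal_gen (U \<union> {x}))"
      unfolding ideal_gen_mult by (rule arg_cong)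
    have "ideal_gen S \<star> ideal_gen M
        = (ideal_gen S \<star> ideal_gen N) \<star> (ideal_gen P \<star> (ideal_gen Q \<star> ideal_gen R))"
      by (simp only: M_def ideal_gen_mult[symmetric] ideal_mult_assoc)
    also have "\<dots> = (ideal_gen ({x} \<union> {y}) \<star> ideal_gen P) \<star> ((ideal_gen ({y} \<union> U) \<star> ideal_gen Q)
           \<star> (ideal_gen (U \<union> {x}) \<star> ideal_gen R))"
      unfolding SN by (simp only: ideal_mult_ac)
    also have "\<dots> = \<O>" by (simp only: P Q R ideal_mult_O_left[OF submodule_O])
    finally have "ideal_gen S \<star> ideal_gen M = \<O>" .
    moreover have "finite M"
      unfolding M_def N_def by (intro finite_set_prod finite_UnI fU P(1) Q(1) R(1)) auto
    moreover have "M \<subseteq> K"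
      unfolding M_def N_def by (intro Knz Un_least sub P(2) Q(2) R(2))
    ultimately show ?thesis by blast
  qed
qed

text \<open>If \<open>x\<close> times \<open>A\<close> is integral, then \<open>x\<close> lies in
  \<open>x A B\<close>, which is contained in \<open>B\<close>. So any inverse that has been
  exhibited coincides with the one defined through integrality.\<close>

lemma ideal_inverse_unique:
  assumes "submodule B" "B \<subseteq> K" "A \<star> B = \<O>"
  shows "ideal_inverse K A = B"
proof
  show "B \<subseteq> ideal_inverse K A"
  proof
    fix b assume b: "b \<in> B"
    then have "b * a \<in> \<O>" if "a \<in> A" for a
      using ideal_mult_base[OF that b] assms(3) by (simp add: mult.commute)
    then show "b \<in> ideal_inverse K A"
      using b assms(2) by (auto simp: ideal_inverse_def)
  qed
  show "ideal_inverse K A \<subseteq> B"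
  proof
    fix x assume x: "x \<in> ideal_inverse K A"
    have "A \<star> B \<subseteq> {y. x * y \<in> B}"
    proof (rule ideal_mult_least)
      show "submodule {y. x * y \<in> B}" by (rule submodule_quotient) fact
      fix a b assume "a \<in> A" "b \<in> B"
      then have "x * a \<in> \<O>" using x by (auto simp: ideal_inverse_def)
      then show "a * b \<in> {y. x * y \<in> B}"
        using submod_scale[OF assms(1) _ \<open>b \<in> B\<close>] by (simp add: mult.assoc[symmetric])
    qed
    then show "x \<in> B" using assms(3) O_1 by auto
  qed
qed

section \<open>The group of fractional ideals\<close>

abbreviation fractional where "fractional \<equiv> fractional_ideal K"

lemma fractional_submodule: "fractional A \<Longrightarrow> submodule A"
  by (auto simp: fractional_ideal_def fin_gen_def submod_gen)

lemma fractional_subset_K: "fractional A \<Longrightarrow> A \<subseteq> K"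
  by (simp add: fractional_ideal_def)

lemma fractional_nonzero: "fractional A \<Longrightarrow> \<exists>x\<in>A. x \<noteq> 0"
  using fractional_submodule submod_0 by (fastforce simp: fractional_ideal_def)

lemma fractional_gen:
  assumes "finite S" "S \<subseteq> K" "x \<in> S" "x \<noteq> 0"
  shows "fractional (ideal_gen S)"
  using assms gen_base[of x S] gen_least[OF assms(2) submodule_K]
  by (auto simp: fractional_ideal_def fin_gen_def)

lemma fractional_O: "fractional \<O>"
  using fractional_gen[of "{1}" 1] by (simp add: gen_O_1 K_1)

text \<open>Zero is removed from the generators because the reduction to two generators divides by
  one of them.\<close>

lemma fractional_finite_gen:
  assumes "fractional A"
  obtains S where "finite S" "S \<subseteq> K" "S \<noteq> {}" "0 \<notin> S" "A = ideal_gen S"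
proof -
  obtain S where S: "finite S" "A = ideal_gen S"
    using assms by (auto simp: fractional_ideal_def fin_gen_def)
  have "ideal_gen {} \<subseteq> {0}"
    by (rule gen_least) (auto simp: submod_def)
  then have "S - {0} \<noteq> {}"
    using S(2) fractional_nonzero[OF assms] gen_Diff_zero[of \<O> "(*)" S] by (metis empty_iff insert_iff subset_iff)
  moreover have "S - {0} \<subseteq> K"
    using S(2) gen_superset[of S \<O> "(*)"] fractional_subset_K[OF assms] by auto
  ultimately show ?thesis
    using that[of "S - {0}"] S gen_Diff_zero[of \<O> "(*)" S] by auto
qed

lemma fractional_mult:
  assumes "fractional A" "fractional B" shows "fractional (A \<star> B)"
proof -
  obtain S where S: "finite S" "S \<subseteq> K" "S \<noteq> {}" "0 \<notin> S" "A = ideal_gen S"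
    by (rule fractional_finite_gen[OF assms(1)])
  obtain T where T: "finite T" "T \<subseteq> K" "T \<noteq> {}" "0 \<notin> T" "B = ideal_gen T"
    by (rule fractional_finite_gen[OF assms(2)])
  obtain x y where "x \<in> S" "y \<in> T" using S T by auto
  then show ?thesis
    unfolding S T ideal_gen_mult using S T
    by (intro fractional_gen[of _ "x * y"] finite_set_prod) (auto simp: set_prod_def K_mult subset_iff)
qed

lemma fractional_Un:
  assumes "fractional A" "fractional B" shows "fractional (ideal_gen (A \<union> B))"
proof -
  obtain S where S: "finite S" "S \<subseteq> K" "S \<noteq> {}" "0 \<notin> S" "A = ideal_gen S"
    by (rule fractional_finite_gen[OF assms(1)])
  obtain T where T: "finite T" "T \<subseteq> K" "T \<noteq> {}" "0 \<notin> T" "B = ideal_gen T"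
    by (rule fractional_finite_gen[OF assms(2)])
  have "ideal_gen (A \<union> B) = ideal_gen (S \<union> T)"
    unfolding S T by (rule gen_Un)
  moreover obtain x where "x \<in> S" using S by auto
  ultimately show ?thesis
    using S T by (auto intro!: fractional_gen[of "S \<union> T" x])
qed

lemma fractional_invertible:
  assumes "fractional A"
  shows ideal_mult_inverse: "A \<star> ideal_inverse K A = \<O>"
    and fractional_inverse: "fractional (ideal_inverse K A)"
proof -
  obtain S where S: "finite S" "S \<subseteq> K" "S \<noteq> {}" "0 \<notin> S" "A = ideal_gen S"
    using assms by (rule fractional_finite_gen)
  obtain Q where Q: "finite Q" "Q \<subseteq> K" "A \<star> ideal_gen Q = \<O>"
    using ideal_gen_finite_invertible[OF S(1-4)] S(5) by auto
  have "ideal_inverse K A = ideal_gen Q"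
    by (intro ideal_inverse_unique submod_gen Q gen_least submodule_K)
  moreover have "\<exists>x\<in>Q. x \<noteq> 0"
  proof (rule ccontr)
    assume "\<not> ?thesis"
    then have "Q \<subseteq> {0}" by auto
    then have "ideal_gen Q \<subseteq> {0}" by (rule gen_least) (auto simp: submod_def)
    then have "A \<star> ideal_gen Q \<subseteq> {0}"
      by (intro ideal_mult_least) (auto simp: submod_def)
    then show False using Q(3) O_1 by auto
  qed
  ultimately show "A \<star> ideal_inverse K A = \<O>" "fractional (ideal_inverse K A)"
    using Q fractional_gen by auto
qed

lemma ideal_inverse_mult:
  assumes "fractional A" "fractional B"
  shows "ideal_inverse K (A \<star> B) = ideal_inverse K A \<star> ideal_inverse K B"
proof (rule ideal_inverse_unique)
  have "(A \<star> B) \<star> (ideal_inverse K A \<star> ideal_inverse K B)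
      = (A \<star> ideal_inverse K A) \<star> (B \<star> ideal_inverse K B)"
    by (simp only: ideal_mult_ac)
  then show "(A \<star> B) \<star> (ideal_inverse K A \<star> ideal_inverse K B) = \<O>"
    using assms by (simp add: ideal_mult_inverse ideal_mult_O_left submodule_O)
qed (use assms in \<open>auto intro!: submodule_ideal_mult ideal_mult_subset_K fractional_mult fractional_subset_K fractional_inverse\<close>)

lemma ideal_inverse_O: "ideal_inverse K \<O> = \<O>"
  by (intro ideal_inverse_unique submodule_O O_subset_K ideal_mult_O_left)

lemma ideal_mult_cancel_inverse:
  assumes "fractional A" "submodule B"
  shows "A \<star> (ideal_inverse K A \<star> B) = B" "ideal_inverse K A \<star> (A \<star> B) = B"
  using assms by (simp_all add: ideal_mult_assoc[symmetric] ideal_mult_inverse ideal_mult_O_left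
      ideal_mult_commute[of "ideal_inverse K A" A])

lemma submodule_principal: "submodule (principal K x)"
proof -
  have "submodule ((\<lambda>a. a * x) ` \<O>)"
    using submodule_O
    by (intro submod_linear_image[where \<sigma> = id and R = \<O> and scale = "(*)"]) (auto simp: algebra_simps)
  moreover have "(\<lambda>a. a * x) ` \<O> = principal K x"
    by (auto simp: principal_def multiples_def)
  ultimately show ?thesis by simp
qed

lemma principal_base: "x \<in> principal K x"
  using O_1 by (force simp: principal_def multiples_def)

lemma principal_subset: "submodule A \<Longrightarrow> principal K x \<subseteq> A \<longleftrightarrow> x \<in> A"
  using principal_base by (auto simp: principal_def multiples_def intro: submod_scale)

text \<open>The cofactor is \<open>ideal_inverse K A \<star> B\<close>, integral because
  \<open>B\<close> is contained in \<open>A\<close>. For \<open>B\<close> a submodule is enough, so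
  that the zero ideal generated by \<open>1 + zeta 2\<close> is covered.\<close>

lemma ideal_dvd_iff:
  assumes A: "fractional A" and B: "submodule B"
  shows "ideal_dvd K A B \<longleftrightarrow> B \<subseteq> A"
proof
  assume "ideal_dvd K A B"
  then obtain C where C: "C \<subseteq> \<O>" "B = A \<star> C"
    by (auto simp: ideal_dvd_def integral_def)
  then have "B \<subseteq> A \<star> \<O>" by (simp add: ideal_mult_mono)
  then show "B \<subseteq> A" by (simp add: ideal_mult_O_right[OF fractional_submodule[OF A]])
next
  assume "B \<subseteq> A"
  then have "ideal_inverse K A \<star> B \<subseteq> ideal_inverse K A \<star> A" by (intro ideal_mult_mono) auto
  then have "ideal_inverse K A \<star> B \<subseteq> \<O>"
    by (simp add: ideal_mult_commute[of "ideal_inverse K A" A] ideal_mult_inverse[OF A])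
  then show "ideal_dvd K A B"
    unfolding ideal_dvd_def integral_def
    using submodule_ideal_mult[of "ideal_inverse K A" B] ideal_mult_cancel_inverse(1)[OF A B, symmetric] by blast
qed

lemma ideal_mult_unit:
  assumes "submodule A" "u \<in> \<O>" "inverse u \<in> \<O>" "u \<noteq> 0"
  shows "u * a \<in> A \<longleftrightarrow> a \<in> A"
proof
  assume "u * a \<in> A"
  then have "inverse u * (u * a) \<in> A" by (rule submod_scale[OF assms(1,3)])
  then show "a \<in> A" using assms(4) by (simp add: mult.assoc[symmetric])
qed (rule submod_scale[OF assms(1,2)])

end

section \<open>Roots of unity\<close>

lemma zeta_eq_cis: "zeta n = cis (2 * pi / real n)"
  by (simp add: zeta_def cis_conv_exp mult_ac)

lemma zeta_power_eq_cis: "zeta n ^ k = cis (2 * pi * real k / real n)"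
  by (simp add: zeta_eq_cis DeMoivre mult_ac)

lemma zeta_power_eq_1_iff:
  assumes "n > 0"
  shows "zeta n ^ k = 1 \<longleftrightarrow> n dvd k"
proof
  assume "zeta n ^ k = 1"
  then have "cos (2 * pi * real k / real n) = 1"
    unfolding zeta_power_eq_cis by (metis cis.sel(1) one_complex.sel(1))
  then obtain x :: int where "2 * pi * real k / real n = of_int x * 2 * pi"
    using cos_one_2pi_int by blast
  then have "real k = of_int x * real n"
    using assms by (simp add: field_simps)
  then have "int k = x * int n"
    by (metis of_int_eq_iff of_int_mult of_int_of_nat_eq)
  then show "n dvd k"
    by (metis dvd_triv_right int_dvd_int_iff)
next
  assume "n dvd k"
  then obtain m where m: "k = n * m" by (rule dvdE)
  have "zeta n ^ k = cis (2 * pi * real m)"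
    unfolding zeta_power_eq_cis using assms by (simp add: m field_simps)
  then show "zeta n ^ k = 1"
    by (metis Ints_of_nat cis_multiple_2pi mult.assoc)
qed

lemma zeta_power_self: "n > 0 \<Longrightarrow> zeta n ^ n = 1"
  by (simp add: zeta_power_eq_1_iff)

lemma zeta_power_half: "N > 0 \<Longrightarrow> zeta (2 * N) ^ N = - 1"
  by (simp add: zeta_power_eq_cis)

lemma zeta_mult_power: "e > 0 \<Longrightarrow> zeta (d * e) ^ e = zeta d"
  unfolding zeta_power_eq_cis by (simp add: zeta_eq_cis)

lemma zeta_nonzero: "zeta n \<noteq> 0"
  by (simp add: zeta_def)

lemma zeta_neq_1: "n > 1 \<Longrightarrow> zeta n \<noteq> 1"
  using zeta_power_eq_1_iff[of n 1] by simp

lemma root_of_unity_zeta_power: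
  assumes "n > 0" "x ^ n = 1"
  obtains k where "k < n" "x = zeta n ^ k"
  using bij_betw_roots_unity[OF assms(1)] assms(2) that
  unfolding bij_betw_def zeta_power_eq_cis by (auto simp: set_eq_iff image_iff)

lemma root_of_unity_nonzero: "n > 0 \<Longrightarrow> x ^ n = 1 \<Longrightarrow> x \<noteq> (0 :: complex)"
  by (auto simp: zero_power)

lemma root_of_unity_mult_cnj:
  fixes x :: complex
  assumes "n > 0" "x ^ n = 1"
  shows "x * cnj x = 1"
proof -
  have "norm x ^ n = 1" using assms(2) by (metis norm_one norm_power)
  then have "norm x = 1"
    using assms(1) power_eq_imp_eq_base[of "norm x" n 1] by simp
  then show ?thesis by (simp flip: complex_norm_square)
qed

lemma root_of_unity_cnj:
  fixes x :: complex
  assumes "n > 0" "x ^ n = 1"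
  shows "cnj x = inverse x"
  using root_of_unity_mult_cnj[OF assms] by (metis inverse_unique)

lemma root_of_unity_algebraic_int:
  fixes x :: complex
  assumes "n > 0" "x ^ n = 1"
  shows "algebraic_int x"
  by (rule algebraic_int_root[of 1 "monom 1 n"]) (use assms in \<open>auto simp: poly_monom degree_monom_eq\<close>)

text \<open>Splitting off the full power of one prime leaves a coprime factor different from 1. At
  most one of the two is even, so they can be ordered with \<open>b\<close> odd, as the sign in
  \<open>1 + zeta\<close> will require.\<close>

lemma coprime_factors_of_not_primepow:
  fixes n :: nat
  assumes "n > 1" "\<not> primepow n"
  obtains a b where "a > 1" "b > 1" "coprime a b" "n = a * b" "odd b"
proof -
  obtain p where p: "prime p" "p dvd n"
    using assms(1) prime_factor_nat[of n] by auto
  define k where "k = multiplicity p n"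
  obtain b where b: "n = p ^ k * b" "\<not> p dvd b"
    using multiplicity_decompose'[of n p] p assms(1) unfolding k_def
    by (metis not_prime_unit not_less_zero)
  have k: "k > 0" using b p by (cases k) auto
  have "b \<noteq> 1"
    using b assms(2) k primepow_prime_power[OF p(1)] by (metis mult.right_neutral)
  moreover have "b \<noteq> 0" using b(2) by (metis dvd_0_right)
  ultimately have b1: "b > 1" by simp
  have a1: "p ^ k > 1"
    using k prime_gt_1_nat[OF p(1)] by (intro one_less_power)
  have cop: "coprime (p ^ k) b"
    using b(2) p(1) by (simp add: prime_imp_coprime)
  show thesis
  proof (cases "odd b")
    case True
    then show thesis using that[OF a1 b1 cop b(1)] by simp
  next
    case False
    have "odd (p ^ k)"
    proof
      assume "even (p ^ k)"
      then have "is_unit (2 :: nat)" using False coprime_common_divisor[OF cop] by blast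
      then show False by simp
    qed
    moreover have "coprime b (p ^ k)" "n = b * p ^ k"
      using cop b(1) by (simp_all add: coprime_commute mult.commute)
    ultimately show thesis using that b1 a1 by blast
  qed
qed

context number_ring
begin

lemma root_of_unity_O: "x \<in> K \<Longrightarrow> n > 0 \<Longrightarrow> x ^ n = 1 \<Longrightarrow> x \<in> \<O>"
  using root_of_unity_algebraic_int by (auto simp: ints_of_def)

lemma root_of_unity_inverse_O:
  assumes "x \<in> K" "n > 0" "x ^ n = 1"
  shows "inverse x \<in> \<O>"
  using assms K_inverse by (intro root_of_unity_O[of _ n]) (auto simp: power_inverse)

text \<open>If \<open>u = y ^ k \<noteq> 1\<close> is a \<open>b\<close>-th root of unity then \<open>b\<close> is the sum of the
  \<open>1 - u ^ i\<close>, each of which is divisible by \<open>1 - y\<close>.\<close>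

lemma one_minus_dvd_order:
  assumes y: "y \<in> \<O>" and u: "(y ^ k) ^ b = 1" "y ^ k \<noteq> 1"
  obtains c where "c \<in> \<O>" "of_nat b = (1 - y) * c"
proof -
  define u where "u = y ^ k"
  have "(1 - u) * (\<Sum>i<b. u ^ i) = 0"
    using u by (simp add: u_def one_diff_power_eq[symmetric])
  then have "(\<Sum>i<b. u ^ i) = 0" using u by (simp add: u_def)
  then have "of_nat b = (\<Sum>i<b. 1 - u ^ i)"
    by (simp add: sum_subtractf)
  also have "\<dots> = (\<Sum>i<b. (1 - y) * (\<Sum>j<k * i. y ^ j))"
    by (simp add: u_def one_diff_power_eq[symmetric] power_mult)
  also have "\<dots> = (1 - y) * (\<Sum>i<b. \<Sum>j<k * i. y ^ j)"
    by (simp add: sum_distrib_left)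
  finally show thesis
    using that[of "\<Sum>i<b. \<Sum>j<k * i. y ^ j"] y by (simp add: O_sum O_power)
qed

text \<open>\<open>1 - y\<close> divides both of the coprime integers \<open>a\<close> and
  \<open>b\<close>, hence also their integer combination 1.\<close>

lemma one_minus_unit:
  assumes y: "y \<in> \<O>" and "coprime a b"
    and "(y ^ k) ^ b = 1" "y ^ k \<noteq> 1" "(y ^ l) ^ a = 1" "y ^ l \<noteq> 1"
  shows "inverse (1 - y) \<in> \<O>" "1 - y \<noteq> 0"
proof -
  obtain c where c: "c \<in> \<O>" "of_nat b = (1 - y) * c"
    using one_minus_dvd_order[OF y assms(3,4)] .
  obtain c' where c': "c' \<in> \<O>" "of_nat a = (1 - y) * c'"
    using one_minus_dvd_order[OF y assms(5,6)] .
  obtain s t where "s * int a + t * int b = 1"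
    using bezout_int[of "int a" "int b"] assms(2) by auto
  then have "1 = of_int s * of_nat a + of_int t * (of_nat b :: complex)"
    by (metis of_int_1 of_int_add of_int_mult of_int_of_nat_eq)
  then have eq: "1 = (1 - y) * (of_int s * c' + of_int t * c)"
    by (simp add: c(2) c'(2) algebra_simps)
  then have "inverse (1 - y) = of_int s * c' + of_int t * c"
    by (metis inverse_unique)
  then show "inverse (1 - y) \<in> \<O>" using c(1) c'(1) by (simp add: O_add O_mult O_of_int)
  show "1 - y \<noteq> 0" using eq by auto
qed

text \<open>For a coprime factorization \<open>n = a * b\<close>, the powers
  \<open>zeta n ^ a\<close> and \<open>zeta n ^ b\<close> are nontrivial and have the coprime orders
  \<open>b\<close> and \<open>a\<close>.\<close>

lemma one_minus_zeta_unit: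
  assumes "zeta n \<in> K" "n > 1" "\<not> primepow n"
  shows "inverse (1 - zeta n) \<in> \<O>" "1 - zeta n \<noteq> 0"
proof -
  obtain a b where ab: "a > 1" "b > 1" "coprime a b" "n = a * b"
    using coprime_factors_of_not_primepow[OF assms(2,3)] by metis
  have "zeta n \<in> \<O>" using assms by (intro root_of_unity_O[of _ n]) (auto simp: zeta_power_self)
  moreover have "(zeta n ^ a) ^ b = 1" "(zeta n ^ b) ^ a = 1"
    using assms(2) ab by (simp_all add: zeta_power_eq_1_iff flip: power_mult)
  moreover have "zeta n ^ a \<noteq> 1" "zeta n ^ b \<noteq> 1"
    using assms(2) ab by (auto simp: zeta_power_eq_1_iff dest: dvd_imp_le)
  ultimately show "inverse (1 - zeta n) \<in> \<O>" "1 - zeta n \<noteq> 0"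
    using one_minus_unit[of "zeta n" a b a b] ab(3) by auto
qed

text \<open>The number is \<open>1 - \<xi>\<close> with \<open>\<xi> = - zeta (2 * N)\<close>. The
  sign can introduce a factor 2 into the order, so the coprime pair is \<open>2 * a\<close> and
  \<open>b\<close> with \<open>b\<close> odd.\<close>

lemma one_plus_zeta_unit:
  assumes "zeta (2 * N) \<in> K" "N > 1" "\<not> primepow N"
  shows "inverse (1 + zeta (2 * N)) \<in> \<O>" "1 + zeta (2 * N) \<noteq> 0"
proof -
  obtain a b where ab: "a > 1" "b > 1" "coprime a b" "N = a * b" "odd b"
    using coprime_factors_of_not_primepow[OF assms(2,3)] by metis
  define \<xi> where "\<xi> = - zeta (2 * N)"
  have "zeta (2 * N) \<in> \<O>" using assms by (intro root_of_unity_O[of _ "2 * N"]) (auto simp: zeta_power_self)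
  then have \<xi>: "\<xi> \<in> \<O>" by (simp add: \<xi>_def O_uminus)
  have "\<xi> ^ (2 * a) = zeta (2 * N) ^ (2 * a)" "\<xi> ^ b = - (zeta (2 * N) ^ b)"
    using ab(5) by (simp_all add: \<xi>_def)
  moreover have "zeta (2 * N) ^ (2 * a) \<noteq> 1"
    using assms(2) ab by (auto simp: zeta_power_eq_1_iff dest: dvd_imp_le)
  moreover have "- (zeta (2 * N) ^ b) \<noteq> 1"
  proof
    assume "- (zeta (2 * N) ^ b) = 1"
    \<comment> \<open>The sign is the \<open>N\<close>-th power of \<open>zeta (2 * N)\<close>, so
      it becomes a shift of the exponent by \<open>N\<close>.\<close>
    then have "zeta (2 * N) ^ b * zeta (2 * N) ^ N = 1"
      using zeta_power_half[of N] assms(2) by simp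
    then have "2 * N dvd b + N"
      using assms(2) by (simp add: zeta_power_eq_1_iff flip: power_add)
    then have "2 * N \<le> b + N" using ab by (intro dvd_imp_le) auto
    then have "N \<le> b" by simp
    then show False using ab by simp
  qed
  moreover have "(\<xi> ^ (2 * a)) ^ b = 1" "(\<xi> ^ b) ^ (2 * a) = 1"
  proof -
    have "\<xi> ^ (2 * N) = 1" using assms(2) by (simp add: \<xi>_def zeta_power_self)
    then show "(\<xi> ^ (2 * a)) ^ b = 1" "(\<xi> ^ b) ^ (2 * a) = 1"
      using ab(4) by (simp_all add: mult_ac flip: power_mult)
  qed
  moreover have "coprime (2 * a) b" using ab by simp
  ultimately have "inverse (1 - \<xi>) \<in> \<O>" "1 - \<xi> \<noteq> 0"
    using one_minus_unit[OF \<xi>, of "2 * a" b "2 * a" b] by auto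
  then show "inverse (1 + zeta (2 * N)) \<in> \<O>" "1 + zeta (2 * N) \<noteq> 0"
    by (simp_all add: \<xi>_def)
qed

end

section \<open>Roots as multiples of a fixed pair of vectors\<close>

locale number_field_space = vector_space_over K scale + number_ring K
  for K and scale :: "complex \<Rightarrow> 'v::ab_group_add \<Rightarrow> 'v"
begin

lemma scale_zero_right: "a \<in> K \<Longrightarrow> scale a 0 = 0"
  using scale_add_right[of a 0 0] by simp

lemma scale_zero_left: "scale 0 x = 0"
  using scale_add_left[OF K_0 K_0, of x] by simp

lemma scale_minus_left: "a \<in> K \<Longrightarrow> scale (- a) x = - scale a x"
  using scale_add_left[of a "- a" x] K_uminus scale_zero_left by (metis add.right_inverse add_eq_0_iff)

lemma scale_minus_right: "a \<in> K \<Longrightarrow> scale a (- x) = - scale a x"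
  using scale_add_right[of a x "- x"] scale_zero_right by (metis add.right_inverse add_eq_0_iff)

lemma scale_diff_right: "a \<in> K \<Longrightarrow> scale a (x - y) = scale a x - scale a y"
  using scale_add_right[of a x "- y"] scale_minus_right by simp

lemma scale_diff_left: "a \<in> K \<Longrightarrow> b \<in> K \<Longrightarrow> scale (a - b) x = scale a x - scale b x"
  using scale_add_left[of a "- b" x] scale_minus_left K_uminus by simp

lemma scale_sum_right: "a \<in> K \<Longrightarrow> scale a (sum f I) = (\<Sum>i\<in>I. scale a (f i))"
  by (induction I rule: infinite_finite_induct) (auto simp: scale_zero_right scale_add_right)

lemma scale_eq_0_iff: "a \<in> K \<Longrightarrow> scale a x = 0 \<longleftrightarrow> a = 0 \<or> x = 0"
proof
  assume a: "a \<in> K" "scale a x = 0"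
  show "a = 0 \<or> x = 0"
  proof (cases "a = 0")
    case False
    have "x = scale (inverse a * a) x" using False by (simp add: scale_one)
    also have "\<dots> = 0" using a scale_scale[of "inverse a" a x] K_inverse scale_zero_right by metis
    finally show ?thesis by simp
  qed simp
qed (auto simp: scale_zero_left scale_zero_right)

lemma scale_cancel: "a \<in> K \<Longrightarrow> b \<in> K \<Longrightarrow> x \<noteq> 0 \<Longrightarrow> scale a x = scale b x \<longleftrightarrow> a = b"
  using scale_eq_0_iff[of "a - b" x] scale_diff_left[of a b x] K_diff[of a b] by auto

lemma scale_inverse: "a \<in> K \<Longrightarrow> a \<noteq> 0 \<Longrightarrow> scale (inverse a) (scale a x) = x"
  by (simp add: scale_scale K_inverse scale_one)

lemma multiplesI: "a \<in> R \<Longrightarrow> scale a v \<in> multiples R scale v"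
  by (auto simp: multiples_def)

lemma multiples_image: "multiples R scale v = (\<lambda>a. scale a v) ` R"
  by (auto simp: multiples_def)

lemma submod_multiples:
  assumes "submodule A" "A \<subseteq> K"
  shows "submod \<O> scale (multiples A scale v)"
  unfolding submod_def
proof (intro conjI ballI)
  show "0 \<in> multiples A scale v"
    using multiplesI[OF submod_0[OF assms(1)], of v] by (simp add: scale_zero_left)
next
  fix x y assume "x \<in> multiples A scale v" "y \<in> multiples A scale v"
  then obtain a b where "a \<in> A" "b \<in> A" "x = scale a v" "y = scale b v" by (auto simp: multiples_def)
  then show "x + y \<in> multiples A scale v"
    using multiplesI[OF submod_add[OF assms(1)], of a b v] assms(2) scale_add_left[of a b v]
    by (simp add: subset_iff)
next
  fix c x assume "c \<in> \<O>" "x \<in> multiples A scale v"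
  then obtain a where "a \<in> A" "x = scale a v" by (auto simp: multiples_def)
  then show "scale c x \<in> multiples A scale v"
    using multiplesI[OF submod_scale[OF assms(1) \<open>c \<in> \<O>\<close>], of a v] assms(2) \<open>c \<in> \<O>\<close> O_subset_K
      scale_scale[of c a v] by (simp add: subset_iff)
qed

lemma submod_K_multiples: "submod K scale (multiples K scale v)"
proof -
  have "scale c (scale a v) \<in> multiples K scale v" if "c \<in> K" "a \<in> K" for c a
    using that by (simp add: scale_scale K_mult multiplesI)
  moreover have "scale c v + scale a v \<in> multiples K scale v" if "c \<in> K" "a \<in> K" for c a
    using that multiplesI[OF K_add[of c a], of v] by (simp add: scale_add_left)
  moreover have "0 \<in> multiples K scale v"
    using multiplesI[OF K_0, of v] by (simp add: scale_zero_left)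
  ultimately show ?thesis
    unfolding submod_def by (auto simp: multiples_image)
qed

lemma self_in_multiples: "v \<in> multiples K scale v"
  using multiplesI[OF K_1, of v] by (simp add: scale_one)

lemma gen_K_multiples:
  assumes "A \<subseteq> K" "a \<in> A" "a \<noteq> 0"
  shows "gen K scale (multiples A scale v) = multiples K scale v"
proof
  show "gen K scale (multiples A scale v) \<subseteq> multiples K scale v"
    using assms(1) by (intro gen_least submod_K_multiples) (auto simp: multiples_def)
  have "v = scale (inverse a) (scale a v)" using assms by (simp add: scale_inverse subset_iff)
  also have "\<dots> \<in> gen K scale (multiples A scale v)"
    using assms by (intro submod_scale[OF submod_gen] K_inverse gen_base multiplesI) auto
  finally have "v \<in> gen K scale (multiples A scale v)" .
  then show "multiples K scale v \<subseteq> gen K scale (multiples A scale v)"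
    by (auto simp: multiples_def intro: submod_scale[OF submod_gen])
qed

lemma multiples_eq:
  assumes "w \<in> multiples K scale v" "w \<noteq> 0"
  shows "multiples K scale w = multiples K scale v"
proof -
  obtain a where a: "a \<in> K" "w = scale a v" using assms(1) by (auto simp: multiples_def)
  then have "a \<noteq> 0" using assms(2) scale_zero_left by auto
  then have v: "v = scale (inverse a) w" using a by (simp add: scale_inverse)
  have "scale c w \<in> multiples K scale v" if "c \<in> K" for c
    using a that by (simp add: scale_scale K_mult multiplesI)
  moreover have "scale c v \<in> multiples K scale w" if "c \<in> K" for c
  proof -
    have "scale c v = scale (c * inverse a) w"
      using a that v scale_scale[of c "inverse a" w] K_inverse by metis
    then show ?thesis using a that multiplesI[of "c * inverse a" K w] by (simp add: K_mult K_inverse)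
  qed
  ultimately show ?thesis by (auto simp: multiples_def)
qed

lemma multiples_vector_eq_iff:
  assumes "v \<noteq> 0" "A \<subseteq> K" "B \<subseteq> K"
  shows "multiples A scale v = multiples B scale v \<longleftrightarrow> A = B"
proof
  assume eq: "multiples A scale v = multiples B scale v"
  have "X \<subseteq> Y" if XY: "multiples X scale v = multiples Y scale v" "X \<subseteq> K" "Y \<subseteq> K" for X Y
  proof
    fix a assume "a \<in> X"
    then have "scale a v \<in> multiples Y scale v" using XY(1) multiplesI by metis
    then obtain b where "b \<in> Y" "scale a v = scale b v" by (auto simp: multiples_def)
    then show "a \<in> Y" using scale_cancel[of a b v] XY \<open>a \<in> X\<close> assms(1) by auto
  qed
  then show "A = B" using eq assms by blast
qed simp

lemma multiples_unit:
  assumes "submodule A" "A \<subseteq> K" "u \<in> \<O>" "inverse u \<in> \<O>" "u \<noteq> 0"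
  shows "multiples A scale (scale u v) = multiples A scale v"
proof -
  have uK: "u \<in> K" using assms(3) O_subset_K by auto
  have "scale a (scale u v) \<in> multiples A scale v" if "a \<in> A" for a
  proof -
    have "scale a (scale u v) = scale (u * a) v"
      using that uK assms(2) by (simp add: scale_scale mult.commute subset_iff)
    then show ?thesis using multiplesI[of "u * a" A v] that assms ideal_mult_unit by simp
  qed
  moreover have "scale a v \<in> multiples A scale (scale u v)" if "a \<in> A" for a
  proof -
    have "inverse u * a \<in> A" by (rule submod_scale[OF assms(1,4) that])
    moreover have "scale (inverse u * a) (scale u v) = scale a v"
    proof -
      have "inverse u * a * u = a" using assms(5) by (simp add: field_simps)
      moreover have "scale (inverse u * a) (scale u v) = scale (inverse u * a * u) v"
        using that uK assms(2) by (intro scale_scale) (auto intro: K_mult K_inverse)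
      ultimately show ?thesis by metis
    qed
    ultimately show ?thesis by (metis multiplesI)
  qed
  ultimately show ?thesis by (auto simp: multiples_def)
qed

text \<open>Containments of modules on a line become containments of coefficient ideals, which can
  be tested on generators. The coefficients are confined to \<open>K\<close> because
  \<open>scale\<close> is specified only there.\<close>

lemma submodule_scale_preimage:
  assumes N: "submod \<O> scale N"
  shows "submodule {x \<in> K. scale x v \<in> N}" (is "submodule ?X")
  unfolding submod_def
proof (intro conjI ballI)
  show "0 \<in> ?X" using submod_0[OF N] by (simp add: K_0 scale_zero_left)
next
  fix x y assume "x \<in> ?X" "y \<in> ?X"
  then show "x + y \<in> ?X"
    using submod_add[OF N, of "scale x v" "scale y v"] by (simp add: K_add scale_add_left)
next
  fix a x assume "a \<in> \<O>" "x \<in> ?X"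
  then show "a * x \<in> ?X"
    using submod_scale[OF N \<open>a \<in> \<O>\<close>, of "scale x v"] O_subset_K
    by (auto simp: K_mult scale_scale)
qed

lemma ideal_mult_multiples:
  assumes "A \<subseteq> K" "B \<subseteq> K"
  shows "ideal_mult K scale A (multiples B scale v) = multiples (A \<star> B) scale v"
proof
  have ABK: "A \<star> B \<subseteq> K" using assms by (rule ideal_mult_subset_K)
  show "ideal_mult K scale A (multiples B scale v) \<subseteq> multiples (A \<star> B) scale v"
    unfolding ideal_mult_def[of K scale]
  proof (intro gen_least submod_multiples submodule_ideal_mult ABK subsetI)
    fix x assume "x \<in> {scale a x |a x. a \<in> A \<and> x \<in> multiples B scale v}"
    then obtain a b where ab: "a \<in> A" "b \<in> B" "x = scale a (scale b v)" by (auto simp: multiples_def)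
    then have "x = scale (a * b) v" using assms by (simp add: scale_scale subset_iff)
    then show "x \<in> multiples (A \<star> B) scale v" using ab by (simp add: multiplesI ideal_mult_base)
  qed
  let ?N = "ideal_mult K scale A (multiples B scale v)"
  have N: "submod \<O> scale ?N" unfolding ideal_mult_def by (rule submod_gen)
  have "A \<star> B \<subseteq> {x \<in> K. scale x v \<in> ?N}"
  proof (rule ideal_mult_least)
    show "submodule {x \<in> K. scale x v \<in> ?N}" by (rule submodule_scale_preimage[OF N])
  next
    fix a b assume ab: "a \<in> A" "b \<in> B"
    then have "scale (a * b) v = scale a (scale b v)" using assms by (simp add: scale_scale subset_iff)
    also have "\<dots> \<in> ?N"
      unfolding ideal_mult_def using ab by (intro gen_base) (auto simp: multiples_def)
    finally show "a * b \<in> {x \<in> K. scale x v \<in> ?N}"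
      using ab assms by (auto intro: K_mult)
  qed
  then show "multiples (A \<star> B) scale v \<subseteq> ?N" by (auto simp: multiples_def)
qed

lemma fin_gen_multiples:
  assumes "fractional A"
  shows "fin_gen \<O> scale (multiples A scale v)"
proof -
  obtain S where S: "finite S" "S \<subseteq> K" "A = ideal_gen S"
    using fractional_finite_gen[OF assms] by metis
  have "multiples A scale v = gen \<O> scale ((\<lambda>s. scale s v) ` S)"
  proof
    have A: "ideal_gen S \<subseteq> {x \<in> K. scale x v \<in> gen \<O> scale ((\<lambda>s. scale s v) ` S)}" (is "_ \<subseteq> ?X")
    proof (rule gen_least)
      show "S \<subseteq> ?X" using S(2) by (auto intro: gen_base)
      show "submodule ?X" by (rule submodule_scale_preimage[OF submod_gen])
    qed
    then show "multiples A scale v \<subseteq> gen \<O> scale ((\<lambda>s. scale s v) ` S)"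
      unfolding S(3) by (auto simp: multiples_def)
    have "scale s v \<in> multiples A scale v" if "s \<in> S" for s
      using that S(3) by (auto intro: multiplesI gen_base)
    then show "gen \<O> scale ((\<lambda>s. scale s v) ` S) \<subseteq> multiples A scale v"
      using assms by (intro gen_least submod_multiples fractional_submodule fractional_subset_K) auto
  qed
  then show ?thesis using S(1) by (auto simp: fin_gen_def)
qed

text \<open>The vectors that equal their expansion form a subspace containing the basis.\<close>

lemma dual_basis_expansion:
  assumes gen: "gen K scale (b ` I) = UNIV" and I: "finite I"
    and f: "\<And>i x. f i x \<in> K" "\<And>i x y. f i (x + y) = f i x + f i y"
      "\<And>i a x. a \<in> K \<Longrightarrow> f i (scale a x) = a * f i x"
    and dual: "\<And>i j. i \<in> I \<Longrightarrow> j \<in> I \<Longrightarrow> f i (b j) = (if i = j then 1 else 0)"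
  shows "x = (\<Sum>i\<in>I. scale (f i x) (b i))"
proof -
  define X where "X = {x. x = (\<Sum>i\<in>I. scale (f i x) (b i))}"
  have "submod K scale X"
    unfolding submod_def
  proof (intro conjI ballI)
    have "f i 0 = 0" for i using f(2)[of i 0 0] by simp
    then show "0 \<in> X" by (simp add: X_def scale_zero_left)
  next
    fix x y assume "x \<in> X" "y \<in> X"
    then have "x + y = (\<Sum>i\<in>I. scale (f i x) (b i)) + (\<Sum>i\<in>I. scale (f i y) (b i))"
      by (simp add: X_def)
    also have "\<dots> = (\<Sum>i\<in>I. scale (f i (x + y)) (b i))"
      by (simp add: f scale_add_left sum.distrib)
    finally show "x + y \<in> X" by (simp add: X_def)
  next
    fix a x assume a: "a \<in> K" and "x \<in> X"
    then have "scale a x = scale a (\<Sum>i\<in>I. scale (f i x) (b i))" by (simp add: X_def)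
    also have "\<dots> = (\<Sum>i\<in>I. scale (f i (scale a x)) (b i))"
      using a by (simp add: scale_sum_right f scale_scale)
    finally show "scale a x \<in> X" by (simp add: X_def)
  qed
  moreover have "b ` I \<subseteq> X"
  proof
    fix x assume "x \<in> b ` I"
    then obtain j where j: "j \<in> I" "x = b j" by auto
    have "(\<Sum>i\<in>I. scale (f i (b j)) (b i)) = (\<Sum>i\<in>I. if i = j then b i else 0)"
      using j by (intro sum.cong) (auto simp: dual scale_zero_left scale_one)
    then show "x \<in> X" using j I by (simp add: X_def)
  qed
  ultimately have "gen K scale (b ` I) \<subseteq> X" by (intro gen_least)
  then show ?thesis using gen by (auto simp: X_def)
qed

section \<open>The general linear group\<close>

lemma GL_carrier:
  "g \<in> carrier (GL K scale) \<longleftrightarrow>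
     bij g \<and> (\<forall>x y. g (x + y) = g x + g y) \<and> (\<forall>a\<in>K. \<forall>x. g (scale a x) = scale a (g x))"
  by (simp add: GL_def)

lemma GL_mult: "g \<otimes>\<^bsub>GL K scale\<^esub> h = g \<circ> h"
  and GL_one: "\<one>\<^bsub>GL K scale\<^esub> = id"
  by (simp_all add: GL_def)

lemma GL_id: "id \<in> carrier (GL K scale)"
  by (simp add: GL_carrier)

lemma GL_comp: "g \<in> carrier (GL K scale) \<Longrightarrow> h \<in> carrier (GL K scale) \<Longrightarrow> g \<circ> h \<in> carrier (GL K scale)"
  by (auto simp: GL_carrier bij_comp)

lemma GL_inv:
  assumes g: "g \<in> carrier (GL K scale)"
  shows "inv_into UNIV g \<in> carrier (GL K scale)"
proof -
  have bij: "bij g" using g by (simp add: GL_carrier)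
  have eq: "inv_into UNIV g (g x) = x" "g (inv_into UNIV g x) = x" for x
    using bij by (auto simp: bij_is_inj bij_is_surj surj_f_inv_f)
  have "inv_into UNIV g (x + y) = inv_into UNIV g x + inv_into UNIV g y" for x y
    using g eq by (metis GL_carrier)
  moreover have "inv_into UNIV g (scale a x) = scale a (inv_into UNIV g x)" if "a \<in> K" for a x
    using g eq that by (metis GL_carrier)
  ultimately show ?thesis using bij bij_imp_bij_inv by (simp add: GL_carrier)
qed

lemma GL_m_inv:
  assumes g: "g \<in> carrier (GL K scale)"
  shows "m_inv (GL K scale) g = inv_into UNIV g"
proof -
  have bij: "bij g" using g by (simp add: GL_carrier)
  have "g \<circ> inv_into UNIV g = id" "inv_into UNIV g \<circ> g = id"
    using bij by (auto simp: bij_is_inj bij_is_surj surj_iff[symmetric] inv_o_cancel)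
  then show ?thesis
    unfolding m_inv_def GL_mult GL_one using GL_inv[OF g]
    by (intro the_equality) (auto dest: inv_unique_comp)
qed

text \<open>Induction on words in the generators and their inverses: it suffices that
  \<open>H\<close> contains the letters and is closed under composition.\<close>

lemma generate_GL_subset:
  assumes S: "S \<subseteq> carrier (GL K scale)"
    and H: "id \<in> H" "S \<subseteq> H" "\<And>s. s \<in> S \<Longrightarrow> inv_into UNIV s \<in> H"
      "\<And>g h. g \<in> H \<Longrightarrow> h \<in> H \<Longrightarrow> g \<circ> h \<in> H"
  shows "generate (GL K scale) S \<subseteq> H"
proof
  fix g assume "g \<in> generate (GL K scale) S"
  then show "g \<in> H"
  proof (induction rule: generate.induct)
    case (inv h)
    then show ?case using S H(3) GL_m_inv by auto
  next
    case one
    show ?case unfolding GL_one by (rule H(1))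
  next
    case (incl h)
    then show ?case using H(2) by blast
  next
    case (eng h1 h2)
    then show ?case unfolding GL_mult by (intro H(4))
  qed
qed

lemma GL_0: "g \<in> carrier (GL K scale) \<Longrightarrow> g 0 = 0"
  unfolding GL_carrier by (metis add_cancel_right_left)

lemma GL_diff: "g \<in> carrier (GL K scale) \<Longrightarrow> g (x - y) = g x - g y"
  unfolding GL_carrier by (metis add_diff_cancel_right' diff_add_cancel)

lemma GL_sum: "g \<in> carrier (GL K scale) \<Longrightarrow> g (sum f I) = (\<Sum>i\<in>I. g (f i))"
  using GL_0 by (induction I rule: infinite_finite_induct) (auto simp: GL_carrier)

lemma GL_scale: "g \<in> carrier (GL K scale) \<Longrightarrow> a \<in> K \<Longrightarrow> g (scale a x) = scale a (g x)"
  by (simp add: GL_carrier)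

lemma GL_multiples:
  "g \<in> carrier (GL K scale) \<Longrightarrow> A \<subseteq> K \<Longrightarrow> g ` multiples A scale v = multiples A scale (g v)"
  unfolding multiples_image image_image by (intro image_cong) (auto simp: GL_scale)

end

sublocale hermitian_pairing \<subseteq> number_ring K
  by unfold_locales (rule number_field)

sublocale hermitian_pairing \<subseteq> VS: number_field_space K sV
  by unfold_locales

sublocale hermitian_pairing \<subseteq> WS: number_field_space K sW
  by unfold_locales

section \<open>Roots, reflections and ideals in a Hermitian pairing\<close>

context hermitian_pairing
begin

lemma cnj_O: "cnj ` \<O> = \<O>"
proof -
  have "cnj ` \<O> \<subseteq> \<O>" by (auto simp: ints_of_def intro: cnj_stable)
  then show ?thesis by (metis complex_cnj_cnj image_eqI subsetI subset_antisym image_subset_iff)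
qed

lemma cnj_ideal_mult: "cnj ` (A \<star> B) = (cnj ` A) \<star> (cnj ` B)"
proof -
  have "cnj ` ideal_gen (set_prod A B) = ideal_gen (cnj ` set_prod A B)"
    by (rule gen_linear_image[where \<sigma> = cnj]) (auto simp: cnj_O)
  also have "cnj ` set_prod A B = set_prod (cnj ` A) (cnj ` B)"
    by (force simp: set_prod_def)
  finally show ?thesis by (simp add: ideal_mult_conv)
qed

lemma fractional_cnj:
  assumes "fractional A" shows "fractional (cnj ` A)"
proof -
  have "fin_gen \<O> (*) (cnj ` A)"
    by (rule fin_gen_linear_image[where \<sigma> = cnj and scale = "(*)" and R = \<O>])
      (use assms in \<open>auto simp: cnj_O fractional_ideal_def\<close>)
  moreover have "cnj ` A \<subseteq> K" using fractional_subset_K[OF assms] cnj_stable by auto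
  moreover have "cnj ` A \<noteq> {0}" using fractional_nonzero[OF assms] by auto
  ultimately show ?thesis by (simp add: fractional_ideal_def)
qed

lemma pr_zero_left: "pr 0 w = 0"
  using pr_add_left[of 0 0 w] by simp

lemma pr_zero_right: "pr v 0 = 0"
  using pr_add_right[of v 0 0] by simp

lemma pr_diff_left: "pr (v - v') w = pr v w - pr v' w"
  using pr_add_left[of "v - v'" v' w] by (simp add: algebra_simps)

lemma pr_diff_right: "pr v (w - w') = pr v w - pr v w'"
  using pr_add_right[of v "w - w'" w'] by (simp add: algebra_simps)

lemma pr_sum_left: "pr (sum f I) w = (\<Sum>i\<in>I. pr (f i) w)"
  by (induction I rule: infinite_finite_induct) (auto simp: pr_zero_left pr_add_left)

lemma pr_sum_right: "pr v (sum f I) = (\<Sum>i\<in>I. pr v (f i))"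
  by (induction I rule: infinite_finite_induct) (auto simp: pr_zero_right pr_add_right)

text \<open>With \<open>pr v w = 1 - z\<close>, this is \<open>A\<close> acting on the root \<open>(\<O> v, \<O> w, z)\<close>.\<close>

definition root_at :: "complex set \<Rightarrow> 'v \<Rightarrow> 'w \<Rightarrow> complex \<Rightarrow> ('v, 'w) root" where
  "root_at A v w z = (multiples A sV v, multiples (cnj ` ideal_inverse K A) sW w, z)"

text \<open>An explicit form of \<open>reflection\<close>, which is defined by a
  description.\<close>

definition refl :: "'v \<Rightarrow> 'w \<Rightarrow> 'v \<Rightarrow> 'v" where
  "refl v w = (\<lambda>x. x - sV (pr x w) v)"

definition root_pair :: "'v \<Rightarrow> 'w \<Rightarrow> complex \<Rightarrow> bool" where
  "root_pair v w z \<longleftrightarrow> z \<in> K \<and> z \<noteq> 1 \<and> (\<exists>n>0. z ^ n = 1) \<and> pr v w = 1 - z"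

lemma root_pair_nonzero: "root_pair v w z \<Longrightarrow> v \<noteq> 0" "root_pair v w z \<Longrightarrow> w \<noteq> 0"
  by (auto simp: root_pair_def pr_zero_left pr_zero_right)

text \<open>For multiples \<open>sV a v0\<close> and \<open>sW b w0\<close> only the product
  \<open>a * cnj b\<close> enters the reflection, and the prescribed nonzero pairing
  \<open>1 - z\<close> fixes it. This makes the description in \<open>reflection\<close> well
  defined.\<close>

lemma refl_unique:
  assumes z: "z \<noteq> 1"
    and v: "v \<in> multiples K sV v0" "v' \<in> multiples K sV v0"
    and w: "w \<in> multiples K sW w0" "w' \<in> multiples K sW w0"
    and eq: "pr v w = 1 - z" "pr v' w' = 1 - z"
  shows "refl v w = refl v' w'"
proof -
  obtain a a' b b' where ab: "a \<in> K" "a' \<in> K" "b \<in> K" "b' \<in> K"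
    "v = sV a v0" "v' = sV a' v0" "w = sW b w0" "w' = sW b' w0"
    using v w by (auto simp: multiples_def)
  then have "a * cnj b * pr v0 w0 = 1 - z" "a' * cnj b' * pr v0 w0 = 1 - z"
    using eq by (simp_all add: pr_scale_left pr_scale_right mult_ac)
  then have "a * cnj b = a' * cnj b'" using z
    by (metis eq_iff_diff_eq_0 mult_cancel_right mult_zero_right)
  then have "cnj b * pr x w0 * a = cnj b' * pr x w0 * a'" for x
    by (simp add: mult_ac)
  moreover have "sV (pr x w) v = sV (cnj b * pr x w0 * a) v0" for x
    using ab by (simp add: pr_scale_right V.scale_scale K_mult cnj_stable pr_in)
  moreover have "sV (pr x w') v' = sV (cnj b' * pr x w0 * a') v0" for x
    using ab by (simp add: pr_scale_right V.scale_scale K_mult cnj_stable pr_in)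
  ultimately show ?thesis
    unfolding refl_def by (simp only:)
qed

lemma reflection_eq_refl:
  assumes "z \<noteq> 1" "gen K sV I = multiples K sV v0" "gen K sW J = multiples K sW w0"
    and "v \<in> gen K sV I" "w \<in> gen K sW J" "pr v w = 1 - z"
  shows "reflection (I, J, z) = refl v w"
  unfolding reflection_def case_prod_conv
proof (rule the_equality)
  show "\<exists>a\<in>gen K sV I. \<exists>b\<in>gen K sW J. pr a b = 1 - z \<and> refl v w = (\<lambda>x. x - sV (pr x b) a)"
    using assms unfolding refl_def by blast
  fix s assume "\<exists>v\<in>gen K sV I. \<exists>w\<in>gen K sW J. pr v w = 1 - z \<and> s = (\<lambda>x. x - sV (pr x w) v)"
  then obtain v' w' where "v' \<in> gen K sV I" "w' \<in> gen K sW J" "pr v' w' = 1 - z" "s = refl v' w'"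
    unfolding refl_def by blast
  then show "s = refl v w"
    using assms refl_unique[of z v' v0 v w' w0 w] by simp
qed

lemma multiples_fractional_gen:
  assumes "fractional A"
  shows "gen K sV (multiples A sV v) = multiples K sV v"
    and "gen K sW (multiples (cnj ` ideal_inverse K A) sW w) = multiples K sW w"
proof -
  obtain a where "a \<in> A" "a \<noteq> 0" using fractional_nonzero[OF assms] by auto
  then show "gen K sV (multiples A sV v) = multiples K sV v"
    using VS.gen_K_multiples[OF fractional_subset_K[OF assms]] by blast
  have B: "fractional (cnj ` ideal_inverse K A)"
    using assms by (intro fractional_cnj fractional_inverse)
  obtain a where "a \<in> cnj ` ideal_inverse K A" "a \<noteq> 0" using fractional_nonzero[OF B] by auto
  then show "gen K sW (multiples (cnj ` ideal_inverse K A) sW w) = multiples K sW w"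
    using WS.gen_K_multiples[OF fractional_subset_K[OF B]] by blast
qed

lemma reflection_root_at:
  assumes "fractional A" "root_pair v w z"
  shows "reflection (root_at A v w z) = refl v w"
  unfolding root_at_def using assms multiples_fractional_gen[OF assms(1)]
  by (intro reflection_eq_refl) (auto simp: root_pair_def VS.self_in_multiples WS.self_in_multiples)

text \<open>The right-hand ideal is conjugated because the pairing is conjugate-linear there; the
  values then form the plain product of ideals, scaled by one number.\<close>

lemma pair_ideal_multiples:
  assumes "A \<subseteq> K" "B \<subseteq> K"
  shows "pair_ideal (multiples A sV v) (multiples (cnj ` B) sW w) = (\<lambda>t. t * pr v w) ` (A \<star> B)"
proof -
  have *: "pr (sV a v) (sW (cnj b) w) = a * b * pr v w" if "a \<in> A" "b \<in> B" for a b
    using that assms by (simp add: pr_scale_left pr_scale_right cnj_stable subset_iff)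
  have "{pr x y |x y. x \<in> multiples A sV v \<and> y \<in> multiples (cnj ` B) sW w}
      = (\<lambda>t. t * pr v w) ` set_prod A B" (is "?L = ?R")
  proof
    show "?L \<subseteq> ?R"
    proof
      fix t assume "t \<in> ?L"
      then obtain a b where "a \<in> A" "b \<in> B" "t = pr (sV a v) (sW (cnj b) w)"
        by (auto simp: multiples_def)
      then show "t \<in> ?R" using * by (auto simp: set_prod_def)
    qed
    show "?R \<subseteq> ?L"
    proof
      fix t assume "t \<in> ?R"
      then obtain a b where "a \<in> A" "b \<in> B" "t = a * b * pr v w"
        by (auto simp: set_prod_def)
      then show "t \<in> ?L"
        using *[of a b] by (auto simp: multiples_def intro!: exI[of _ "sV a v"] exI[of _ "sW (cnj b) w"])
    qed
  qed
  moreover have "(\<lambda>t. t * pr v w) ` ideal_gen (set_prod A B) = ideal_gen ((\<lambda>t. t * pr v w) ` set_prod A B)"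
    by (rule gen_linear_image[where \<sigma> = id]) (auto simp: algebra_simps)
  ultimately show ?thesis by (simp add: pair_ideal_def ideal_mult_conv)
qed

lemma is_root_root_at:
  assumes A: "fractional A" and vw: "root_pair v w z"
  shows "is_root (root_at A v w z)"
proof -
  have B: "fractional (ideal_inverse K A)" by (rule fractional_inverse[OF A])
  have "pair_ideal (multiples A sV v) (multiples (cnj ` ideal_inverse K A) sW w) = principal K (1 - z)"
    using pair_ideal_multiples[OF fractional_subset_K[OF A] fractional_subset_K[OF B]] vw
    by (simp add: ideal_mult_inverse[OF A] root_pair_def) (auto simp: principal_def multiples_def)
  moreover have "rank_one K sV (multiples A sV v)"
    "rank_one K sW (multiples (cnj ` ideal_inverse K A) sW w)"
    using multiples_fractional_gen[OF A] root_pair_nonzero[OF vw] by (auto simp: rank_one_def)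
  ultimately show ?thesis
    unfolding is_root_def root_at_def
    using vw VS.fin_gen_multiples[OF A] WS.fin_gen_multiples[OF fractional_cnj[OF B]]
    by (auto simp: root_pair_def)
qed

text \<open>The pairings generate the nonzero ideal of \<open>1 - z\<close>, so some pair of
  elements of \<open>I\<close> and \<open>J\<close> has nonzero pairing; rescaling the second vector
  adjusts its value to \<open>1 - z\<close>.\<close>

lemma root_vectors:
  assumes "is_root (I, J, z)"
  obtains v w where "v \<in> gen K sV I" "w \<in> gen K sW J" "root_pair v w z"
    "gen K sV I = multiples K sV v" "gen K sW J = multiples K sW w"
proof -
  obtain v0 w0 where v0: "v0 \<noteq> 0" "gen K sV I = multiples K sV v0"
    and w0: "w0 \<noteq> 0" "gen K sW J = multiples K sW w0"
    and z: "z \<in> K" "z \<noteq> 1" "\<exists>n>0. z ^ n = 1" and pi: "pair_ideal I J = principal K (1 - z)"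
    using assms by (auto simp: is_root_def rank_one_def)
  have "\<exists>x\<in>I. \<exists>y\<in>J. pr x y \<noteq> 0"
  proof (rule ccontr)
    assume "\<not> ?thesis"
    then have "pair_ideal I J \<subseteq> {0}"
      unfolding pair_ideal_def by (intro gen_least) (auto simp: submod_def)
    then show False using principal_base[of "1 - z"] pi z(2) by auto
  qed
  then obtain x y where xy: "x \<in> I" "y \<in> J" "pr x y \<noteq> 0" by blast
  then have "x \<in> gen K sV I" "y \<in> gen K sW J" by (auto intro: gen_base)
  define c where "c = cnj ((1 - z) / pr x y)"
  have c: "c \<in> K"
    unfolding c_def using z(1) by (intro cnj_stable K_divide K_diff K_1 pr_in)
  have y': "sW c y \<in> gen K sW J"
    using \<open>y \<in> gen K sW J\<close> c by (intro submod_scale[OF submod_gen])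
  have pr: "pr x (sW c y) = 1 - z"
    using xy(3) c by (simp add: pr_scale_right c_def)
  then have rp: "root_pair x (sW c y) z" using z by (simp add: root_pair_def)
  show thesis
  proof (rule that[OF \<open>x \<in> gen K sV I\<close> y' rp])
    show "gen K sV I = multiples K sV x"
      using VS.multiples_eq[of x v0] v0 \<open>x \<in> gen K sV I\<close> root_pair_nonzero(1)[OF rp] by simp
    show "gen K sW J = multiples K sW (sW c y)"
      using WS.multiples_eq[of "sW c y" w0] w0 y' root_pair_nonzero(2)[OF rp] by simp
  qed
qed

text \<open>Since \<open>pair_ideal I J\<close> is principal, \<open>J\<close> is determined by \<open>I\<close>.\<close>

lemma root_form:
  assumes root: "is_root (I, J, z)"
    and v: "v \<in> gen K sV I" and w: "w \<in> gen K sW J" and pr: "pr v w = 1 - z"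
  obtains A where "fractional A" "root_pair v w z" "(I, J, z) = root_at A v w z"
proof -
  have z: "z \<in> K" "z \<noteq> 1" "\<exists>n>0. z ^ n = 1" and pi: "pair_ideal I J = principal K (1 - z)"
    and fg: "fin_gen \<O> sV I" "fin_gen \<O> sW J"
    using root by (auto simp: is_root_def)
  have rp: "root_pair v w z" using z pr by (simp add: root_pair_def)
  have nz: "v \<noteq> 0" "w \<noteq> 0" using root_pair_nonzero[OF rp] by auto
  have gI: "gen K sV I = multiples K sV v" and gJ: "gen K sW J = multiples K sW w"
    using root_vectors[OF root] VS.multiples_eq[OF _ nz(1)] WS.multiples_eq[OF _ nz(2)] v w by metis+
  \<comment> \<open>Coordinates on the two lines: \<open>f x\<close> is the coefficient of
    \<open>x\<close> along \<open>v\<close>, and \<open>g y\<close> the conjugate of the coefficient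
    of \<open>y\<close> along \<open>w\<close>. The images of \<open>I\<close> and \<open>J\<close>
    are the ideals sought.\<close>
  define f where "f = (\<lambda>x. pr x w / (1 - z))"
  define g where "g = (\<lambda>y. pr v y / (1 - z))"
  have f: "x = sV (f x) v \<and> f x \<in> K" if "x \<in> I" for x
  proof -
    have "x \<in> multiples K sV v" using that gI gen_base by metis
    then obtain a where "a \<in> K" "x = sV a v" by (auto simp: multiples_def)
    then show ?thesis using z(2) pr by (simp add: f_def pr_scale_left)
  qed
  have g: "y = sW (cnj (g y)) w \<and> g y \<in> K" if "y \<in> J" for y
  proof -
    have "y \<in> multiples K sW w" using that gJ gen_base by metis
    then obtain a where "a \<in> K" "y = sW a w" by (auto simp: multiples_def)
    then show ?thesis using z(2) pr by (simp add: g_def pr_scale_right cnj_stable)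
  qed
  have I: "I = multiples (f ` I) sV v"
    unfolding VS.multiples_image image_image using f by (force simp: image_iff)
  have J: "J = multiples (cnj ` g ` J) sW w"
    unfolding WS.multiples_image image_image using g by (force simp: image_iff)
  have fK: "f ` I \<subseteq> K" "g ` J \<subseteq> K" using f g by auto
  have fgf: "fin_gen \<O> (*) (f ` I)"
    by (rule fin_gen_linear_image[where \<sigma> = id, OF _ _ _ fg(1)])
      (use O_subset_K in \<open>auto simp: f_def pr_add_left add_divide_distrib pr_scale_left\<close>)
  have fgg: "fin_gen \<O> (*) (g ` J)"
    by (rule fin_gen_linear_image[where \<sigma> = cnj, OF _ _ _ fg(2)])
      (use O_subset_K in \<open>auto simp: g_def pr_add_right add_divide_distrib pr_scale_right cnj_O\<close>)
  have "(\<lambda>t. t * (1 - z)) ` (f ` I \<star> g ` J) = pair_ideal I J"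
    using pair_ideal_multiples[OF fK, of v w] I J pr by simp
  also have "\<dots> = (\<lambda>t. t * (1 - z)) ` \<O>"
    unfolding pi by (auto simp: principal_def multiples_def)
  finally have "(\<lambda>t. t / (1 - z)) ` (\<lambda>t. t * (1 - z)) ` (f ` I \<star> g ` J)
      = (\<lambda>t. t / (1 - z)) ` (\<lambda>t. t * (1 - z)) ` \<O>" by simp
  then have prod: "f ` I \<star> g ` J = \<O>"
    using z(2) by (simp add: image_image)
  have sub: "submodule (g ` J)"
    using fgg submod_gen by (metis fin_gen_def)
  have "f ` I \<noteq> {0}"
  proof
    assume "f ` I = {0}"
    then have "f ` I \<star> g ` J \<subseteq> {0}" by (intro ideal_mult_least) (auto simp: submod_def)
    then show False using prod O_1 by auto
  qed
  then have A: "fractional (f ` I)" using fK fgf by (simp add: fractional_ideal_def)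
  have "ideal_inverse K (f ` I) = g ` J"
    by (rule ideal_inverse_unique[OF sub fK(2) prod])
  then have "(I, J, z) = root_at (f ` I) v w z"
    unfolding root_at_def using I J by simp
  then show thesis using that A rp by blast
qed

lemma is_root_cases:
  assumes "is_root \<rho>"
  obtains A v w z where "fractional A" "root_pair v w z" "\<rho> = root_at A v w z"
proof -
  obtain I J z where \<rho>: "\<rho> = (I, J, z)" by (cases \<rho>)
  then have root: "is_root (I, J, z)" using assms by simp
  obtain v w where vw: "v \<in> gen K sV I" "w \<in> gen K sW J" "root_pair v w z"
    by (rule root_vectors[OF root])
  then have "pr v w = 1 - z" by (simp add: root_pair_def)
  then show thesis
    using root_form[OF root vw(1,2)] that \<rho> by metis
qed

lemma ideal_act_root_at:
  assumes "fractional A" "fractional C"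
  shows "ideal_act C (root_at A v w z) = root_at (C \<star> A) v w z"
proof -
  have "cnj ` ideal_inverse K C \<star> cnj ` ideal_inverse K A = cnj ` ideal_inverse K (C \<star> A)"
    using assms by (simp add: ideal_inverse_mult cnj_ideal_mult)
  then show ?thesis
    using assms unfolding root_at_def ideal_act_def ideal_inverse_cnj_def
    by (simp add: VS.ideal_mult_multiples WS.ideal_mult_multiples fractional_subset_K
        fractional_cnj fractional_inverse)
qed

lemma root_at_eqD:
  assumes "root_at A v w z = root_at B v w z" "fractional A" "fractional B" "v \<noteq> 0"
  shows "A = B"
  using assms VS.multiples_vector_eq_iff[of v A B] by (simp add: root_at_def fractional_subset_K)

text \<open>The same root is presented by all unit multiples of its vectors. This absorbs the roots
  of unity that monomial maps produce.\<close>

lemma root_at_unit: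
  assumes "fractional A" "u \<in> \<O>" "inverse u \<in> \<O>" "u \<noteq> 0" "c \<in> \<O>" "inverse c \<in> \<O>" "c \<noteq> 0"
  shows "root_at A (sV u v) (sW c w) z = root_at A v w z"
  unfolding root_at_def
  using assms fractional_cnj[OF fractional_inverse[OF assms(1)]]
  by (simp add: VS.multiples_unit WS.multiples_unit fractional_submodule fractional_subset_K)

lemma refl_ideal_act:
  assumes "is_root \<rho>" "fractional C"
  shows "reflection (ideal_act C \<rho>) = reflection \<rho>"
  using assms
  by (auto elim!: is_root_cases simp: ideal_act_root_at reflection_root_at fractional_mult)

lemma is_root_ideal_act:
  assumes "is_root \<rho>" "fractional C"
  shows "is_root (ideal_act C \<rho>)"
  using assms
  by (auto elim!: is_root_cases simp: ideal_act_root_at is_root_root_at fractional_mult)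

end

section \<open>Contragredient maps and the action on root systems\<close>

context hermitian_pairing_basis
begin

lemma expand_V: "v = (\<Sum>i=1..r. sV (pr v (eW i)) (eV i))"
  using basis_V
  by (intro VS.dual_basis_expansion) (auto simp: basis_of_def pr_in pr_add_left pr_scale_left dual)

lemma expand_W: "w = (\<Sum>i=1..r. sW (cnj (pr (eV i) w)) (eW i))"
  using basis_W
  by (intro WS.dual_basis_expansion)
    (auto simp: basis_of_def pr_in cnj_stable pr_add_right pr_scale_right dual)

lemma vector_eqI:
  assumes "\<And>i. i \<in> {1..r} \<Longrightarrow> pr v (eW i) = pr v' (eW i)"
  shows "v = v'"
  by (subst expand_V[of v], subst expand_V[of v'], intro sum.cong refl) (simp add: assms)

lemma covector_eqI:
  assumes "\<And>i. i \<in> {1..r} \<Longrightarrow> pr (eV i) w = pr (eV i) w'"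
  shows "w = w'"
  by (subst expand_W[of w], subst expand_W[of w'], intro sum.cong refl) (simp add: assms)

text \<open>Pairing with \<open>g (eV i)\<close> prescribes the coordinates of the adjoint in the
  dual basis.\<close>

lemma GL_adjoint:
  assumes g: "g \<in> carrier (GL K sV)"
  shows "\<exists>h. \<forall>v w. pr v (h w) = pr (g v) w"
proof -
  define h where "h = (\<lambda>w. \<Sum>i=1..r. sW (cnj (pr (g (eV i)) w)) (eW i))"
  have "pr v (h w) = pr (g v) w" for v w
  proof -
    have "pr v (h w) = (\<Sum>i=1..r. pr (g (eV i)) w * pr v (eW i))"
      by (simp add: h_def pr_sum_right pr_scale_right pr_in cnj_stable)
    also have "\<dots> = pr (\<Sum>i=1..r. sV (pr v (eW i)) (g (eV i))) w"
      by (simp add: pr_sum_left pr_scale_left pr_in mult.commute)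
    also have "(\<Sum>i=1..r. sV (pr v (eW i)) (g (eV i))) = g (\<Sum>i=1..r. sV (pr v (eW i)) (eV i))"
      using g by (simp add: VS.GL_sum VS.GL_scale pr_in)
    also have "\<dots> = g v" by (simp only: expand_V[of v, symmetric])
    finally show ?thesis .
  qed
  then show ?thesis by blast
qed

lemma pr_right_eqI:
  assumes "\<And>v. pr v w = pr v w'" shows "w = w'"
proof -
  have "w - w' = 0" by (rule nondegenerate_right) (simp add: pr_diff_right assms)
  then show ?thesis by simp
qed

lemma
  assumes g: "g \<in> carrier (GL K sV)"
  shows contragredient_GL: "contragredient g \<in> carrier (GL K sW)"
    and pr_contragredient: "pr (g v) (contragredient g w) = pr v w"
    and contragredient_unique: "\<And>h. (\<And>v w. pr (g v) (h w) = pr v w) \<Longrightarrow> contragredient g = h"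
proof -
  have gi: "inv_into UNIV g \<in> carrier (GL K sV)" by (rule VS.GL_inv[OF g])
  have bij: "bij g" using g by (simp add: VS.GL_carrier)
  have eq: "inv_into UNIV g (g x) = x" "g (inv_into UNIV g x) = x" for x
    using bij by (auto simp: bij_is_inj bij_is_surj surj_f_inv_f)
  \<comment> \<open>The contragredient is \<open>h\<close>, the adjoint of the inverse of
    \<open>g\<close>; the adjoint \<open>k\<close> of \<open>g\<close> is its inverse map and gives
    bijectivity.\<close>
  obtain k where k: "\<And>v w. pr v (k w) = pr (g v) w" using GL_adjoint[OF g] by blast
  obtain h where h: "\<And>v w. pr v (h w) = pr (inv_into UNIV g v) w" using GL_adjoint[OF gi] by blast
  have uniq: "h' = h" if "\<And>v w. pr (g v) (h' w) = pr v w" for h'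
  proof
    fix w
    show "h' w = h w"
      by (rule pr_right_eqI) (metis eq(2) h that)
  qed
  have "h (k w) = w" "k (h w) = w" for w
    by (rule pr_right_eqI, simp add: h k eq)+
  then have "bij h" by (metis bijI')
  moreover have "h (x + y) = h x + h y" for x y
    by (rule pr_right_eqI) (simp add: h pr_add_right)
  moreover have "h (sW a x) = sW a (h x)" if "a \<in> K" for a x
    by (rule pr_right_eqI) (simp add: h pr_scale_right that)
  ultimately have hGL: "h \<in> carrier (GL K sW)" by (simp add: WS.GL_carrier)
  have hpr: "pr (g v) (h w) = pr v w" for v w by (simp add: h eq)
  have cg: "contragredient g = h"
    unfolding contragredient_def using hGL hpr uniq by (intro the_equality) auto
  show "contragredient g \<in> carrier (GL K sW)" "pr (g v) (contragredient g w) = pr v w"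
    unfolding cg by (rule hGL) (rule hpr)
  show "contragredient g = h'" if "\<And>v w. pr (g v) (h' w) = pr v w" for h'
    unfolding cg using uniq[OF that] by (rule sym)
qed

lemma act_id: "act id \<rho> = \<rho>"
proof -
  have "contragredient id = id" by (rule contragredient_unique[OF VS.GL_id]) simp
  then show ?thesis by (cases \<rho>) (simp add: act_def)
qed

lemma act_comp:
  assumes g: "g \<in> carrier (GL K sV)" and h: "h \<in> carrier (GL K sV)"
  shows "act (g \<circ> h) \<rho> = act g (act h \<rho>)"
proof -
  have "contragredient (g \<circ> h) = contragredient g \<circ> contragredient h"
    by (rule contragredient_unique[OF VS.GL_comp[OF g h]]) (simp add: pr_contragredient g h)
  then show ?thesis by (cases \<rho>) (simp add: act_def image_comp)
qed

lemma act_root_at: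
  assumes "g \<in> carrier (GL K sV)" "fractional A"
  shows "act g (root_at A v w z) = root_at A (g v) (contragredient g w) z"
  using assms contragredient_GL[OF assms(1)] fractional_cnj[OF fractional_inverse[OF assms(2)]]
  by (simp add: act_def root_at_def VS.GL_multiples WS.GL_multiples fractional_subset_K)

lemma act_ideal_act:
  assumes "g \<in> carrier (GL K sV)" "is_root \<rho>" "fractional C"
  shows "act g (ideal_act C \<rho>) = ideal_act C (act g \<rho>)"
  using assms
  by (auto elim!: is_root_cases simp: ideal_act_root_at act_root_at fractional_mult)

lemma generate_superset: "S \<subseteq> generate M S"
  by (auto intro: generate.incl)

text \<open>The maps that preserve \<open>\<R>\<close> include the reflections and their inverses
  and are closed under composition, so they exhaust the generated group.\<close>

lemma root_system_act:
  assumes R: "root_system_for G \<R>" and G: "G \<subseteq> carrier (GL K sV)" and g: "g \<in> G"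
  shows "act g ` \<R> = \<R>"
proof -
  have gen: "generate (GL K sV) (reflection ` \<R>) = G" and sys: "root_system \<R>"
    using R by (auto simp: root_system_for_def)
  have S: "reflection ` \<R> \<subseteq> carrier (GL K sV)"
    using generate_superset[of "reflection ` \<R>" "GL K sV"] gen G by blast
  define H where "H = {g \<in> carrier (GL K sV). act g ` \<R> = \<R>}"
  have comp: "act (g \<circ> h) ` X = act g ` act h ` X"
    if "g \<in> carrier (GL K sV)" "h \<in> carrier (GL K sV)" for g h and X :: "('v, 'w) root set"
    using act_comp[OF that] by (simp add: image_image)
  have "act id = (\<lambda>\<rho>. \<rho>)" by (rule ext) (rule act_id)
  then have id: "act id ` \<R> = \<R>" by simp
  have S_H: "s \<in> H" if "s \<in> reflection ` \<R>" for s
  proof -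
    have "act s ` \<R> = \<R>" using that sys unfolding root_system_def by blast
    then show ?thesis using that S by (auto simp: H_def)
  qed
  have "generate (GL K sV) (reflection ` \<R>) \<subseteq> H"
  proof (rule VS.generate_GL_subset[OF S])
    show "id \<in> H" using id VS.GL_id by (simp add: H_def)
    show "reflection ` \<R> \<subseteq> H" using S_H by blast
    fix s assume s: "s \<in> reflection ` \<R>"
    then have sGL: "s \<in> carrier (GL K sV)" using S by blast
    then have bij: "bij s" by (simp add: VS.GL_carrier)
    have "act (inv_into UNIV s) ` \<R> = act (inv_into UNIV s) ` act s ` \<R>"
      using S_H[OF s] by (simp add: H_def)
    also have "\<dots> = act (inv_into UNIV s \<circ> s) ` \<R>"
      using comp[OF VS.GL_inv[OF sGL] sGL] by simp
    also have "inv_into UNIV s \<circ> s = id" using bij by (simp add: bij_is_inj)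
    finally have "act (inv_into UNIV s) ` \<R> = \<R>" unfolding id .
    then show "inv_into UNIV s \<in> H" using VS.GL_inv[OF sGL] by (simp add: H_def)
  next
    fix g h assume "g \<in> H" "h \<in> H"
    then show "g \<circ> h \<in> H" using comp VS.GL_comp by (auto simp: H_def)
  qed
  then show ?thesis using g gen by (auto simp: H_def)
qed

text \<open>In each pairing ideal, built from \<open>A \<star> ideal_inverse K B\<close>, the factor
  \<open>C\<close> cancels, so integrality survives. Reflections do not change, and the actions of
  maps and ideals commute. So every fractional ideal leads to a member of the same genus.\<close>

lemma distinguished_systems_ideal_act:
  assumes R: "\<R> \<in> distinguished_systems G" and G: "G \<subseteq> carrier (GL K sV)" and C: "fractional C"
  shows "ideal_act C ` \<R> \<in> distinguished_systems G"
proof -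
  have sys: "root_system \<R>" and gen: "generate (GL K sV) (reflection ` \<R>) = G"
    and inj: "inj_on reflection \<R>"
    and dist: "\<And>\<rho>. \<rho> \<in> \<R> \<Longrightarrow> distinguished_reflection G (reflection \<rho>)"
    using R by (auto simp: distinguished_systems_def root_system_for_def)
  have root: "is_root \<rho>" if "\<rho> \<in> \<R>" for \<rho> using sys that by (simp add: root_system_def)
  have refl_eq: "reflection (ideal_act C \<rho>) = reflection \<rho>" if "\<rho> \<in> \<R>" for \<rho>
    using refl_ideal_act[OF root[OF that] C] .
  have im: "reflection ` ideal_act C ` \<R> = reflection ` \<R>"
    unfolding image_image by (rule image_cong[OF HOL.refl]) (rule refl_eq)
  have S: "reflection ` \<R> \<subseteq> carrier (GL K sV)"
    using generate_superset[of "reflection ` \<R>" "GL K sV"] gen G by blast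
  have int: "pair_ideal (fst (ideal_act C \<rho>)) (fst (snd (ideal_act C \<sigma>))) \<subseteq> \<O>"
    if mem: "\<rho> \<in> \<R>" "\<sigma> \<in> \<R>" for \<rho> \<sigma>
  proof -
    obtain A v w z where \<rho>: "fractional A" "\<rho> = root_at A v w z"
      using root[OF mem(1)] by (rule is_root_cases)
    obtain B v' w' z' where \<sigma>: "fractional B" "\<sigma> = root_at B v' w' z'"
      using root[OF mem(2)] by (rule is_root_cases)
    have p: "pair_ideal (fst (root_at A' v w z)) (fst (snd (root_at B' v' w' z')))
        = (\<lambda>t. t * pr v w') ` (A' \<star> ideal_inverse K B')"
      if "fractional A'" "fractional B'" for A' B'
      using pair_ideal_multiples[of A' "ideal_inverse K B'" v w'] that
      by (simp add: root_at_def fractional_subset_K fractional_inverse)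
    have "(C \<star> A) \<star> ideal_inverse K (C \<star> B)
        = (C \<star> ideal_inverse K C) \<star> (A \<star> ideal_inverse K B)"
      unfolding ideal_inverse_mult[OF C \<sigma>(1)] by (simp only: ideal_mult_ac)
    also have "\<dots> = A \<star> ideal_inverse K B"
      by (simp add: ideal_mult_inverse[OF C] ideal_mult_O_left submodule_ideal_mult)
    finally have "pair_ideal (fst (ideal_act C \<rho>)) (fst (snd (ideal_act C \<sigma>)))
        = pair_ideal (fst \<rho>) (fst (snd \<sigma>))"
      by (simp add: \<rho> \<sigma> C ideal_act_root_at p fractional_mult)
    then show ?thesis using sys mem by (simp add: root_system_def)
  qed
  have "UNIV = gen K sV (\<Union>\<rho>\<in>\<R>. fst \<rho>)" using sys by (simp add: root_system_def)
  also have "\<dots> \<subseteq> gen K sV (\<Union>\<rho>\<in>ideal_act C ` \<R>. fst \<rho>)" (is "_ \<subseteq> ?X")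
  proof (intro gen_least submod_gen UN_least)
    fix \<rho> assume "\<rho> \<in> \<R>"
    obtain A v w z where \<rho>: "fractional A" "\<rho> = root_at A v w z"
      using root[OF \<open>\<rho> \<in> \<R>\<close>] by (rule is_root_cases)
    have "fst \<rho> \<subseteq> multiples K sV v"
      using fractional_subset_K[OF \<rho>(1)] by (auto simp: \<rho>(2) root_at_def multiples_def)
    also have "\<dots> = gen K sV (fst (ideal_act C \<rho>))"
      using multiples_fractional_gen(1)[OF fractional_mult[OF C \<rho>(1)], of v]
      unfolding \<rho>(2) ideal_act_root_at[OF \<rho>(1) C] by (simp add: root_at_def)
    also have "\<dots> \<subseteq> ?X" using \<open>\<rho> \<in> \<R>\<close> by (intro gen_mono) auto
    finally show "fst \<rho> \<subseteq> ?X" .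
  qed
  finally have span: "?X = UNIV" by auto
  have "act (reflection \<rho>) ` ideal_act C ` \<R> = ideal_act C ` \<R>" if "\<rho> \<in> \<R>" for \<rho>
  proof -
    have "act (reflection \<rho>) ` ideal_act C ` \<R> = ideal_act C ` act (reflection \<rho>) ` \<R>"
      using act_ideal_act[OF _ root C] S that by (auto simp: image_image intro!: image_cong)
    then show ?thesis using sys that by (simp add: root_system_def)
  qed
  then have "root_system (ideal_act C ` \<R>)"
    using sys span int root is_root_ideal_act[OF _ C] refl_eq by (simp add: root_system_def)
  then show ?thesis
    using gen im inj dist refl_eq
    by (auto simp: distinguished_systems_def root_system_for_def inj_on_def)
qed

end

section \<open>Monomial maps\<close>

locale monomial_setting = hermitian_pairing_basis K sV sW pr r eV eW
  for K :: "complex set"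
    and sV :: "complex \<Rightarrow> 'v::ab_group_add \<Rightarrow> 'v"
    and sW :: "complex \<Rightarrow> 'w::ab_group_add \<Rightarrow> 'w"
    and pr :: "'v \<Rightarrow> 'w \<Rightarrow> complex"
    and r :: nat and eV :: "nat \<Rightarrow> 'v" and eW :: "nat \<Rightarrow> 'w" +
  fixes d e :: nat
  assumes d_pos: "d \<ge> 1" and e_pos: "e \<ge> 1" and de_gt_1: "d * e > 1"
    and zeta_K: "zeta (d * e) \<in> K"
begin

abbreviation "G \<equiv> monomial_group d e"

definition normal_form :: "('v, 'w) root set \<Rightarrow> bool" where
  "normal_form \<S> \<longleftrightarrow> (\<exists>A B\<^sub>0 B\<^sub>1. ideal_family d e A B\<^sub>0 B\<^sub>1 \<and> normalized_family d e A B\<^sub>0 B\<^sub>1 \<and>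
     \<S> = family_system d e A B\<^sub>0 B\<^sub>1)"

lemma de_pos: "d * e > 0" using de_gt_1 by linarith

lemma root_of_unity_K:
  assumes "x ^ (d * e) = 1" shows "x \<in> K"
  using root_of_unity_zeta_power[OF de_pos assms] zeta_K K_power by metis

lemmas unity_O = root_of_unity_O[OF root_of_unity_K de_pos]
lemmas unity_inverse_O = root_of_unity_inverse_O[OF root_of_unity_K de_pos]
lemmas unity_nonzero = root_of_unity_nonzero[OF de_pos]
lemmas unity_cnj = root_of_unity_cnj[OF de_pos]

lemma root_of_unity_d: "x ^ d = 1 \<Longrightarrow> x ^ (d * e) = (1 :: complex)"
  by (simp add: power_mult)

lemma zeta_d_K: "zeta d \<in> K"
proof -
  have "zeta (d * e) ^ e = zeta d" using e_pos by (intro zeta_mult_power) simp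
  then show ?thesis using K_power[OF zeta_K, of e] by simp
qed

text \<open>The linear map that sends \<open>eV i\<close> to \<open>c i\<close> times
  \<open>eV (\<pi> i)\<close>, written through coordinates. Only the entries at \<open>1..r\<close>
  are read, so one map has many coefficient functions.\<close>

definition mon :: "(nat \<Rightarrow> nat) \<Rightarrow> (nat \<Rightarrow> complex) \<Rightarrow> 'v \<Rightarrow> 'v" where
  "mon \<pi> c x = (\<Sum>i=1..r. sV (pr x (eW i) * c i) (eV (\<pi> i)))"

definition mon_data :: "(nat \<Rightarrow> nat) \<Rightarrow> (nat \<Rightarrow> complex) \<Rightarrow> bool" where
  "mon_data \<pi> c \<longleftrightarrow> \<pi> permutes {1..r} \<and> (\<forall>i\<in>{1..r}. c i ^ (d * e) = 1)"

lemma mon_data_perm: "mon_data \<pi> c \<Longrightarrow> i \<in> {1..r} \<Longrightarrow> \<pi> i \<in> {1..r}"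
  unfolding mon_data_def using permutes_in_image[of \<pi> "{1..r}" i] by blast

lemma mon_data_inj: "mon_data \<pi> c \<Longrightarrow> \<pi> i = \<pi> j \<longleftrightarrow> i = j"
  unfolding mon_data_def using permutes_inj[of \<pi> "{1..r}"] inj_eq[of \<pi> i j] by blast

lemma mon_data_K: "mon_data \<pi> c \<Longrightarrow> i \<in> {1..r} \<Longrightarrow> c i \<in> K"
  unfolding mon_data_def using root_of_unity_K by blast

lemma mon_data_nonzero: "mon_data \<pi> c \<Longrightarrow> i \<in> {1..r} \<Longrightarrow> c i \<noteq> 0"
  unfolding mon_data_def using unity_nonzero by blast

lemma mon_cong:
  "(\<And>i. i \<in> {1..r} \<Longrightarrow> \<pi> i = \<pi>' i) \<Longrightarrow> (\<And>i. i \<in> {1..r} \<Longrightarrow> c i = c' i) \<Longrightarrow> mon \<pi> c = mon \<pi>' c'"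
  unfolding mon_def by (intro ext sum.cong) auto

lemma pr_mon:
  assumes "mon_data \<pi> c" "j \<in> {1..r}"
  shows "pr (mon \<pi> c x) (eW (\<pi> j)) = pr x (eW j) * c j"
proof -
  have "pr (mon \<pi> c x) (eW (\<pi> j)) = (\<Sum>i=1..r. pr x (eW i) * c i * pr (eV (\<pi> i)) (eW (\<pi> j)))"
    using mon_data_K[OF assms(1)] by (simp add: mon_def pr_sum_left pr_scale_left pr_in K_mult)
  also have "\<dots> = (\<Sum>i=1..r. if i = j then pr x (eW i) * c i else 0)"
    using assms mon_data_perm[OF assms(1)] mon_data_inj[OF assms(1)]
    by (intro sum.cong) (auto simp: dual)
  also have "\<dots> = pr x (eW j) * c j" using assms(2) by simp
  finally show ?thesis .
qed

lemma permuted_index: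
  assumes "mon_data \<pi> c" "i \<in> {1..r}"
  obtains j where "j \<in> {1..r}" "i = \<pi> j"
proof -
  have "i \<in> \<pi> ` {1..r}" using assms permutes_image[of \<pi> "{1..r}"] unfolding mon_data_def by blast
  then show thesis using that by blast
qed

lemma vector_eqI_perm:
  assumes "mon_data \<pi> c" "\<And>j. j \<in> {1..r} \<Longrightarrow> pr v (eW (\<pi> j)) = pr v' (eW (\<pi> j))"
  shows "v = v'"
  by (rule vector_eqI) (metis assms(2) permuted_index[OF assms(1)])

lemma covector_eqI_perm:
  assumes "mon_data \<pi> c" "\<And>j. j \<in> {1..r} \<Longrightarrow> pr (eV (\<pi> j)) w = pr (eV (\<pi> j)) w'"
  shows "w = w'"
  by (rule covector_eqI) (metis assms(2) permuted_index[OF assms(1)])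

lemma mon_basis:
  assumes "mon_data \<pi> c" "j \<in> {1..r}"
  shows "mon \<pi> c (eV j) = sV (c j) (eV (\<pi> j))"
  using assms mon_data_perm[OF assms(1)] mon_data_inj[OF assms(1)] mon_data_K[OF assms(1)]
  by (intro vector_eqI_perm[OF assms(1)]) (auto simp: pr_mon dual pr_scale_left)

lemma mon_data_comp:
  assumes "mon_data \<pi> c" "mon_data \<pi>' c'"
  shows "mon_data (\<pi> \<circ> \<pi>') (\<lambda>i. c' i * c (\<pi>' i))"
  using assms mon_data_perm[OF assms(2)] unfolding mon_data_def
  by (auto simp: power_mult_distrib intro: permutes_compose)

lemma mon_comp:
  assumes "mon_data \<pi> c" "mon_data \<pi>' c'"
  shows "mon \<pi> c \<circ> mon \<pi>' c' = mon (\<pi> \<circ> \<pi>') (\<lambda>i. c' i * c (\<pi>' i))"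
proof
  fix x
  show "(mon \<pi> c \<circ> mon \<pi>' c') x = mon (\<pi> \<circ> \<pi>') (\<lambda>i. c' i * c (\<pi>' i)) x"
  proof (rule vector_eqI_perm[OF mon_data_comp[OF assms]])
    fix j assume j: "j \<in> {1..r}"
    have "pr ((mon \<pi> c \<circ> mon \<pi>' c') x) (eW ((\<pi> \<circ> \<pi>') j)) = pr x (eW j) * c' j * c (\<pi>' j)"
      using pr_mon[OF assms(1) mon_data_perm[OF assms(2) j]] pr_mon[OF assms(2) j] by simp
    then show "pr ((mon \<pi> c \<circ> mon \<pi>' c') x) (eW ((\<pi> \<circ> \<pi>') j))
        = pr (mon (\<pi> \<circ> \<pi>') (\<lambda>i. c' i * c (\<pi>' i)) x) (eW ((\<pi> \<circ> \<pi>') j))"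
      using pr_mon[OF mon_data_comp[OF assms] j, of x] by simp
  qed
qed

lemma mon_data_id: "mon_data id (\<lambda>_. 1)"
  by (simp add: mon_data_def permutes_id)

lemma mon_id: "mon id (\<lambda>_. 1) = id"
proof
  fix x show "mon id (\<lambda>_. 1) x = id x"
    by (rule vector_eqI) (use pr_mon[OF mon_data_id] in simp)
qed

lemma mon_data_inverse:
  assumes "mon_data \<pi> c"
  shows "mon_data (inv_into UNIV \<pi>) (\<lambda>i. inverse (c (inv_into UNIV \<pi> i)))"
proof -
  have inv: "inv_into UNIV \<pi> permutes {1..r}"
    using assms unfolding mon_data_def by (blast intro: permutes_inv)
  have "inv_into UNIV \<pi> i \<in> {1..r}" if "i \<in> {1..r}" for i
    using that permutes_in_image[OF inv, of i] by blast
  then show ?thesis using inv assms by (auto simp: mon_data_def power_inverse)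
qed

lemma mon_GL:
  assumes m: "mon_data \<pi> c"
  shows "mon \<pi> c \<in> carrier (GL K sV)"
proof -
  let ?\<pi>' = "inv_into UNIV \<pi>"
  let ?c' = "\<lambda>i. inverse (c (?\<pi>' i))"
  have p: "\<pi> permutes {1..r}" using m by (simp add: mon_data_def)
  note m' = mon_data_inverse[OF m]
  have eq: "\<pi> \<circ> ?\<pi>' = id" "?\<pi>' \<circ> \<pi> = id" "\<And>i. ?\<pi>' (\<pi> i) = i"
    using permutes_inv_o[OF p] permutes_inverses[OF p] by auto
  have "mon \<pi> c \<circ> mon ?\<pi>' ?c' = mon id (\<lambda>_. 1)"
    unfolding mon_comp[OF m m'] eq(1)
    using mon_data_nonzero[OF m] mon_data_perm[OF m'] by (intro mon_cong) auto
  moreover have "mon ?\<pi>' ?c' \<circ> mon \<pi> c = mon id (\<lambda>_. 1)"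
    unfolding mon_comp[OF m' m] eq(2,3)
    using mon_data_nonzero[OF m] by (intro mon_cong) auto
  ultimately have "bij (mon \<pi> c)" unfolding mon_id by (metis o_bij)
  moreover have "mon \<pi> c (x + y) = mon \<pi> c x + mon \<pi> c y" for x y
    by (rule vector_eqI_perm[OF m]) (simp add: pr_mon[OF m] pr_add_left distrib_right)
  moreover have "mon \<pi> c (sV a x) = sV a (mon \<pi> c x)" if "a \<in> K" for a x
    by (rule vector_eqI_perm[OF m]) (simp add: pr_mon[OF m] pr_scale_left that mult.assoc)
  ultimately show ?thesis by (simp add: VS.GL_carrier)
qed

lemma monomial_group_subset_GL: "G \<subseteq> carrier (GL K sV)"
  by (auto simp: monomial_group_def)

lemma mon_in_group:
  assumes "mon_data \<pi> c" "(\<Prod>i=1..r. c i) ^ d = 1"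
  shows "mon \<pi> c \<in> G"
  unfolding monomial_group_def
  using mon_GL[OF assms(1)] mon_basis[OF assms(1)] assms mon_data_K[OF assms(1)]
  by (auto simp: mon_data_def intro!: exI[of _ \<pi>] exI[of _ c])

lemma monomial_group_cases:
  assumes "g \<in> G"
  obtains \<pi> c where "mon_data \<pi> c" "(\<Prod>i=1..r. c i) ^ d = 1" "g = mon \<pi> c"
proof -
  obtain \<pi> c where g: "g \<in> carrier (GL K sV)" and \<pi>: "\<pi> permutes {1..r}"
    and c: "\<And>i. i \<in> {1..r} \<Longrightarrow> c i \<in> K \<and> c i ^ (d * e) = 1" "(\<Prod>i=1..r. c i) ^ d = 1"
    and gb: "\<And>i. i \<in> {1..r} \<Longrightarrow> g (eV i) = sV (c i) (eV (\<pi> i))"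
    using assms unfolding monomial_group_def mem_Collect_eq by blast
  have "g x = mon \<pi> c x" for x
  proof -
    have "g x = g (\<Sum>i=1..r. sV (pr x (eW i)) (eV i))" by (simp only: expand_V[of x, symmetric])
    also have "\<dots> = (\<Sum>i=1..r. sV (pr x (eW i)) (sV (c i) (eV (\<pi> i))))"
      using g by (simp add: VS.GL_sum VS.GL_scale pr_in gb)
    also have "\<dots> = mon \<pi> c x"
      unfolding mon_def using c(1) by (intro sum.cong) (auto simp: V.scale_scale pr_in)
    finally show ?thesis .
  qed
  then show thesis using that[of \<pi> c] \<pi> c by (auto simp: mon_data_def)
qed

lemma mon_eqD:
  assumes "mon_data \<pi> c" "mon_data \<pi>' c'" "mon \<pi> c = mon \<pi>' c'" "i \<in> {1..r}"
  shows "\<pi> i = \<pi>' i" "c i = c' i"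
proof -
  have "sV (c i) (eV (\<pi> i)) = sV (c' i) (eV (\<pi>' i))"
    using assms mon_basis by metis
  then have "pr (sV (c i) (eV (\<pi> i))) (eW (\<pi> i)) = pr (sV (c' i) (eV (\<pi>' i))) (eW (\<pi> i))"
    by simp
  then have "c i = (if \<pi>' i = \<pi> i then c' i else 0)"
    using mon_data_perm[OF assms(1,4)] mon_data_perm[OF assms(2,4)]
      mon_data_K[OF assms(1,4)] mon_data_K[OF assms(2,4)]
    by (simp add: pr_scale_left dual)
  then show "\<pi> i = \<pi>' i" "c i = c' i"
    using mon_data_nonzero[OF assms(1,4)] by (auto split: if_splits)
qed

text \<open>The entries of a contragredient are the inverse conjugates; for roots of unity these are
  the entries themselves, so vectors and covectors transform alike.\<close>

lemma contragredient_mon: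
  assumes m: "mon_data \<pi> c" and j: "j \<in> {1..r}"
  shows "contragredient (mon \<pi> c) (eW j) = sW (c j) (eW (\<pi> j))"
proof (rule covector_eqI_perm[OF m])
  fix i assume i: "i \<in> {1..r}"
  note K = mon_data_K[OF m i] and nz = mon_data_nonzero[OF m i]
  have "eV (\<pi> i) = sV (inverse (c i)) (mon \<pi> c (eV i))"
    using K nz by (simp add: mon_basis[OF m i] VS.scale_inverse)
  then have "pr (eV (\<pi> i)) (contragredient (mon \<pi> c) (eW j)) = inverse (c i) * pr (eV i) (eW j)"
    using K by (simp add: pr_scale_left K_inverse pr_contragredient[OF mon_GL[OF m]])
  also have "\<dots> = cnj (c j) * pr (eV (\<pi> i)) (eW (\<pi> j))"
    using i j m mon_data_perm[OF m] mon_data_inj[OF m] unity_cnj[of "c j"]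
    by (auto simp: dual mon_data_def)
  finally show "pr (eV (\<pi> i)) (contragredient (mon \<pi> c) (eW j)) = pr (eV (\<pi> i)) (sW (c j) (eW (\<pi> j)))"
    using mon_data_K[OF m j] by (simp add: pr_scale_right)
qed

definition swap_vec :: "nat \<Rightarrow> nat \<Rightarrow> complex \<Rightarrow> 'v" where
  "swap_vec m n x = eV m - sV x (eV n)"

definition swap_covec :: "nat \<Rightarrow> nat \<Rightarrow> complex \<Rightarrow> 'w" where
  "swap_covec m n x = eW m - sW x (eW n)"

definition swap_root :: "complex set \<Rightarrow> nat \<Rightarrow> nat \<Rightarrow> complex \<Rightarrow> ('v, 'w) root" where
  "swap_root A m n x = root_at A (swap_vec m n x) (swap_covec m n x) (- 1)"

text \<open>The factor \<open>1 - inverse (zeta d)\<close> is the conjugate of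
  \<open>1 - zeta d\<close>, so pairing with \<open>eV m\<close> gives
  \<open>1 - zeta d\<close>.\<close>

definition axis_root :: "complex set \<Rightarrow> nat \<Rightarrow> ('v, 'w) root" where
  "axis_root A m = root_at A (eV m) (sW (1 - inverse (zeta d)) (eW m)) (zeta d)"

lemma pr_swap:
  assumes "m \<in> {1..r}" "n \<in> {1..r}" "m \<noteq> n" "x \<in> K" "y \<in> K"
  shows "pr (swap_vec m n x) (swap_covec m n y) = 1 + x * cnj y"
  using assms by (simp add: swap_vec_def swap_covec_def pr_diff_left pr_diff_right pr_scale_left
      pr_scale_right dual)

lemma root_pair_swap:
  assumes "m \<in> {1..r}" "n \<in> {1..r}" "m \<noteq> n" "x ^ (d * e) = 1"
  shows "root_pair (swap_vec m n x) (swap_covec m n x) (- 1)"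
  using pr_swap[OF assms(1-3), of x x] assms(4) root_of_unity_K root_of_unity_mult_cnj[OF de_pos assms(4)]
  by (auto simp: root_pair_def K_uminus K_1 intro!: exI[of _ "2::nat"])

lemma root_pair_axis:
  assumes "m \<in> {1..r}" "d > 1"
  shows "root_pair (eV m) (sW (1 - inverse (zeta d)) (eW m)) (zeta d)"
proof -
  have "cnj (zeta d) = inverse (zeta d)"
    using assms(2) by (intro root_of_unity_cnj[of d]) (auto simp: zeta_power_self)
  then have "cnj (1 - inverse (zeta d)) = 1 - zeta d" by simp
  moreover have "1 - inverse (zeta d) \<in> K" using zeta_d_K by (intro K_diff K_1 K_inverse)
  ultimately show ?thesis
    using assms zeta_d_K zeta_neq_1[of d] zeta_power_self[of d]
    by (auto simp: root_pair_def pr_scale_right dual intro!: exI[of _ d])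
qed

lemma perm_root_conv: "perm_root (d * e) j m n = swap_root \<O> m n (zeta (d * e) ^ j)"
  by (simp add: perm_root_def swap_root_def root_at_def swap_vec_def swap_covec_def
      ideal_inverse_O cnj_O)

lemma diag_root_conv: "diag_root d m = axis_root \<O> m"
  by (simp add: diag_root_def axis_root_def root_at_def ideal_inverse_O cnj_O)

lemma ideal_act_perm_root:
  "fractional B \<Longrightarrow> ideal_act B (perm_root (d * e) j m n) = swap_root B m n (zeta (d * e) ^ j)"
  by (simp add: perm_root_conv swap_root_def ideal_act_root_at fractional_O ideal_mult_O_right
      fractional_submodule)

lemma ideal_act_diag_root:
  "fractional B \<Longrightarrow> ideal_act B (diag_root d m) = axis_root B m"
  by (simp add: diag_root_conv axis_root_def ideal_act_root_at fractional_O ideal_mult_O_right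
      fractional_submodule)

text \<open>Exchanging the indices and inverting \<open>x\<close> multiplies both vectors by the
  unit \<open>- inverse x\<close>. So a root can be listed with its indices in either order.\<close>

lemma swap_root_flip:
  assumes "fractional A" "x ^ (d * e) = 1"
  shows "swap_root A n m (inverse x) = swap_root A m n x"
proof -
  have x: "x \<in> K" "x \<in> \<O>" "inverse x \<in> \<O>" "x \<noteq> 0"
    using assms(2) root_of_unity_K unity_O unity_inverse_O unity_nonzero by blast+
  then have ix: "inverse x \<in> K" "- inverse x \<in> K" by (auto intro: K_inverse K_uminus)
  have "swap_vec n m (inverse x) = sV (- inverse x) (swap_vec m n x)"
    "swap_covec n m (inverse x) = sW (- inverse x) (swap_covec m n x)"
    using x ix by (simp_all add: swap_vec_def swap_covec_def VS.scale_diff_right WS.scale_diff_right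
        V.scale_scale W.scale_scale VS.scale_minus_left WS.scale_minus_left V.scale_one W.scale_one K_1)
  then show ?thesis
    unfolding swap_root_def using x assms(1)
    by (simp add: root_at_unit O_uminus)
qed

text \<open>Taking out the unit \<open>c m\<close> leaves the parameter
  \<open>x * c n / c m\<close>; the analysis of the orbits rests on this formula.\<close>

lemma act_swap_root:
  assumes "mon_data \<pi> c" "fractional A" "m \<in> {1..r}" "n \<in> {1..r}" "x ^ (d * e) = 1"
  shows "act (mon \<pi> c) (swap_root A m n x) = swap_root A (\<pi> m) (\<pi> n) (x * c n / c m)"
proof -
  have cm: "c m ^ (d * e) = 1" "c n ^ (d * e) = 1" using assms by (auto simp: mon_data_def)
  have x: "x \<in> K" "c m \<in> K" "c n \<in> K" "c m \<noteq> 0" "x * c n / c m \<in> K"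
    using assms(5) cm root_of_unity_K unity_nonzero by (auto intro: K_divide K_mult)
  have "mon \<pi> c (swap_vec m n x) = sV (c m) (swap_vec (\<pi> m) (\<pi> n) (x * c n / c m))"
    using mon_GL[OF assms(1)] x assms
    by (simp add: swap_vec_def VS.GL_diff VS.GL_scale mon_basis VS.scale_diff_right V.scale_scale)
  moreover have "contragredient (mon \<pi> c) (swap_covec m n x)
      = sW (c m) (swap_covec (\<pi> m) (\<pi> n) (x * c n / c m))"
    using contragredient_GL[OF mon_GL[OF assms(1)]] x assms
    by (simp add: swap_covec_def WS.GL_diff WS.GL_scale contragredient_mon WS.scale_diff_right W.scale_scale)
  ultimately show ?thesis
    unfolding swap_root_def using cm(1) assms(2) unity_O unity_inverse_O x(4)
    by (simp add: act_root_at mon_GL[OF assms(1)] root_at_unit)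
qed

lemma act_axis_root:
  assumes "mon_data \<pi> c" "fractional A" "m \<in> {1..r}"
  shows "act (mon \<pi> c) (axis_root A m) = axis_root A (\<pi> m)"
proof -
  have cm: "c m ^ (d * e) = 1" using assms by (auto simp: mon_data_def)
  then have x: "c m \<in> K" "c m \<noteq> 0" using root_of_unity_K unity_nonzero by auto
  define y where "y = 1 - inverse (zeta d)"
  have y: "y \<in> K" using zeta_d_K unfolding y_def by (intro K_diff K_1 K_inverse)
  have "contragredient (mon \<pi> c) (sW y (eW m)) = sW (c m) (sW y (eW (\<pi> m)))"
    using contragredient_GL[OF mon_GL[OF assms(1)]] x y assms
    by (simp add: WS.GL_scale contragredient_mon W.scale_scale mult.commute)
  then show ?thesis
    unfolding axis_root_def y_def[symmetric] using cm assms unity_O unity_inverse_O x(2)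
    by (simp add: act_root_at mon_GL[OF assms(1)] root_at_unit mon_basis)
qed

end

section \<open>Reflections in the monomial group and their roots\<close>

context monomial_setting
begin

text \<open>With the transposition of \<open>m\<close> and \<open>n\<close> these are the entries of
  a reflection; with the identity permutation they give a diagonal matrix of product 1, which will
  move roots within an orbit.\<close>

definition swap_coeff :: "nat \<Rightarrow> nat \<Rightarrow> complex \<Rightarrow> nat \<Rightarrow> complex" where
  "swap_coeff m n x i = (if i = m then x else if i = n then inverse x else 1)"

definition axis_coeff :: "nat \<Rightarrow> complex \<Rightarrow> nat \<Rightarrow> complex" where
  "axis_coeff m t i = (if i = m then t else 1)"

lemma mon_data_swap:
  "m \<in> {1..r} \<Longrightarrow> n \<in> {1..r} \<Longrightarrow> x ^ (d * e) = 1 \<Longrightarrow> mon_data (transpose m n) (swap_coeff m n x)"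
  by (auto simp: mon_data_def swap_coeff_def power_inverse intro!: permutes_swap_id)

lemma mon_data_axis:
  "x ^ (d * e) = 1 \<Longrightarrow> mon_data id (axis_coeff m x)"
  by (auto simp: mon_data_def axis_coeff_def permutes_id)

lemma prod_swap_coeff:
  assumes "m \<in> {1..r}" "n \<in> {1..r}" "m \<noteq> n" "x \<noteq> 0"
  shows "(\<Prod>i=1..r. swap_coeff m n x i) = 1"
proof -
  have "(\<Prod>i=1..r. swap_coeff m n x i)
      = (\<Prod>i=1..r. (if i = m then x else 1) * (if i = n then inverse x else 1))"
    using assms(3) by (intro prod.cong) (auto simp: swap_coeff_def)
  also have "\<dots> = 1" using assms by (simp add: prod.distrib)
  finally show ?thesis .
qed

lemma prod_axis_coeff: "m \<in> {1..r} \<Longrightarrow> (\<Prod>i=1..r. axis_coeff m x i) = x"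
  by (simp add: axis_coeff_def)

lemma pr_refl: "pr (refl v w x) y = pr x y - pr x w * pr v y"
  by (simp add: refl_def pr_diff_left pr_scale_left pr_in)

lemma reflection_swap_root:
  assumes "fractional A" "m \<in> {1..r}" "n \<in> {1..r}" "m \<noteq> n" "x ^ (d * e) = 1"
  shows "reflection (swap_root A m n x) = mon (transpose m n) (swap_coeff m n x)"
proof -
  note md = mon_data_swap[OF assms(2,3,5)]
  have x: "x \<in> K" "cnj x = inverse x" "x \<noteq> 0"
    using assms(5) root_of_unity_K unity_cnj unity_nonzero by auto
  have "refl (swap_vec m n x) (swap_covec m n x) y = mon (transpose m n) (swap_coeff m n x) y" for y
  proof (rule vector_eqI_perm[OF md])
    fix j assume j: "j \<in> {1..r}"
    have "pr y (swap_covec m n x) = pr y (eW m) - inverse x * pr y (eW n)"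
      using x by (simp add: swap_covec_def pr_diff_right pr_scale_right)
    moreover have "pr (swap_vec m n x) (eW k)
        = (if k = m then 1 else if k = n then - x else 0)" if "k \<in> {1..r}" for k
      using that x assms by (auto simp: swap_vec_def pr_diff_left pr_scale_left dual)
    moreover have "transpose m n j \<in> {1..r}" using j assms by (auto simp: transpose_def)
    ultimately show "pr (refl (swap_vec m n x) (swap_covec m n x) y) (eW (transpose m n j))
        = pr (mon (transpose m n) (swap_coeff m n x) y) (eW (transpose m n j))"
      unfolding pr_mon[OF md j] pr_refl using x(3) assms(4)
      by (auto simp: transpose_def swap_coeff_def field_simps)
  qed
  then show ?thesis
    using reflection_root_at[OF assms(1) root_pair_swap[OF assms(2-5)]]
    unfolding swap_root_def by auto
qed

lemma reflection_axis_root: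
  assumes "fractional A" "m \<in> {1..r}" "d > 1"
  shows "reflection (axis_root A m) = mon id (axis_coeff m (zeta d))"
proof -
  have md: "mon_data id (axis_coeff m (zeta d))"
    using assms(3) by (intro mon_data_axis root_of_unity_d zeta_power_self) simp
  have y: "1 - inverse (zeta d) \<in> K" using zeta_d_K by (intro K_diff K_1 K_inverse)
  have c: "cnj (1 - inverse (zeta d)) = 1 - zeta d"
    using root_pair_axis[OF assms(2,3)] y assms(2) by (simp add: root_pair_def pr_scale_right dual)
  have "refl (eV m) (sW (1 - inverse (zeta d)) (eW m)) x = mon id (axis_coeff m (zeta d)) x" for x
  proof (rule vector_eqI)
    fix j assume j: "j \<in> {1..r}"
    then show "pr (refl (eV m) (sW (1 - inverse (zeta d)) (eW m)) x) (eW j)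
        = pr (mon id (axis_coeff m (zeta d)) x) (eW j)"
      using pr_mon[OF md j, of x] assms(2) y c
      by (simp add: pr_refl pr_scale_right dual axis_coeff_def algebra_simps)
  qed
  then show ?thesis
    using reflection_root_at[OF assms(1) root_pair_axis[OF assms(2,3)]]
    unfolding axis_root_def by auto
qed

text \<open>Determinants are needed for diagonal reflections only; for transpositions the value
  \<open>z = - 1\<close> will come out of the pairing.\<close>

lemma det_of_mon_diag:
  assumes "mon_data \<pi> c" "\<And>i. i \<in> {1..r} \<Longrightarrow> \<pi> i = i"
  shows "det_of (mon \<pi> c) = (\<Prod>i=1..r. c i)"
proof -
  define M where "M = mat r r (\<lambda>(i, j). pr (mon \<pi> c (eV (Suc j))) (eW (Suc i)))"
  have M: "M $$ (i, j) = (if i = j then c (Suc j) else 0)" if "i < r" "j < r" for i j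
    using that assms mon_data_K[OF assms(1), of "Suc j"]
    by (simp add: M_def mon_basis pr_scale_left dual)
  have "M \<in> carrier_mat r r" by (simp add: M_def)
  moreover have "upper_triangular M" using M by (auto simp: upper_triangular_def M_def)
  ultimately have "det M = prod_list (diag_mat M)" by (intro det_upper_triangular)
  also have "\<dots> = (\<Prod>i = 0..<r. c (Suc i))"
    using M by (simp add: prod_list_diag_prod M_def)
  also have "\<dots> = (\<Prod>i=1..r. c i)"
    by (simp add: prod.atLeast1_atMost_eq atLeast0LessThan)
  finally show ?thesis by (simp add: det_of_def M_def)
qed

text \<open>An element that fixes all \<open>eV i\<close> with \<open>i \<noteq> m\<close> is
  diagonal with one free entry \<open>t\<close>, and the product condition of \<open>G\<close>
  becomes \<open>t ^ d = 1\<close>. So a distinguished diagonal reflection has determinant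
  \<open>zeta d\<close>.\<close>

lemma card_pointwise_stabilizer:
  assumes m: "m \<in> {1..r}" and md: "mon_data \<pi> c"
    and \<pi>: "\<And>i. i \<in> {1..r} \<Longrightarrow> \<pi> i = i"
    and c: "\<And>i. i \<in> {1..r} \<Longrightarrow> i \<noteq> m \<Longrightarrow> c i = 1" "c m \<noteq> 1"
  shows "card {g \<in> G. \<forall>x. mon \<pi> c x = x \<longrightarrow> g x = x} = d"
proof -
  let ?X = "{g \<in> G. \<forall>x. mon \<pi> c x = x \<longrightarrow> g x = x}"
  have "bij_betw (\<lambda>t. mon id (axis_coeff m t)) {t. t ^ d = 1} ?X"
    unfolding bij_betw_def
  proof (intro conjI subset_antisym)
    show "inj_on (\<lambda>t. mon id (axis_coeff m t)) {t. t ^ d = 1}"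
    proof (rule inj_onI)
      fix s t assume "s \<in> {t. t ^ d = 1}" "t \<in> {t. t ^ d = 1}"
        "mon id (axis_coeff m s) = mon id (axis_coeff m t)"
      then have "axis_coeff m s m = axis_coeff m t m"
        using m by (intro mon_eqD(2)[OF mon_data_axis mon_data_axis]) (auto simp: root_of_unity_d)
      then show "s = t" by (simp add: axis_coeff_def)
    qed
    show "(\<lambda>t. mon id (axis_coeff m t)) ` {t. t ^ d = 1} \<subseteq> ?X"
    proof
      fix g assume "g \<in> (\<lambda>t. mon id (axis_coeff m t)) ` {t. t ^ d = 1}"
      then obtain t where t: "t ^ d = 1" "g = mon id (axis_coeff m t)" by auto
      note mdt = mon_data_axis[OF root_of_unity_d[OF t(1)], of m]
      have "g \<in> G"
        unfolding t(2) using t(1) m prod_axis_coeff by (intro mon_in_group[OF mdt]) auto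
      moreover have "g x = x" if x: "mon \<pi> c x = x" for x
      proof (rule vector_eqI)
        fix j assume j: "j \<in> {1..r}"
        have "pr x (eW m) * c m = pr x (eW m)"
          using pr_mon[OF md m, of x] x \<pi>[OF m] by simp
        then have "pr x (eW m) = 0" using c(2) by simp
        then show "pr (g x) (eW j) = pr x (eW j)"
          using pr_mon[OF mdt j, of x] by (auto simp: t(2) axis_coeff_def)
      qed
      ultimately show "g \<in> ?X" by blast
    qed
    show "?X \<subseteq> (\<lambda>t. mon id (axis_coeff m t)) ` {t. t ^ d = 1}"
    proof
      fix g assume g: "g \<in> ?X"
      obtain \<sigma> b where gb: "mon_data \<sigma> b" "(\<Prod>i=1..r. b i) ^ d = 1" "g = mon \<sigma> b"
        using monomial_group_cases g by blast
      have fix_i: "\<sigma> i = i \<and> b i = 1" if i: "i \<in> {1..r}" "i \<noteq> m" for i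
      proof -
        have "mon \<pi> c (eV i) = eV i"
          using mon_basis[OF md i(1)] \<pi>[OF i(1)] c(1)[OF i] by (simp add: V.scale_one)
        then have "mon \<sigma> b (eV i) = eV i" using g gb(3) by blast
        then have eq: "sV (b i) (eV (\<sigma> i)) = eV i" using mon_basis[OF gb(1) i(1)] by simp
        have "pr (sV (b i) (eV (\<sigma> i))) (eW i) = 1" unfolding eq using i by (simp add: dual)
        then have "b i * (if \<sigma> i = i then 1 else 0) = 1"
          using mon_data_K[OF gb(1) i(1)] mon_data_perm[OF gb(1) i(1)] i(1) by (simp add: pr_scale_left dual)
        then show ?thesis by (auto split: if_splits)
      qed
      have "\<sigma> m = m"
      proof (rule ccontr)
        assume ne: "\<sigma> m \<noteq> m"
        then have "\<sigma> (\<sigma> m) = \<sigma> m" using fix_i mon_data_perm[OF gb(1) m] by blast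
        then show False using ne mon_data_inj[OF gb(1)] by blast
      qed
      then have eq: "g = mon id (axis_coeff m (b m))"
        unfolding gb(3) using fix_i by (intro mon_cong) (auto simp: axis_coeff_def)
      have "(\<Prod>i=1..r. b i) = (\<Prod>i=1..r. axis_coeff m (b m) i)"
        using fix_i by (intro prod.cong) (auto simp: axis_coeff_def)
      then have "b m ^ d = 1" using gb(2) prod_axis_coeff[OF m] by simp
      then show "g \<in> (\<lambda>t. mon id (axis_coeff m t)) ` {t. t ^ d = 1}" using eq by blast
    qed
  qed
  then have "card {t :: complex. t ^ d = 1} = card ?X" by (rule bij_betw_same_card)
  moreover have "card {t :: complex. t ^ d = 1} = d" using d_pos by (intro card_roots_unity_eq) simp
  ultimately show ?thesis by simp
qed

text \<open>The reflection is monomial, and its difference from the identity has rank one. If the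
  permutation moves an index, rank one leaves a transposition with mutually inverse entries.
  Otherwise exactly one diagonal entry differs from 1, and it must be \<open>zeta d\<close>.\<close>

lemma distinguished_root_cases:
  assumes root: "is_root \<rho>" and dist: "distinguished_reflection G (reflection \<rho>)"
  obtains (axis) A m where "fractional A" "m \<in> {1..r}" "d > 1" "\<rho> = axis_root A m"
  | (swap) A m n x where "fractional A" "m \<in> {1..r}" "n \<in> {1..r}" "m \<noteq> n" "x ^ (d * e) = 1"
      "\<rho> = swap_root A m n x"
proof -
  obtain A v w z where A: "fractional A" and vw: "root_pair v w z" and \<rho>: "\<rho> = root_at A v w z"
    using root by (rule is_root_cases)
  \<comment> \<open>The vectors may be replaced by others on the same lines, at the cost of another
    ideal.\<close>
  have form: "\<exists>B. fractional B \<and> root_pair v' w' z \<and> \<rho> = root_at B v' w' z"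
    if v': "v' \<in> multiples K sV v" "w' \<in> multiples K sW w" "pr v' w' = 1 - z" for v' w'
  proof -
    have "is_root (multiples A sV v, multiples (cnj ` ideal_inverse K A) sW w, z)"
      using root unfolding \<rho> root_at_def .
    then show ?thesis
      unfolding \<rho> root_at_def[of A]
      using root_form[of "multiples A sV v" "multiples (cnj ` ideal_inverse K A) sW w" z v' w'] v'
        multiples_fractional_gen(1)[OF A, of v] multiples_fractional_gen(2)[OF A, of w] by metis
  qed
  have prvw: "pr v w = 1 - z" using vw by (simp add: root_pair_def)
  have nz: "v \<noteq> 0" "w \<noteq> 0" using root_pair_nonzero[OF vw] by auto
  have refl: "reflection \<rho> = refl v w" unfolding \<rho> by (rule reflection_root_at[OF A vw])
  then have "refl v w \<in> G" using dist by (simp add: distinguished_reflection_def)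
  then obtain \<pi> c where md: "mon_data \<pi> c" and s: "refl v w = mon \<pi> c"
    by (rule monomial_group_cases)
  \<comment> \<open>Coordinate \<open>k\<close> of the difference between \<open>eV i\<close> and
    its image, expressed by the reflection formula on the left and by the monomial form on the
    right.\<close>
  have key: "pr (eV i) w * pr v (eW k) = (if k = i then 1 else 0) - c i * (if k = \<pi> i then 1 else 0)"
    if i: "i \<in> {1..r}" and k: "k \<in> {1..r}" for i k
  proof -
    have "pr (refl v w (eV i)) (eW k) = pr (sV (c i) (eV (\<pi> i))) (eW k)"
      unfolding s mon_basis[OF md i] ..
    then have "pr (eV i) (eW k) - pr (eV i) w * pr v (eW k) = c i * pr (eV (\<pi> i)) (eW k)"
      using mon_data_K[OF md i] by (simp add: pr_refl pr_scale_left)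
    then have "pr (eV i) w * pr v (eW k) = pr (eV i) (eW k) - c i * pr (eV (\<pi> i)) (eW k)"
      by (simp add: algebra_simps)
    then show ?thesis
      using dual[OF i k] dual[OF mon_data_perm[OF md i] k] by (simp add: eq_commute)
  qed
  show thesis
  proof (cases "\<exists>m\<in>{1..r}. \<pi> m \<noteq> m")
    case True
    then obtain m where m: "m \<in> {1..r}" "\<pi> m \<noteq> m" by blast
    define n where "n = \<pi> m"
    define x where "x = c m"
    define \<alpha> where "\<alpha> = pr (eV m) w"
    have n: "n \<in> {1..r}" "n \<noteq> m" "\<pi> m = n"
      using m mon_data_perm[OF md m(1)] unfolding n_def by auto
    have x: "x ^ (d * e) = 1" using md m by (simp add: x_def mon_data_def)
    then have xK: "x \<in> K" "cnj x = inverse x" "x \<noteq> 0"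
      using root_of_unity_K unity_cnj unity_nonzero by auto
    have vk: "\<alpha> * pr v (eW k) = (if k = m then 1 else if k = n then - x else 0)" if k: "k \<in> {1..r}" for k
    proof -
      have "\<alpha> * pr v (eW k) = (if k = m then 1 else 0) - x * (if k = n then 1 else 0)"
        using key[OF m(1) k] unfolding \<alpha>_def x_def n_def .
      then show ?thesis using n(2) by auto
    qed
    have \<alpha>v: "\<alpha> * pr v (eW m) = 1" using vk[OF m(1)] by simp
    then have \<alpha>: "\<alpha> \<noteq> 0" by auto
    have \<alpha>K: "\<alpha> \<in> K" by (simp add: \<alpha>_def pr_in)
    have v': "swap_vec m n x = sV \<alpha> v"
    proof (rule vector_eqI)
      fix k assume k: "k \<in> {1..r}"
      show "pr (swap_vec m n x) (eW k) = pr (sV \<alpha> v) (eW k)"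
        using vk[OF k] k m(1) n(1,2) xK \<alpha>K
        by (auto simp: swap_vec_def pr_diff_left pr_scale_left dual)
    qed
    \<comment> \<open>\<open>eV n\<close> and its image differ by a multiple of \<open>v\<close>,
      which is supported on \<open>m\<close> and \<open>n\<close>; an entry \<open>c n\<close> at
      any third place would have to vanish.\<close>
    have \<pi>n: "\<pi> n = m"
    proof (rule ccontr)
      assume ne: "\<pi> n \<noteq> m"
      have ne': "\<pi> n \<noteq> n" using n mon_data_inj[OF md] by metis
      have pn: "\<pi> n \<in> {1..r}" by (rule mon_data_perm[OF md n(1)])
      have "\<alpha> * pr v (eW (\<pi> n)) = 0" using vk[OF pn] ne ne' by simp
      then have "pr v (eW (\<pi> n)) = 0" using \<alpha> by simp
      then have "c n = 0" using key[OF n(1) pn] ne' by simp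
      then show False using mon_data_nonzero[OF md n(1)] by simp
    qed
    have \<pi>i: "m = \<pi> i \<longleftrightarrow> i = n" for i using \<pi>n mon_data_inj[OF md] by metis
    have w0: "pr (eV i) w = \<alpha> * ((if i = m then 1 else 0) - c i * (if i = n then 1 else 0))"
      if i: "i \<in> {1..r}" for i
    proof -
      have "pr (eV i) w = \<alpha> * (pr (eV i) w * pr v (eW m))"
        using \<alpha>v by (metis mult.left_commute mult.right_neutral)
      also have "pr (eV i) w * pr v (eW m) = (if i = m then 1 else 0) - c i * (if i = n then 1 else 0)"
        using key[OF i m(1)] unfolding \<pi>i by (simp add: eq_commute[of m i])
      finally show ?thesis .
    qed
    \<comment> \<open>\<open>\<pi>\<close> moves \<open>n\<close>, so the diagonal entry of the rank
      one matrix at \<open>n\<close> is 1; its factors are known up to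
      \<open>\<alpha>\<close>.\<close>
    have "c n * x = 1"
    proof -
      have "pr (eV n) w = - (\<alpha> * c n)" using w0[OF n(1)] n(2) by simp
      moreover have "pr (eV n) w * (\<alpha> * pr v (eW n)) = \<alpha>"
        using key[OF n(1) n(1)] n \<pi>n by (simp add: mult.left_commute)
      ultimately have "\<alpha> * (c n * x) = \<alpha>" using vk[OF n(1)] n(2) by simp
      then show ?thesis using \<alpha> by simp
    qed
    then have "c n = inverse x" by (metis inverse_unique mult.commute)
    then have wm: "pr (eV i) w = \<alpha> * (if i = m then 1 else if i = n then - inverse x else 0)"
      if "i \<in> {1..r}" for i
      using w0[OF that] n(2) by auto
    have w': "swap_covec m n x = sW (cnj (inverse \<alpha>)) w"
    proof (rule covector_eqI)
      fix i assume i: "i \<in> {1..r}"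
      show "pr (eV i) (swap_covec m n x) = pr (eV i) (sW (cnj (inverse \<alpha>)) w)"
        using wm[OF i] i m n xK \<alpha> cnj_stable[OF K_inverse[OF \<alpha>K]]
        by (auto simp: swap_covec_def pr_diff_right pr_scale_right dual)
    qed
    have "pr (swap_vec m n x) (swap_covec m n x) = 1 - z"
      unfolding v' w' using \<alpha> \<alpha>K cnj_stable[OF K_inverse[OF \<alpha>K]]
      by (simp add: pr_scale_left pr_scale_right prvw)
    moreover have "pr (swap_vec m n x) (swap_covec m n x) = 1 - (- 1)"
      using root_pair_swap[OF m(1) n(1) _ x] n(2) by (auto simp: root_pair_def)
    ultimately have "1 - z = 1 - (- 1)" by metis
    then have zm1: "z = - 1" by (rule diff_left_imp_eq)
    have "swap_vec m n x \<in> multiples K sV v" "swap_covec m n x \<in> multiples K sW w"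
      unfolding v' w' by (intro VS.multiplesI \<alpha>K WS.multiplesI cnj_stable K_inverse)+
    then obtain B where "fractional B" "\<rho> = swap_root B m n x"
      using form \<open>pr (swap_vec m n x) (swap_covec m n x) = 1 - z\<close> zm1 by (auto simp: swap_root_def)
    then show thesis using swap m(1) n(1,2) x by metis
  next
    case False
    then have \<pi>: "\<pi> i = i" if "i \<in> {1..r}" for i using that by blast
    have key': "pr (eV i) w * pr v (eW k) = (if k = i then 1 - c i else 0)"
      if "i \<in> {1..r}" "k \<in> {1..r}" for i k
      using key[OF that] \<pi>[OF that(1)] by simp
    have "\<exists>m\<in>{1..r}. pr (eV m) w \<noteq> 0"
    proof (rule ccontr)
      assume "\<not> ?thesis"
      then have "w = 0" by (intro covector_eqI) (simp add: pr_zero_right)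
      then show False using nz(2) by simp
    qed
    then obtain m where m: "m \<in> {1..r}" "pr (eV m) w \<noteq> 0" by blast
    define \<alpha> where "\<alpha> = pr (eV m) w"
    have \<alpha>: "\<alpha> \<noteq> 0" "\<alpha> \<in> K" using m by (auto simp: \<alpha>_def pr_in)
    have vk: "pr v (eW k) = 0" if "k \<in> {1..r}" "k \<noteq> m" for k
      using key'[OF m(1) that(1)] that(2) m(2) by auto
    have vm: "\<alpha> * pr v (eW m) = 1 - c m" using key'[OF m(1) m(1)] by (simp add: \<alpha>_def)
    \<comment> \<open>Otherwise all coordinates of \<open>v\<close> would vanish.\<close>
    have cm: "c m \<noteq> 1"
    proof
      assume "c m = 1"
      then have "pr v (eW m) = 0" using vm \<alpha> by simp
      then have "v = 0" using vk by (intro vector_eqI) (metis pr_zero_left)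
      then show False using nz by simp
    qed
    have ci: "c i = 1" if "i \<in> {1..r}" "i \<noteq> m" for i
      using key'[OF that(1) that(1)] vk[OF that] by simp
    have wi: "pr (eV i) w = 0" if "i \<in> {1..r}" "i \<noteq> m" for i
    proof -
      have "pr v (eW m) \<noteq> 0" using vm cm by auto
      then show ?thesis using key'[OF that(1) m(1)] that(2) by simp
    qed
    have cK: "c m \<in> K" by (rule mon_data_K[OF md m(1)])
    define \<beta> where "\<beta> = (1 - c m) / \<alpha>"
    have \<beta>: "\<beta> \<noteq> 0" "\<beta> \<in> K" "pr v (eW m) = \<beta>"
      using \<alpha> cm cK vm by (auto simp: \<beta>_def field_simps intro!: K_divide K_diff K_1)
    have v: "v = sV \<beta> (eV m)"
    proof (rule vector_eqI)
      fix k assume k: "k \<in> {1..r}"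
      show "pr v (eW k) = pr (sV \<beta> (eV m)) (eW k)"
        using vk[OF k] k m(1) \<beta> by (cases "k = m") (auto simp: pr_scale_left dual)
    qed
    have "pr v w = \<beta> * \<alpha>" unfolding v using \<beta> by (simp add: pr_scale_left \<alpha>_def)
    then have zc: "z = c m" using prvw \<alpha> by (simp add: \<beta>_def)
    have "det_of (mon \<pi> c) = c m"
    proof -
      have "(\<Prod>i=1..r. c i) = (\<Prod>i=1..r. axis_coeff m (c m) i)"
        using ci by (intro prod.cong) (auto simp: axis_coeff_def)
      then show ?thesis using det_of_mon_diag[OF md \<pi>] prod_axis_coeff[OF m(1)] by simp
    qed
    moreover have "card {g \<in> G. \<forall>x. mon \<pi> c x = x \<longrightarrow> g x = x} = d"
      by (rule card_pointwise_stabilizer[OF m(1) md \<pi> ci cm])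
    ultimately have cz: "c m = zeta d"
      using dist unfolding distinguished_reflection_def refl s by simp
    have "d \<noteq> 1"
    proof
      assume "d = 1"
      then show False using cz cm by (simp add: zeta_def)
    qed
    then have d1: "d > 1" using d_pos by simp
    have "zeta d ^ d = 1" using d1 by (simp add: zeta_power_self)
    then have cz': "cnj (inverse (zeta d)) = zeta d"
      using root_of_unity_cnj[of d "zeta d"] d1 by simp
    define \<gamma> where "\<gamma> = cnj \<beta>"
    have "sW (1 - inverse (zeta d)) (eW m) = sW \<gamma> w"
    proof (rule covector_eqI)
      fix i assume i: "i \<in> {1..r}"
      have "pr (eV i) (sW (1 - inverse (zeta d)) (eW m)) = (1 - zeta d) * pr (eV i) (eW m)"
        using zeta_d_K cz' by (simp add: pr_scale_right K_diff K_1 K_inverse)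
      moreover have "pr (eV i) (sW \<gamma> w) = \<beta> * pr (eV i) w"
        using \<beta> by (simp add: \<gamma>_def pr_scale_right cnj_stable)
      moreover have "\<beta> * \<alpha> = 1 - zeta d" using \<alpha> cz by (simp add: \<beta>_def)
      ultimately show "pr (eV i) (sW (1 - inverse (zeta d)) (eW m)) = pr (eV i) (sW \<gamma> w)"
        using i m(1) wi[of i] by (cases "i = m") (auto simp: dual \<alpha>_def)
    qed
    then have "sW (1 - inverse (zeta d)) (eW m) \<in> multiples K sW w"
      using WS.multiplesI[of \<gamma> K w] \<beta>(2) by (simp add: \<gamma>_def cnj_stable)
    moreover have "eV m \<in> multiples K sV v"
    proof -
      have "eV m = sV (inverse \<beta>) v" unfolding v using \<beta> by (simp add: VS.scale_inverse)
      then show ?thesis using VS.multiplesI[OF K_inverse[OF \<beta>(2)]] by metis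
    qed
    moreover have "pr (eV m) (sW (1 - inverse (zeta d)) (eW m)) = 1 - z"
      using root_pair_axis[OF m(1) d1] zc cz by (simp add: root_pair_def)
    ultimately obtain B where "fractional B" "\<rho> = axis_root B m"
      using form zc cz by (auto simp: axis_root_def)
    then show thesis using axis m(1) d1 by metis
  qed
qed

end

section \<open>Distinguished root systems of the monomial groups\<close>

locale monomial_system = monomial_setting K sV sW pr r eV eW d e
  for K :: "complex set"
    and sV :: "complex \<Rightarrow> 'v::ab_group_add \<Rightarrow> 'v"
    and sW :: "complex \<Rightarrow> 'w::ab_group_add \<Rightarrow> 'w"
    and pr :: "'v \<Rightarrow> 'w \<Rightarrow> complex"
    and r :: nat and eV :: "nat \<Rightarrow> 'v" and eW :: "nat \<Rightarrow> 'w" and d e :: nat +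
  fixes \<R> :: "('v, 'w) root set"
  assumes distinguished: "\<R> \<in> distinguished_systems G"
begin

lemma system_for: "root_system_for G \<R>"
  and inj_reflection: "inj_on reflection \<R>"
  and distinguished_reflection: "\<rho> \<in> \<R> \<Longrightarrow> distinguished_reflection G (reflection \<rho>)"
  using distinguished by (auto simp: distinguished_systems_def)

lemma system: "root_system \<R>"
  and generates: "generate (GL K sV) (reflection ` \<R>) = G"
  using system_for by (auto simp: root_system_for_def)

lemma is_root: "\<rho> \<in> \<R> \<Longrightarrow> is_root \<rho>"
  using system by (simp add: root_system_def)

lemma act_closed: "g \<in> G \<Longrightarrow> \<rho> \<in> \<R> \<Longrightarrow> act g \<rho> \<in> \<R>"
  using root_system_act[OF system_for monomial_group_subset_GL] by blast

lemma root_cases: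
  assumes "\<rho> \<in> \<R>"
  obtains (axis) A m where "fractional A" "m \<in> {1..r}" "d > 1" "\<rho> = axis_root A m"
  | (swap) A m n x where "fractional A" "m \<in> {1..r}" "n \<in> {1..r}" "m \<noteq> n" "x ^ (d * e) = 1"
      "\<rho> = swap_root A m n x"
  using distinguished_root_cases[OF is_root[OF assms] distinguished_reflection[OF assms]] by blast

text \<open>The two roots have the same reflection, and in a distinguished system the reflection
  determines the root and with it the ideal.\<close>

lemma swap_root_unique:
  assumes "swap_root A m n x \<in> \<R>" "swap_root B m n x \<in> \<R>" "fractional A" "fractional B"
    and "m \<in> {1..r}" "n \<in> {1..r}" "m \<noteq> n" "x ^ (d * e) = 1"
  shows "A = B"
proof -
  have "swap_root A m n x = swap_root B m n x"
    by (rule inj_onD[OF inj_reflection _ assms(1,2)]) (simp only: reflection_swap_root[OF assms(3,5-8)] reflection_swap_root[OF assms(4,5-8)])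
  then show ?thesis
    unfolding swap_root_def
    by (rule root_at_eqD[OF _ assms(3,4) root_pair_nonzero(1)[OF root_pair_swap[OF assms(5-8)]]])
qed

lemma axis_root_unique:
  assumes "axis_root A m \<in> \<R>" "axis_root B m \<in> \<R>" "fractional A" "fractional B"
    and "m \<in> {1..r}" "d > 1"
  shows "A = B"
proof -
  have "axis_root A m = axis_root B m"
    by (rule inj_onD[OF inj_reflection _ assms(1,2)]) (simp only: reflection_axis_root[OF assms(3,5,6)] reflection_axis_root[OF assms(4,5,6)])
  then show ?thesis
    unfolding axis_root_def
    by (rule root_at_eqD[OF _ assms(3,4) root_pair_nonzero(1)[OF root_pair_axis[OF assms(5,6)]]])
qed

text \<open>Elements of \<open>G\<close> are words in the reflections of the system, so a property
  of entries passes from these to all of \<open>G\<close>. Axis reflections come with their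
  inverses, while swaps are involutions. The entries are determined on \<open>1..r\<close> only, so
  the conclusion provides a representative \<open>c'\<close>.\<close>

lemma monomial_group_induct:
  assumes Q_id: "Q id (\<lambda>_. 1)"
    and Q_comp: "\<And>\<pi> c \<pi>' c'. mon_data \<pi> c \<Longrightarrow> mon_data \<pi>' c' \<Longrightarrow> Q \<pi> c \<Longrightarrow> Q \<pi>' c' \<Longrightarrow>
      Q (\<pi> \<circ> \<pi>') (\<lambda>i. c' i * c (\<pi>' i))"
    and Q_swap: "\<And>A m n x. swap_root A m n x \<in> \<R> \<Longrightarrow> fractional A \<Longrightarrow> m \<in> {1..r} \<Longrightarrow> n \<in> {1..r} \<Longrightarrow> m \<noteq> n \<Longrightarrow>
      x ^ (d * e) = 1 \<Longrightarrow> Q (transpose m n) (swap_coeff m n x)"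
    and Q_axis: "\<And>A m t. axis_root A m \<in> \<R> \<Longrightarrow> fractional A \<Longrightarrow> m \<in> {1..r} \<Longrightarrow> d > 1 \<Longrightarrow>
      t = zeta d \<or> t = inverse (zeta d) \<Longrightarrow> Q id (axis_coeff m t)"
    and md: "mon_data \<pi> c" and c: "(\<Prod>i=1..r. c i) ^ d = 1"
  shows "\<exists>c'. Q \<pi> c' \<and> (\<forall>i\<in>{1..r}. c' i = c i)"
proof -
  define H where "H = {g. \<exists>\<pi> c. mon_data \<pi> c \<and> Q \<pi> c \<and> g = mon \<pi> c}"
  have S: "reflection ` \<R> \<subseteq> carrier (GL K sV)"
    using generate_superset[of "reflection ` \<R>" "GL K sV"] generates monomial_group_subset_GL by blast
  have comp: "g \<circ> h \<in> H" if gh: "g \<in> H" "h \<in> H" for g h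
  proof -
    obtain \<pi> c \<pi>' c' where *: "mon_data \<pi> c" "Q \<pi> c" "g = mon \<pi> c" "mon_data \<pi>' c'" "Q \<pi>' c'" "h = mon \<pi>' c'"
      using gh unfolding H_def by blast
    have "g \<circ> h = mon (\<pi> \<circ> \<pi>') (\<lambda>i. c' i * c (\<pi>' i))"
      unfolding *(3,6) by (rule mon_comp[OF *(1,4)])
    then show ?thesis
      unfolding H_def mem_Collect_eq using mon_data_comp[OF *(1,4)] Q_comp[OF *(1,4,2,5)] by metis
  qed
  have refl_H: "reflection \<rho> \<in> H \<and> inv_into UNIV (reflection \<rho>) \<in> H" if \<rho>: "\<rho> \<in> \<R>" for \<rho>
    using \<rho>
  proof (cases rule: root_cases)
    case (axis A m)
    define s where "s = mon id (axis_coeff m (zeta d))"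
    define t where "t = mon id (axis_coeff m (inverse (zeta d)))"
    have "zeta d ^ d = 1" using axis by (simp add: zeta_power_self)
    then have mz: "mon_data id (axis_coeff m (zeta d))" "mon_data id (axis_coeff m (inverse (zeta d)))"
      by (auto intro!: mon_data_axis root_of_unity_d simp: power_inverse)
    have "s \<circ> t = mon id (\<lambda>_. 1)" "t \<circ> s = mon id (\<lambda>_. 1)"
      unfolding s_def t_def mon_comp[OF mz] mon_comp[OF mz(2,1)]
      by (auto intro!: mon_cong simp: axis_coeff_def zeta_nonzero)
    then have "inv_into UNIV s = t" unfolding mon_id by (rule inv_unique_comp)
    moreover have "s \<in> H" "t \<in> H"
      unfolding H_def s_def t_def using mz Q_axis[of A m] \<rho> axis by blast+
    ultimately show ?thesis unfolding axis(4) reflection_axis_root[OF axis(1-3)] s_def by simp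
  next
    case (swap A m n x)
    define s where "s = mon (transpose m n) (swap_coeff m n x)"
    have mz: "mon_data (transpose m n) (swap_coeff m n x)" using swap by (intro mon_data_swap)
    have "s \<circ> s = mon id (\<lambda>_. 1)"
      unfolding s_def mon_comp[OF mz mz]
      using swap unity_nonzero[of x] by (intro mon_cong) (auto simp: swap_coeff_def transpose_def)
    then have "inv_into UNIV s = s" unfolding mon_id by (intro inv_unique_comp)
    moreover have "s \<in> H"
      unfolding H_def s_def using mz Q_swap[of A m n x] \<rho> swap by blast
    ultimately show ?thesis unfolding swap(6) reflection_swap_root[OF swap(1-5)] s_def by simp
  qed
  have "generate (GL K sV) (reflection ` \<R>) \<subseteq> H"
  proof (rule VS.generate_GL_subset[OF S _ _ _ comp])
    show "id \<in> H" unfolding H_def using Q_id mon_data_id mon_id[symmetric] by blast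
  qed (use refl_H in auto)
  then have "mon \<pi> c \<in> H" using mon_in_group[OF md c] generates by blast
  then obtain \<pi>' c' where H: "mon_data \<pi>' c'" "Q \<pi>' c'" "mon \<pi> c = mon \<pi>' c'"
    unfolding H_def by blast
  have "\<pi>' = \<pi>"
  proof
    fix i show "\<pi>' i = \<pi> i"
      using mon_eqD(1)[OF md H(1) H(3), of i] md H(1) permutes_not_in[of _ "{1..r}" i]
      unfolding mon_data_def by (cases "i \<in> {1..r}") metis+
  qed
  then show ?thesis using H(2) mon_eqD(2)[OF md H(1) H(3)] by (intro exI[of _ c']) simp
qed

text \<open>Swaps have product of entries 1. Without axis roots this would hold for every element of
  \<open>G\<close>, but the diagonal element with single entry \<open>zeta d\<close> violates
  it.\<close>

lemma axis_root_exists: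
  assumes "d > 1" "r \<ge> 1"
  shows "\<exists>A m. fractional A \<and> m \<in> {1..r} \<and> axis_root A m \<in> \<R>"
proof (rule ccontr)
  assume no: "\<not> ?thesis"
  have z: "zeta d ^ d = 1" using assms(1) by (simp add: zeta_power_self)
  have 1: "1 \<in> {1..r}" using assms(2) by simp
  have "\<exists>c'. (\<Prod>i=1..r. c' i) = 1 \<and> (\<forall>i\<in>{1..r}. c' i = axis_coeff 1 (zeta d) i)"
  proof (rule monomial_group_induct[where Q = "\<lambda>\<pi> c. (\<Prod>i=1..r. c i) = 1" and \<pi> = id
        and c = "axis_coeff 1 (zeta d)"])
    fix \<pi> c \<pi>' c' assume "mon_data \<pi> c" "mon_data \<pi>' c'" "(\<Prod>i=1..r. c i) = 1" "(\<Prod>i=1..r. c' i) = 1"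
    moreover have "(\<Prod>i=1..r. c (\<pi>' i)) = (\<Prod>i=1..r. c i)"
      using \<open>mon_data \<pi>' c'\<close> prod.permute[of \<pi>' "{1..r}" c] by (simp add: mon_data_def o_def)
    ultimately show "(\<Prod>i=1..r. c' i * c (\<pi>' i)) = 1" by (simp add: prod.distrib)
  next
    fix A m n and x :: complex assume "m \<in> {1..r}" "n \<in> {1..r}" "m \<noteq> n" "x ^ (d * e) = 1"
    then show "(\<Prod>i=1..r. swap_coeff m n x i) = 1" using unity_nonzero by (intro prod_swap_coeff)
  next
    show "mon_data id (axis_coeff 1 (zeta d))" by (intro mon_data_axis root_of_unity_d z)
    show "(\<Prod>i=1..r. axis_coeff 1 (zeta d) i) ^ d = 1" using prod_axis_coeff[OF 1] z by simp
  next
    fix A m t assume "axis_root A m \<in> \<R>" "fractional A" "m \<in> {1..r}"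
    then show "(\<Prod>i=1..r. axis_coeff m t i) = 1" using no by blast
  qed simp
  then obtain c' where c': "(\<Prod>i=1..r. c' i) = 1" "\<And>i. i \<in> {1..r} \<Longrightarrow> c' i = axis_coeff 1 (zeta d) i"
    by blast
  have "(\<Prod>i=1..r. c' i) = zeta d"
    using prod.cong[OF HOL.refl c'(2), of "{1..r}"] prod_axis_coeff[OF 1, of "zeta d"] by simp
  then show False using c'(1) zeta_neq_1[OF assms(1)] by simp
qed

text \<open>Axis reflections are diagonal, so without swaps no element of \<open>G\<close> could
  permute the basis lines.\<close>

lemma swap_root_exists:
  assumes "r \<ge> 2"
  shows "\<exists>A m n x. fractional A \<and> m \<in> {1..r} \<and> n \<in> {1..r} \<and> m \<noteq> n \<and> x ^ (d * e) = 1 \<and>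
    swap_root A m n x \<in> \<R>"
proof (rule ccontr)
  assume no: "\<not> ?thesis"
  have r: "1 \<in> {1..r}" "2 \<in> {1..r}" using assms by auto
  have "\<exists>c'. (\<forall>i\<in>{1..r}. transpose 1 2 i = i) \<and> (\<forall>i\<in>{1..r}. c' i = swap_coeff 1 2 1 i)"
  proof (rule monomial_group_induct[where Q = "\<lambda>\<pi> c. \<forall>i\<in>{1..r}. \<pi> i = i" and \<pi> = "transpose 1 2"
        and c = "swap_coeff 1 2 1"])
    show "mon_data (transpose 1 2) (swap_coeff 1 2 1)" using r by (intro mon_data_swap) auto
    show "(\<Prod>i=1..r. swap_coeff 1 2 1 i) ^ d = 1" using prod_swap_coeff[OF r] by simp
  next
    fix A m n x assume "swap_root A m n x \<in> \<R>" "fractional A" "m \<in> {1..r}" "n \<in> {1..r}" "m \<noteq> n"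
      "x ^ (d * e) = 1"
    then show "\<forall>i\<in>{1..r}. transpose m n i = i" using no by blast
  next
    fix \<pi> c \<pi>' c' assume "mon_data \<pi>' c'" "\<forall>i\<in>{1..r}. \<pi> i = i" "\<forall>i\<in>{1..r}. \<pi>' i = i"
    then show "\<forall>i\<in>{1..r}. (\<pi> \<circ> \<pi>') i = i" by simp
  qed simp_all
  then have "transpose 1 2 (1::nat) = 1" using r by blast
  then show False by simp
qed

text \<open>For \<open>r = 2\<close> and even \<open>e\<close> the product of the first nonzero entry to the power
  \<open>d e / 2\<close> with a power of the sign of the permutation is a character of \<open>G\<close>;
  it separates the roots with even index from those with odd index.\<close>

lemma swap_root_exists_parity:
  assumes r: "r = 2" and e: "even e" and N: "d * e = 2 * N" and \<delta>: "\<delta> = 1 \<or> \<delta> = (- 1 :: complex)"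
  shows "\<exists>A m n x. fractional A \<and> m \<in> {1..r} \<and> n \<in> {1..r} \<and> m \<noteq> n \<and> x ^ (d * e) = 1 \<and> x ^ N = \<delta> \<and>
    swap_root A m n x \<in> \<R>"
proof (rule ccontr)
  assume no: "\<not> ?thesis"
  \<comment> \<open>\<open>x ^ N\<close> is always a sign. If \<open>\<delta>\<close> does not occur
    among the swaps of the system, they all have \<open>x ^ N = \<epsilon>\<close>.\<close>
  define \<epsilon> where "\<epsilon> = - \<delta>"
  have \<epsilon>: "\<epsilon> * \<epsilon> = 1" "inverse \<epsilon> = \<epsilon>" "\<epsilon> \<noteq> \<delta>" "\<delta> \<noteq> 0" using \<delta> by (auto simp: \<epsilon>_def)
  have half: "x ^ N = \<epsilon>" if "x ^ (d * e) = 1" "x ^ N \<noteq> \<delta>" for x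
  proof -
    have "(x ^ N)\<^sup>2 = 1" using that(1) N by (simp add: power_mult[symmetric] mult.commute)
    then have "x ^ N = 1 \<or> x ^ N = - 1" by (rule power2_eq_1_iff[THEN iffD1])
    then show ?thesis using that(2) \<delta> by (auto simp: \<epsilon>_def)
  qed
  have Npos: "N > 0" using N de_pos by simp
  have zN: "zeta (d * e) ^ N = - 1" unfolding N by (rule zeta_power_half[OF Npos])
  \<comment> \<open>The parameter of a swap in \<open>G\<close> with the sign
    \<open>\<delta>\<close>: exponent 0 or 1, according to the parity wanted.\<close>
  define y where "y = (if \<delta> = 1 then 1 else zeta (d * e))"
  have y: "y ^ (d * e) = 1" "y ^ N = \<delta>"
    using \<delta> zN de_pos by (auto simp: y_def zeta_power_self)
  have I: "{1..r} = {1, 2}" using r by auto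
  have perm: "\<pi> 1 = 1 \<and> \<pi> 2 = 2 \<or> \<pi> 1 = 2 \<and> \<pi> 2 = 1" if "mon_data \<pi> c" for \<pi> c
    using mon_data_perm[OF that, of 1] mon_data_perm[OF that, of 2] mon_data_inj[OF that, of 1 2]
    unfolding I by auto
  have "\<exists>c'. (c' 1 ^ N = (if transpose 1 2 (1::nat) = 1 then 1 else \<epsilon>) \<and>
      c' 2 ^ N = (if transpose 1 2 (1::nat) = 1 then 1 else \<epsilon>)) \<and>
      (\<forall>i\<in>{1..r}. c' i = swap_coeff 1 2 y i)"
  \<comment> \<open>Both entries are followed, because a composition with the transposition
    exchanges them.\<close>
  proof (rule monomial_group_induct[where Q = "\<lambda>\<pi> c. c 1 ^ N = (if \<pi> (1::nat) = 1 then 1 else \<epsilon>) \<and>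
        c (2::nat) ^ N = (if \<pi> 1 = 1 then 1 else \<epsilon>)" and \<pi> = "transpose 1 2" and c = "swap_coeff 1 2 y"])
    fix \<pi> c \<pi>' c' assume md: "mon_data \<pi> c" "mon_data \<pi>' c'"
      and Q: "c 1 ^ N = (if \<pi> 1 = 1 then 1 else \<epsilon>) \<and> c 2 ^ N = (if \<pi> 1 = 1 then 1 else \<epsilon>)"
        "c' 1 ^ N = (if \<pi>' 1 = 1 then 1 else \<epsilon>) \<and> c' 2 ^ N = (if \<pi>' 1 = 1 then 1 else \<epsilon>)"
    show "(c' 1 * c (\<pi>' 1)) ^ N = (if (\<pi> \<circ> \<pi>') 1 = 1 then 1 else \<epsilon>) \<and>
        (c' 2 * c (\<pi>' 2)) ^ N = (if (\<pi> \<circ> \<pi>') 1 = 1 then 1 else \<epsilon>)"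
      using perm[OF md(1)] perm[OF md(2)] Q \<epsilon>(1) by (auto simp: power_mult_distrib)
  next
    fix A m n x assume *: "swap_root A m n x \<in> \<R>" "fractional A" "m \<in> {1..r}" "n \<in> {1..r}" "m \<noteq> n"
      "x ^ (d * e) = 1"
    then have xN: "x ^ N = \<epsilon>" using no half by blast
    have iN: "inverse x ^ N = \<epsilon>" unfolding power_inverse xN by (rule \<epsilon>(2))
    have mn: "m = 1 \<and> n = 2 \<or> m = 2 \<and> n = 1" using *(3-5) unfolding I by auto
    show "swap_coeff m n x 1 ^ N = (if transpose m n 1 = 1 then 1 else \<epsilon>) \<and>
        swap_coeff m n x 2 ^ N = (if transpose m n 1 = 1 then 1 else \<epsilon>)"
      using mn by (elim disjE conjE) (simp_all add: swap_coeff_def xN iN)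
  next
    fix A m t assume "t = zeta d \<or> t = inverse (zeta d)"
    \<comment> \<open>\<open>zeta d\<close> is the \<open>e\<close>-th power of
      \<open>zeta (d * e)\<close>, so the value is \<open>(- 1) ^ e\<close>. This is where an even
      \<open>e\<close> protects the invariant from the axis reflections.\<close>
    moreover have "zeta d ^ N = 1"
    proof -
      have "zeta d = zeta (d * e) ^ e"
        using zeta_mult_power[of e d] e_pos by simp
      then have "zeta d ^ N = (zeta (d * e) ^ e) ^ N" by (rule arg_cong)
      also have "\<dots> = (zeta (d * e) ^ N) ^ e"
        by (simp only: power_mult[symmetric] mult.commute)
      finally have "zeta d ^ N = (zeta (d * e) ^ N) ^ e" .
      then show ?thesis using zN e by simp
    qed
    ultimately show "axis_coeff m t 1 ^ N = (if id (1::nat) = 1 then 1 else \<epsilon>) \<and>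
        axis_coeff m t 2 ^ N = (if id (1::nat) = 1 then 1 else \<epsilon>)"
      by (auto simp: axis_coeff_def power_inverse)
  next
    show "mon_data (transpose 1 2) (swap_coeff 1 2 y)" using r y by (intro mon_data_swap) auto
    have "y \<noteq> 0" using unity_nonzero[OF y(1)] .
    then show "(\<Prod>i=1..r. swap_coeff 1 2 y i) ^ d = 1"
      using prod_swap_coeff[of 1 2 y] r by simp
  qed simp
  then have "y ^ N = \<epsilon>" using r by (auto simp: swap_coeff_def)
  then show False using y(2) \<epsilon>(3) by simp
qed

section \<open>Orbits of swap roots\<close>

lemma swap_root_move:
  assumes "swap_root A m n x \<in> \<R>" "fractional A" "m \<in> {1..r}" "n \<in> {1..r}" "x ^ (d * e) = 1"
    and "mon_data \<pi> c" "(\<Prod>i=1..r. c i) ^ d = 1"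
  shows "swap_root A (\<pi> m) (\<pi> n) (x * c n / c m) \<in> \<R>"
  using act_closed[OF mon_in_group[OF assms(6,7)] assms(1)] act_swap_root[OF assms(6,2-5)] by simp

text \<open>Permutation matrices have entries 1 and keep the parameter. The first transposition
  takes \<open>m\<close> to \<open>m'\<close> and \<open>n\<close> to some
  \<open>k \<noteq> m'\<close>; the second takes \<open>k\<close> to \<open>n'\<close> and fixes
  \<open>m'\<close>.\<close>

lemma swap_root_permute:
  assumes "swap_root A m n x \<in> \<R>" "fractional A" "m \<in> {1..r}" "n \<in> {1..r}" "m \<noteq> n" "x ^ (d * e) = 1"
    and "m' \<in> {1..r}" "n' \<in> {1..r}" "m' \<noteq> n'"
  shows "swap_root A m' n' x \<in> \<R>"
proof -
  define k where "k = transpose m m' n"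
  define \<pi> where "\<pi> = transpose k n' \<circ> transpose m m'"
  have k: "k \<in> {1..r}" "k \<noteq> m'" using assms by (auto simp: k_def transpose_def)
  have "\<pi> m = m'" "\<pi> n = n'"
    using k assms(9) by (simp_all add: \<pi>_def k_def[symmetric] transpose_apply_other)
  moreover have "\<pi> permutes {1..r}"
    unfolding \<pi>_def using assms k by (intro permutes_compose permutes_swap_id)
  then have "mon_data \<pi> (\<lambda>_. 1)" by (simp add: mon_data_def)
  ultimately show ?thesis using swap_root_move[OF assms(1-4,6), of \<pi> "\<lambda>_. 1"] by simp
qed

text \<open>The diagonal matrix with entries \<open>inverse y\<close> and \<open>y\<close> has
  product 1 and multiplies the parameter by their quotient.\<close>

lemma swap_root_square:
  assumes "swap_root A 1 2 x \<in> \<R>" "fractional A" "r \<ge> 2" "x ^ (d * e) = 1" "y ^ (d * e) = 1"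
  shows "swap_root A 1 2 (x * y\<^sup>2) \<in> \<R>"
proof -
  have r: "1 \<in> {1..r}" "2 \<in> {1..r}" using assms(3) by auto
  have y0: "y \<noteq> 0" using unity_nonzero[OF assms(5)] .
  have md: "mon_data id (swap_coeff 1 2 (inverse y))"
    using assms(5) by (auto simp: mon_data_def swap_coeff_def permutes_id power_inverse)
  have "(\<Prod>i=1..r. swap_coeff 1 2 (inverse y) i) = 1" by (rule prod_swap_coeff) (use r y0 in auto)
  then have "(\<Prod>i=1..r. swap_coeff 1 2 (inverse y) i) ^ d = 1" by simp
  from swap_root_move[OF assms(1,2) r assms(4) md this] show ?thesis
    using y0 by (simp add: swap_coeff_def field_simps power2_eq_square)
qed

text \<open>The parameter is multiplied by \<open>t\<close> if index 2 receives the entry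
  \<open>t\<close>. For \<open>r \<ge> 3\<close> index 3 compensates with \<open>inverse t\<close>.
  For odd \<open>e\<close>, \<open>zeta d\<close> is an admissible single entry and an odd power of
  \<open>zeta (d * e)\<close>; squares supply the even powers.\<close>

lemma swap_root_single_orbit:
  assumes "swap_root A 1 2 x \<in> \<R>" "fractional A" "r \<ge> 2" "x ^ (d * e) = 1" "y ^ (d * e) = 1"
    and orbit: "r \<ge> 3 \<or> odd e"
  shows "swap_root A 1 2 y \<in> \<R>"
proof -
  have r: "1 \<in> {1..r}" "2 \<in> {1..r}" using assms(3) by auto
  have x0: "x \<noteq> 0" using unity_nonzero[OF assms(4)] .
  define t where "t = y / x"
  have t: "t ^ (d * e) = 1" "x * t = y" "t \<noteq> 0"
    using assms(4,5) x0 unity_nonzero[OF assms(5)] by (simp_all add: t_def power_divide)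
  show ?thesis
  proof (cases "r \<ge> 3")
    case True
    then have 3: "3 \<in> {1..r}" by simp
    have md: "mon_data id (swap_coeff 2 3 t)"
      using t by (auto simp: mon_data_def swap_coeff_def permutes_id power_inverse)
    have "(\<Prod>i=1..r. swap_coeff 2 3 t i) = 1" by (rule prod_swap_coeff) (use r 3 t in auto)
    then have "(\<Prod>i=1..r. swap_coeff 2 3 t i) ^ d = 1" by simp
    from swap_root_move[OF assms(1,2) r assms(4) md this] show ?thesis
      using t(2) by (simp add: swap_coeff_def)
  next
    case False
    then have odd: "odd e" using orbit by simp
    let ?\<zeta> = "zeta (d * e)"
    have \<zeta>: "?\<zeta> ^ (d * e) = 1" using de_pos by (simp add: zeta_power_self)
    have even_step: "swap_root A 1 2 (u * ?\<zeta> ^ k) \<in> \<R>"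
      if u: "swap_root A 1 2 u \<in> \<R>" "u ^ (d * e) = 1" and k: "even k" for u k
    proof -
      obtain l where l: "k = 2 * l" using k by (rule evenE)
      have "(?\<zeta> ^ l) ^ (d * e) = (?\<zeta> ^ (d * e)) ^ l" by (simp only: power_mult[symmetric] mult.commute)
      then have "(?\<zeta> ^ l) ^ (d * e) = 1" unfolding \<zeta> by simp
      from swap_root_square[OF u(1) assms(2,3) u(2) this] show ?thesis
        unfolding l by (simp only: power_mult[symmetric] mult.commute[of 2 l])
    qed
    have e_step: "swap_root A 1 2 (x * ?\<zeta> ^ e) \<in> \<R>"
    proof -
      have ze: "?\<zeta> ^ e = zeta d" using e_pos by (intro zeta_mult_power) simp
      have zd: "zeta d ^ d = 1" using d_pos by (simp add: zeta_power_self)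
      have md: "mon_data id (axis_coeff 2 (zeta d))" by (intro mon_data_axis root_of_unity_d zd)
      have "(\<Prod>i=1..r. axis_coeff 2 (zeta d) i) ^ d = 1" using prod_axis_coeff[OF r(2)] zd by simp
      from swap_root_move[OF assms(1,2) r assms(4) md this] show ?thesis
        by (simp add: axis_coeff_def ze)
    qed
    have "(?\<zeta> ^ e) ^ (d * e) = (?\<zeta> ^ (d * e)) ^ e" by (simp only: power_mult[symmetric] mult.commute)
    then have xe: "(x * ?\<zeta> ^ e) ^ (d * e) = 1"
      unfolding power_mult_distrib assms(4) \<zeta> by simp
    obtain k where k: "t = ?\<zeta> ^ k" using root_of_unity_zeta_power[OF de_pos t(1)] by blast
    \<comment> \<open>Adding the period keeps the power; it may change the parity of the exponent,
      and it ensures that \<open>e\<close> can be subtracted in the natural numbers.\<close>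
    have kq: "?\<zeta> ^ (k + d * e) = t" using k \<zeta> by (simp add: power_add)
    show ?thesis
    proof (cases "even k \<or> even (k + d * e)")
      case True
      then show ?thesis
        using even_step[OF assms(1,4), of k] even_step[OF assms(1,4), of "k + d * e"] k kq t(2) by auto
    next
      case False
      have le: "e \<le> k + d * e" using d_pos by (simp add: trans_le_add2)
      have "even (s - e)" if "odd s" for s :: nat using that odd by simp
      then have "even (k + d * e - e)" using False by blast
      from even_step[OF e_step xe this]
      have "swap_root A 1 2 (x * (?\<zeta> ^ e * ?\<zeta> ^ (k + d * e - e))) \<in> \<R>" by (simp add: mult.assoc)
      also have "?\<zeta> ^ e * ?\<zeta> ^ (k + d * e - e) = t"
        using kq le by (simp only: power_add[symmetric] le_add_diff_inverse)
      finally show ?thesis using t(2) by simp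
    qed
  qed
qed

end

section \<open>Reading off the ideals of a system\<close>

context monomial_system
begin

definition genus_member :: "('v, 'w) root set \<Rightarrow> bool" where
  "genus_member \<S> \<longleftrightarrow> (\<exists>C. fractional C \<and> \<S> \<in> distinguished_systems G \<and> \<S> = ideal_act C ` \<R>)"

lemma zeta_power_de: "(zeta (d * e) ^ j) ^ (d * e) = 1"
proof -
  have "(zeta (d * e) ^ j) ^ (d * e) = (zeta (d * e) ^ (d * e)) ^ j"
    by (simp only: power_mult[symmetric] mult.commute)
  then show ?thesis using zeta_power_self[OF de_pos] by simp
qed

lemma swap_root_same_parity:
  assumes "swap_root A 1 2 (zeta (d * e) ^ j) \<in> \<R>" "fractional A" "r \<ge> 2"
    and "even (d * e)" "even j \<longleftrightarrow> even k"
  shows "swap_root A 1 2 (zeta (d * e) ^ k) \<in> \<R>"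
proof -
  let ?q = "d * e"
  \<comment> \<open>A multiple of the period is added so that the difference of exponents is a
    natural number; as \<open>d * e\<close> is even, the parity is unchanged.\<close>
  have le: "j \<le> k + ?q * j" using de_pos by (metis One_nat_def Suc_leI mult_le_mono1 nat_mult_1 trans_le_add2)
  have "even (k + ?q * j - j)" using assms(4,5) le by (simp only: even_diff_nat) auto
  then obtain l where l: "k + ?q * j - j = 2 * l" by (rule evenE)
  have "swap_root A 1 2 (zeta ?q ^ j * (zeta ?q ^ l)\<^sup>2) \<in> \<R>"
    by (rule swap_root_square[OF assms(1-3) zeta_power_de zeta_power_de])
  also have "zeta ?q ^ j * (zeta ?q ^ l)\<^sup>2 = zeta ?q ^ (j + 2 * l)"
    by (simp only: power_add power_mult mult.commute[of 2 l])
  also have "j + 2 * l = k + ?q * j" using l le by simp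
  also have "zeta ?q ^ (k + ?q * j) = zeta ?q ^ k"
    using zeta_power_self[OF de_pos] by (simp only: power_add power_mult power_one mult_1_right)
  finally show ?thesis .
qed

text \<open>The exponent \<open>j\<close> is unbounded. If \<open>d * e\<close> is odd, one root of
  unity has exponents of both parities; but then \<open>e\<close> is odd and the two ideals
  agree.\<close>

lemma swap_roots:
  assumes r: "r \<ge> 2"
  obtains B\<^sub>0 B\<^sub>1 where "fractional B\<^sub>0" "fractional B\<^sub>1"
    "\<And>j m n. even j \<Longrightarrow> m \<in> {1..r} \<Longrightarrow> n \<in> {1..r} \<Longrightarrow> m \<noteq> n \<Longrightarrow> swap_root B\<^sub>0 m n (zeta (d * e) ^ j) \<in> \<R>"
    "\<And>j m n. odd j \<Longrightarrow> m \<in> {1..r} \<Longrightarrow> n \<in> {1..r} \<Longrightarrow> m \<noteq> n \<Longrightarrow> swap_root B\<^sub>1 m n (zeta (d * e) ^ j) \<in> \<R>"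
    "r \<ge> 3 \<or> odd e \<Longrightarrow> B\<^sub>0 = B\<^sub>1"
proof -
  let ?\<zeta> = "zeta (d * e)"
  have r12: "1 \<in> {1..r}" "2 \<in> {1..r}" "(1::nat) \<noteq> 2" using r by auto
  have from12: "swap_root B m n (?\<zeta> ^ j) \<in> \<R>"
    if "swap_root B 1 2 (?\<zeta> ^ j) \<in> \<R>" "fractional B" "m \<in> {1..r}" "n \<in> {1..r}" "m \<noteq> n" for B m n j
    by (rule swap_root_permute[OF that(1,2) r12 zeta_power_de that(3-5)])
  show thesis
  proof (cases "r \<ge> 3 \<or> odd e")
    case True
    obtain A m n x where A: "fractional A" "m \<in> {1..r}" "n \<in> {1..r}" "m \<noteq> n" "x ^ (d * e) = 1"
      "swap_root A m n x \<in> \<R>"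
      using swap_root_exists[OF r] by blast
    have "swap_root A 1 2 x \<in> \<R>" by (rule swap_root_permute[OF A(6,1-5) r12])
    then have "swap_root A 1 2 (?\<zeta> ^ j) \<in> \<R>" for j
      by (rule swap_root_single_orbit[OF _ A(1) r A(5) zeta_power_de True])
    then show thesis using that[of A A] from12 A(1) by blast
  next
    case False
    then have r2: "r = 2" and e: "even e" using r by auto
    then obtain N where N: "d * e = 2 * N" by (metis evenE even_mult_iff)
    have Npos: "N > 0" using N de_pos by simp
    have zN: "?\<zeta> ^ N = - 1" unfolding N by (rule zeta_power_half[OF Npos])
    have ex: "\<exists>A. fractional A \<and> (\<forall>k. (even k \<longleftrightarrow> \<delta> = 1) \<longrightarrow> swap_root A 1 2 (?\<zeta> ^ k) \<in> \<R>)"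
      if \<delta>: "\<delta> = 1 \<or> \<delta> = (- 1 :: complex)" for \<delta>
    proof -
      obtain A m n x where A: "fractional A" "m \<in> {1..r}" "n \<in> {1..r}" "m \<noteq> n" "x ^ (d * e) = 1"
        "x ^ N = \<delta>" "swap_root A m n x \<in> \<R>"
        using swap_root_exists_parity[OF r2 e N \<delta>] by blast
      have x12: "swap_root A 1 2 x \<in> \<R>" by (rule swap_root_permute[OF A(7,1-5) r12])
      obtain j where j: "x = ?\<zeta> ^ j" using root_of_unity_zeta_power[OF de_pos A(5)] by blast
      have "x ^ N = (?\<zeta> ^ N) ^ j" unfolding j by (simp only: power_mult[symmetric] mult.commute)
      then have "\<delta> = (- 1) ^ j" using A(6) zN by simp
      \<comment> \<open>The sign \<open>x ^ N\<close> records the parity of the exponent, so squares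
        reach every other exponent of the same class.\<close>
      then have par: "even j \<longleftrightarrow> \<delta> = 1" by (cases "even j") auto
      have "swap_root A 1 2 (?\<zeta> ^ k) \<in> \<R>" if "even k \<longleftrightarrow> \<delta> = 1" for k
        using swap_root_same_parity[of A j k] x12 A(1) r N par that unfolding j by simp
      then show ?thesis using A(1) by blast
    qed
    obtain B\<^sub>0 where B0: "fractional B\<^sub>0" "\<And>k. even k \<Longrightarrow> swap_root B\<^sub>0 1 2 (?\<zeta> ^ k) \<in> \<R>"
      using ex[of 1] by auto
    have "- 1 \<noteq> (1 :: complex)" by simp
    then obtain B\<^sub>1 where B1: "fractional B\<^sub>1" "\<And>k. odd k \<Longrightarrow> swap_root B\<^sub>1 1 2 (?\<zeta> ^ k) \<in> \<R>"
      using ex[of "- 1"] by auto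
    show thesis
      using that[of B\<^sub>0 B\<^sub>1, OF B0(1) B1(1) from12[OF B0(2) B0(1)] from12[OF B1(2) B1(1)]] False by blast
  qed
qed

lemma axis_roots:
  assumes "d > 1" "r \<ge> 1"
  obtains A where "fractional A" "\<And>m. m \<in> {1..r} \<Longrightarrow> axis_root A m \<in> \<R>"
proof -
  obtain A m where A: "fractional A" "m \<in> {1..r}" "axis_root A m \<in> \<R>"
    using axis_root_exists[OF assms] by blast
  have "axis_root A n \<in> \<R>" if n: "n \<in> {1..r}" for n
  proof -
    have md: "mon_data (transpose m n) (\<lambda>_. 1)"
      using A(2) n by (auto simp: mon_data_def intro: permutes_swap_id)
    have "act (mon (transpose m n) (\<lambda>_. 1)) (axis_root A m) \<in> \<R>"
      by (rule act_closed[OF mon_in_group[OF md] A(3)]) simp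
    then show ?thesis by (simp add: act_axis_root[OF md A(1,2)])
  qed
  then show thesis using that A(1) by blast
qed

lemma family_system_conv:
  assumes "fractional A" "fractional B\<^sub>0" "fractional B\<^sub>1"
  shows "family_system d e A B\<^sub>0 B\<^sub>1 =
    {axis_root A m | m. d \<noteq> 1 \<and> m \<in> {1..r}} \<union>
    {swap_root (if even j then B\<^sub>0 else B\<^sub>1) m n (zeta (d * e) ^ j) | j m n.
       m \<in> {1..r} \<and> n \<in> {1..r} \<and> m < n \<and> j < d * e}" (is "_ = ?D \<union> ?S")
proof -
  have "ideal_act A ` diag_roots d = ?D"
  proof -
    have "diag_roots d = {diag_root d m | m. d \<noteq> 1 \<and> m \<in> {1..r}}"
      by (auto simp: diag_roots_def)
    then show ?thesis
      unfolding setcompr_eq_image by (simp only: image_image ideal_act_diag_root[OF assms(1)])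
  qed
  moreover have "ideal_act B\<^sub>0 ` even_roots (d * e) \<union> ideal_act B\<^sub>1 ` odd_roots (d * e) = ?S"
  proof (intro subset_antisym subsetI)
    fix \<rho> assume "\<rho> \<in> ideal_act B\<^sub>0 ` even_roots (d * e) \<union> ideal_act B\<^sub>1 ` odd_roots (d * e)"
    then consider
      j m n where "\<rho> = ideal_act B\<^sub>0 (perm_root (d * e) j m n)" "1 \<le> m" "m < n" "n \<le> r" "j \<le> d * e - 1" "even j" |
      j m n where "\<rho> = ideal_act B\<^sub>1 (perm_root (d * e) j m n)" "1 \<le> m" "m < n" "n \<le> r" "j \<le> d * e - 1" "odd j"
      unfolding even_roots_def odd_roots_def by blast
    then show "\<rho> \<in> ?S"
    proof cases
      case (1 j m n)
      then have "m \<in> {1..r}" "n \<in> {1..r}" by auto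
      moreover have "j < d * e" using 1(5) de_pos by linarith
      moreover have "\<rho> = swap_root (if even j then B\<^sub>0 else B\<^sub>1) m n (zeta (d * e) ^ j)"
        using 1 assms by (simp add: ideal_act_perm_root)
      ultimately show ?thesis using 1(3) by blast
    next
      case (2 j m n)
      then have "m \<in> {1..r}" "n \<in> {1..r}" by auto
      moreover have "j < d * e" using 2(5) de_pos by linarith
      moreover have "\<rho> = swap_root (if even j then B\<^sub>0 else B\<^sub>1) m n (zeta (d * e) ^ j)"
        using 2 assms by (simp add: ideal_act_perm_root)
      ultimately show ?thesis using 2(3) by blast
    qed
  next
    fix \<rho> assume "\<rho> \<in> ?S"
    then obtain j m n where \<rho>: "\<rho> = swap_root (if even j then B\<^sub>0 else B\<^sub>1) m n (zeta (d * e) ^ j)"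
      "m \<in> {1..r}" "n \<in> {1..r}" "m < n" "j < d * e"
      by blast
    then have *: "1 \<le> m" "m < n" "n \<le> r" "j \<le> d * e - 1" by auto
    show "\<rho> \<in> ideal_act B\<^sub>0 ` even_roots (d * e) \<union> ideal_act B\<^sub>1 ` odd_roots (d * e)"
    proof (cases "even j")
      case True
      then have "perm_root (d * e) j m n \<in> even_roots (d * e)"
        unfolding even_roots_def using * by blast
      moreover have "\<rho> = ideal_act B\<^sub>0 (perm_root (d * e) j m n)"
        using True \<rho>(1) assms by (simp add: ideal_act_perm_root)
      ultimately show ?thesis by blast
    next
      case False
      then have "perm_root (d * e) j m n \<in> odd_roots (d * e)"
        unfolding odd_roots_def using * by blast
      moreover have "\<rho> = ideal_act B\<^sub>1 (perm_root (d * e) j m n)"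
        using False \<rho>(1) assms by (simp add: ideal_act_perm_root)
      ultimately show ?thesis by blast
    qed
  qed
  ultimately show ?thesis by (simp add: family_system_def Un_assoc)
qed

text \<open>Each root of the system shares its reflection with a listed root, so uniqueness
  identifies the ideals. The family lists only \<open>m < n\<close>; a root with
  \<open>n < m\<close> is flipped first.\<close>

lemma system_eq_family:
  assumes A: "fractional A" and B: "fractional B\<^sub>0" "fractional B\<^sub>1"
    and axes: "\<And>m. d > 1 \<Longrightarrow> m \<in> {1..r} \<Longrightarrow> axis_root A m \<in> \<R>"
    and swaps: "\<And>j m n. m \<in> {1..r} \<Longrightarrow> n \<in> {1..r} \<Longrightarrow> m \<noteq> n \<Longrightarrow>
      swap_root (if even j then B\<^sub>0 else B\<^sub>1) m n (zeta (d * e) ^ j) \<in> \<R>"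
  shows "\<R> = family_system d e A B\<^sub>0 B\<^sub>1"
  unfolding family_system_conv[OF A B]
proof (intro subset_antisym subsetI)
  let ?D = "{axis_root A m | m. d \<noteq> 1 \<and> m \<in> {1..r}}"
  let ?S = "{swap_root (if even j then B\<^sub>0 else B\<^sub>1) m n (zeta (d * e) ^ j) | j m n.
    m \<in> {1..r} \<and> n \<in> {1..r} \<and> m < n \<and> j < d * e}"
  fix \<rho> assume \<rho>: "\<rho> \<in> \<R>"
  have swap_in: "swap_root A' m n x \<in> ?S"
    if s: "fractional A'" "m \<in> {1..r}" "n \<in> {1..r}" "m < n" "x ^ (d * e) = 1" "swap_root A' m n x \<in> \<R>"
    for A' m n x
  proof -
    obtain j where j: "j < d * e" "x = zeta (d * e) ^ j"
      by (rule root_of_unity_zeta_power[OF de_pos s(5)])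
    let ?B = "if even j then B\<^sub>0 else B\<^sub>1"
    have "swap_root ?B m n x \<in> \<R>" unfolding j(2) using s by (intro swaps) auto
    then have "A' = ?B"
      using swap_root_unique[OF s(6) _ s(1) _ s(2,3) _ s(5), of ?B] B s(4) by auto
    then show ?thesis using s(2-4) j by blast
  qed
  from \<rho> show "\<rho> \<in> ?D \<union> ?S"
  proof (cases rule: root_cases)
    case (axis A' m)
    then have "A' = A" using axis_root_unique[OF _ axes[OF axis(3,2)] axis(1) A axis(2,3)] \<rho> by metis
    then show ?thesis using axis by auto
  next
    case (swap A' m n x)
    show ?thesis
    proof (cases "m < n")
      case True
      then show ?thesis using swap_in[OF swap(1-3) _ swap(5)] swap(6) \<rho> by blast
    next
      case False
      have eq: "\<rho> = swap_root A' n m (inverse x)"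
        unfolding swap(6) swap_root_flip[OF swap(1,5)] ..
      have "n < m" "inverse x ^ (d * e) = 1" using swap(4,5) False by (simp_all only: power_inverse) simp_all
      then show ?thesis
        unfolding eq by (intro UnI2 swap_in[OF swap(1,3,2)]) (use \<rho> eq in simp_all)
    qed
  qed
next
  let ?D = "{axis_root A m | m. d \<noteq> 1 \<and> m \<in> {1..r}}"
  let ?S = "{swap_root (if even j then B\<^sub>0 else B\<^sub>1) m n (zeta (d * e) ^ j) | j m n.
    m \<in> {1..r} \<and> n \<in> {1..r} \<and> m < n \<and> j < d * e}"
  fix \<rho> assume "\<rho> \<in> ?D \<union> ?S"
  then consider m where "\<rho> = axis_root A m" "d \<noteq> 1" "m \<in> {1..r}" |
    j m n where "\<rho> = swap_root (if even j then B\<^sub>0 else B\<^sub>1) m n (zeta (d * e) ^ j)"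
      "m \<in> {1..r}" "n \<in> {1..r}" "m < n"
    by blast
  then show "\<rho> \<in> \<R>"
  proof cases
    case (1 m)
    then show ?thesis using axes d_pos by simp
  next
    case (2 j m n)
    then show ?thesis using swaps[of m n j] by simp
  qed
qed

text \<open>Multiplying the integral pairing ideal by \<open>B\<close> cancels the inverse of
  \<open>B\<close> and leaves \<open>pr v w'\<close> times \<open>A\<close> inside
  \<open>B\<close>.\<close>

lemma pairing_integral:
  assumes "root_at A v w z \<in> \<R>" "root_at B v' w' z' \<in> \<R>" "fractional A" "fractional B" "a \<in> A"
  shows "pr v w' * a \<in> B"
proof -
  have "pair_ideal (multiples A sV v) (multiples (cnj ` ideal_inverse K B) sW w') \<subseteq> \<O>"
    using system assms(1,2) unfolding root_system_def root_at_def by fastforce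
  then have int: "t * pr v w' \<in> \<O>" if "t \<in> A \<star> ideal_inverse K B" for t
    using pair_ideal_multiples[of A "ideal_inverse K B" v w'] assms(3,4) that
    by (auto simp: fractional_subset_K fractional_inverse)
  have "A = (A \<star> ideal_inverse K B) \<star> B"
    using assms(3,4) by (simp add: ideal_mult_assoc ideal_mult_commute[of "ideal_inverse K B" B]
        ideal_mult_inverse ideal_mult_O_right fractional_submodule)
  also have "\<dots> \<subseteq> {t. pr v w' * t \<in> B}"
  proof (rule ideal_mult_least)
    show "submodule {t. pr v w' * t \<in> B}"
      by (rule submodule_quotient[OF fractional_submodule[OF assms(4)]])
    fix t b assume "t \<in> A \<star> ideal_inverse K B" "b \<in> B"
    then have "(t * pr v w') * b \<in> B"
      by (intro submod_scale[OF fractional_submodule[OF assms(4)]] int)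
    then show "t * b \<in> {t. pr v w' * t \<in> B}" by (simp add: mult_ac)
  qed
  finally show ?thesis using assms(5) by blast
qed

end

section \<open>Normalization and uniqueness within a genus\<close>

context monomial_system
begin

text \<open>Swaps of opposite parity pair to \<open>1 + zeta (d * e)\<close> up to a unit; an axis
  root and a swap root pair to 1 in one order and to \<open>1 - zeta d\<close> in the other.
  Together with coprimality of \<open>B\<^sub>0\<close> and \<open>B\<^sub>1\<close> these values
  give all the divisibilities.\<close>

lemma ideal_family_and_normalized:
  assumes B: "fractional B\<^sub>0" "fractional B\<^sub>1" and A: "fractional A" and r: "r \<ge> 2"
    and deg: "\<not> degenerate d e r"
    and mem: "swap_root B\<^sub>0 1 2 1 \<in> \<R>" "swap_root B\<^sub>1 1 2 (zeta (d * e)) \<in> \<R>"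
      "d > 1 \<Longrightarrow> axis_root A 1 \<in> \<R>"
    and single: "r \<ge> 3 \<or> odd e \<Longrightarrow> B\<^sub>0 = B\<^sub>1"
    and coprime: "ideal_gen (B\<^sub>0 \<union> B\<^sub>1) = \<O>"
  shows "ideal_family d e A B\<^sub>0 B\<^sub>1 \<and> normalized_family d e A B\<^sub>0 B\<^sub>1"
proof -
  let ?\<zeta> = "zeta (d * e)"
  have r12: "1 \<in> {1..r}" "2 \<in> {1..r}" "(1::nat) \<noteq> 2" using r by auto
  note sub = fractional_submodule[OF B(1)] fractional_submodule[OF B(2)] fractional_submodule[OF A]
  have \<zeta>: "?\<zeta> ^ (d * e) = 1" by (rule zeta_power_self[OF de_pos])
  have \<zeta>O: "?\<zeta> \<in> \<O>" by (rule unity_O[OF \<zeta> \<zeta>])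
  have BO: "B\<^sub>0 \<subseteq> \<O>" "B\<^sub>1 \<subseteq> \<O>" using gen_superset[of "B\<^sub>0 \<union> B\<^sub>1" \<O> "(*)"] coprime by auto
  \<comment> \<open>1 is a sum of elements of \<open>B\<^sub>0\<close> and \<open>B\<^sub>1\<close>,
    so \<open>t\<close> lies in \<open>M\<close> as soon as its multiples by both ideals do.\<close>
  have from_B: "t \<in> M" if "submodule M" "\<And>b. b \<in> B\<^sub>0 \<Longrightarrow> t * b \<in> M" "\<And>b. b \<in> B\<^sub>1 \<Longrightarrow> t * b \<in> M" for t M
  proof -
    have "ideal_gen (B\<^sub>0 \<union> B\<^sub>1) \<subseteq> {b. t * b \<in> M}"
      using that by (intro gen_least submodule_quotient) auto
    then show ?thesis using coprime O_1 by auto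
  qed
  have plus_O: "1 + ?\<zeta> \<in> \<O>" by (intro O_add O_1 \<zeta>O)
  have p01: "(1 + ?\<zeta>) * b \<in> B\<^sub>1" if b: "b \<in> B\<^sub>0" for b
  proof -
    have "pr (swap_vec 1 2 1) (swap_covec 1 2 ?\<zeta>) * b \<in> B\<^sub>1"
      by (rule pairing_integral[OF mem(1,2)[unfolded swap_root_def] B b])
    then have "(1 + inverse ?\<zeta>) * b \<in> B\<^sub>1"
      using pr_swap[OF r12 K_1 zeta_K] unity_cnj[OF \<zeta>] by simp
    \<comment> \<open>The unit \<open>?\<zeta>\<close> undoes the conjugation caused by the second
      argument of the pairing.\<close>
    then have "?\<zeta> * ((1 + inverse ?\<zeta>) * b) \<in> B\<^sub>1" by (rule submod_scale[OF sub(2) \<zeta>O])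
    moreover have "?\<zeta> * ((1 + inverse ?\<zeta>) * b) = (1 + ?\<zeta>) * b"
      using zeta_nonzero[of "d * e"] by (simp add: field_simps)
    ultimately show ?thesis by simp
  qed
  have p10: "(1 + ?\<zeta>) * b \<in> B\<^sub>0" if b: "b \<in> B\<^sub>1" for b
  proof -
    have "pr (swap_vec 1 2 ?\<zeta>) (swap_covec 1 2 1) * b \<in> B\<^sub>0"
      by (rule pairing_integral[OF mem(2,1)[unfolded swap_root_def] B(2,1) b])
    then show ?thesis using pr_swap[OF r12 zeta_K K_1] by simp
  qed
  have plus: "1 + ?\<zeta> \<in> B\<^sub>0" "1 + ?\<zeta> \<in> B\<^sub>1"
  proof -
    show "1 + ?\<zeta> \<in> B\<^sub>0" by (rule from_B[OF sub(1) submod_scale[OF sub(1) plus_O] p10])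
    show "1 + ?\<zeta> \<in> B\<^sub>1" by (rule from_B[OF sub(2) p01 submod_scale[OF sub(2) plus_O]])
  qed
  have A_conds: "A \<subseteq> B\<^sub>0 \<and> A \<subseteq> B\<^sub>1 \<and> 1 - zeta d \<in> A" if "d \<noteq> 1"
  proof -
    have d1: "d > 1" using that d_pos by simp
    note axis = mem(3)[OF d1, unfolded axis_root_def]
    have pr1: "pr (eV 1) (swap_covec 1 2 x) = 1" if "x \<in> K" for x
      using that r12 by (simp add: swap_covec_def pr_diff_right pr_scale_right dual)
    have pr2: "pr (swap_vec 1 2 x) (sW (1 - inverse (zeta d)) (eW 1)) = 1 - zeta d" if "x \<in> K" for x
    proof -
      have y: "1 - inverse (zeta d) \<in> K" using zeta_d_K by (intro K_diff K_1 K_inverse)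
      have "pr (eV 1) (sW (1 - inverse (zeta d)) (eW 1)) = 1 - zeta d"
        using root_pair_axis[OF r12(1) d1] by (simp add: root_pair_def)
      moreover have "pr (eV 2) (sW (1 - inverse (zeta d)) (eW 1)) = 0"
        unfolding pr_scale_right[OF y] using dual[OF r12(2,1)] by simp
      ultimately show ?thesis using that by (simp add: swap_vec_def pr_diff_left pr_scale_left)
    qed
    have "a \<in> B\<^sub>0" "a \<in> B\<^sub>1" if "a \<in> A" for a
      using pairing_integral[OF axis mem(1)[unfolded swap_root_def] A B(1) that]
        pairing_integral[OF axis mem(2)[unfolded swap_root_def] A B(2) that]
        pr1[OF K_1] pr1[OF zeta_K] by simp_all
    moreover have "1 - zeta d \<in> A"
    proof (rule from_B[OF sub(3)])
      show "(1 - zeta d) * b \<in> A" if "b \<in> B\<^sub>0" for b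
        using pairing_integral[OF mem(1)[unfolded swap_root_def] axis B(1) A that] pr2[OF K_1] by simp
      show "(1 - zeta d) * b \<in> A" if "b \<in> B\<^sub>1" for b
        using pairing_integral[OF mem(2)[unfolded swap_root_def] axis B(2) A that] pr2[OF zeta_K] by simp
    qed
    ultimately show ?thesis by blast
  qed
  have "B\<^sub>0 = \<O> \<and> B\<^sub>1 = \<O>" if np: "\<not> (r = 2 \<and> (\<exists>p l. prime p \<and> l \<ge> 1 \<and> d * e = 2 * p ^ l))"
  proof (cases "r \<ge> 3 \<or> odd e")
    case True
    then have "B\<^sub>0 = B\<^sub>1" by (rule single)
    then show ?thesis using coprime gen_submod[OF sub(1)] by simp
  next
    case False
    then have r2: "r = 2" and e: "even e" using r by auto
    then obtain N where N: "d * e = 2 * N" by (metis evenE even_mult_iff)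
    \<comment> \<open>With \<open>e\<close> even, \<open>N = 1\<close> means G(2,2,2), where
      \<open>1 + zeta 2 = 0\<close> carries no information about the ideals.\<close>
    have "N \<noteq> 1"
    proof
      assume "N = 1"
      then have "d * e = 2" using N by simp
      moreover obtain e' where "e = 2 * e'" using e by (rule evenE)
      ultimately have "d * e' = 1" by simp
      then have "d = 1" "e' = 1" by simp_all
      then show False using deg r2 \<open>e = 2 * e'\<close> by (simp add: degenerate_def)
    qed
    moreover have "N \<noteq> 0" using N de_pos by auto
    ultimately have N1: "N > 1" by simp
    have "\<not> primepow N"
    proof
      assume "primepow N"
      then obtain p k where "prime p" "k > 0" "N = p ^ k" by (auto simp: primepow_def)
      then have "prime p \<and> k \<ge> 1 \<and> d * e = 2 * p ^ k" using N by simp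
      then show False using np r2 by blast
    qed
    then have unit: "inverse (1 + ?\<zeta>) \<in> \<O>" "1 + ?\<zeta> \<noteq> 0"
      using one_plus_zeta_unit[of N] N1 zeta_K N by simp_all
    have "X = \<O>" if X: "submodule X" "X \<subseteq> \<O>" "1 + ?\<zeta> \<in> X" for X
    proof
      have "inverse (1 + ?\<zeta>) * (1 + ?\<zeta>) \<in> X" by (rule submod_scale[OF X(1) unit(1) X(3)])
      then have one: "1 \<in> X" using unit(2) by simp
      show "\<O> \<subseteq> X" using submod_scale[OF X(1) _ one] by fastforce
    qed (rule X(2))
    then show ?thesis using sub BO plus by blast
  qed
  then have "ideal_family d e A B\<^sub>0 B\<^sub>1" using A B by (simp add: ideal_family_def)
  moreover have "normalized_family d e A B\<^sub>0 B\<^sub>1"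
    unfolding normalized_family_def integral_def relatively_prime_def
    using BO coprime plus A_conds B A sub
    by (auto simp: ideal_dvd_iff submodule_principal principal_subset)
  ultimately show ?thesis by blast
qed

text \<open>A swap needs two indices, so only axis roots are possible. The system is not empty
  because it spans the space, and two axis roots on the same axis coincide.\<close>

lemma axis_system_rank_one:
  assumes r: "r = 1"
  obtains A where "fractional A" "d > 1" "\<R> = {axis_root A 1}"
proof -
  have ax: "\<exists>A. fractional A \<and> d > 1 \<and> \<rho> = axis_root A 1" if "\<rho> \<in> \<R>" for \<rho>
    using that by (cases rule: root_cases) (use r in auto)
  have "\<R> \<noteq> {}"
  proof
    assume "\<R> = {}"
    then have "gen K sV {} = (UNIV :: 'v set)" using system by (simp add: root_system_def)
    moreover have "gen K sV {} \<subseteq> {0}"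
      by (rule gen_least) (auto simp: submod_def VS.scale_zero_right)
    ultimately have "eV 1 = 0" by auto
    moreover have "pr (eV 1) (eW 1) = 1" using r by (simp add: dual)
    ultimately show False by (simp add: pr_zero_left)
  qed
  then obtain \<rho> where \<rho>: "\<rho> \<in> \<R>" by blast
  obtain A where A: "fractional A" "d > 1" "\<rho> = axis_root A 1" using ax[OF \<rho>] by blast
  have "\<sigma> = axis_root A 1" if \<sigma>: "\<sigma> \<in> \<R>" for \<sigma>
  proof -
    obtain B where B: "fractional B" "\<sigma> = axis_root B 1" using ax[OF \<sigma>] by blast
    then have "B = A" using axis_root_unique[of B 1 A] A \<rho> \<sigma> r by auto
    then show ?thesis using B by simp
  qed
  then have "\<R> = {axis_root A 1}" using \<rho> A(3) by blast
  then show thesis using that A by blast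
qed

text \<open>Every fractional ideal occurs as \<open>X\<close> in the genus. As \<open>d\<close> is
  not a prime power, \<open>1 - zeta d\<close> is a unit, and its only integral divisor is the unit
  ideal.\<close>

lemma unique_family_system_rank_one:
  assumes r: "r = 1" and deg: "\<not> degenerate d e r"
  shows "\<exists>!\<S>. genus_member \<S> \<and> normal_form \<S>"
proof -
  obtain A where A: "fractional A" "d > 1" "\<R> = {axis_root A 1}"
    by (rule axis_system_rank_one[OF r])
  have fam: "family_system d e X B\<^sub>0 B\<^sub>1 = {axis_root X 1}"
    if "fractional X" "fractional B\<^sub>0" "fractional B\<^sub>1" for X B\<^sub>0 B\<^sub>1
    unfolding family_system_conv[OF that] using r A(2) by auto
  have np: "\<not> primepow d" using deg r by (simp add: degenerate_def)
  note unit = one_minus_zeta_unit[OF zeta_d_K A(2) np]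
  have zdO: "1 - zeta d \<in> \<O>"
    using zeta_d_K d_pos zeta_power_self[of d]
    by (intro O_diff O_1 root_of_unity_O[of _ d]) auto
  have zqO: "1 + zeta (d * e) \<in> \<O>"
    using unity_O[OF zeta_power_self zeta_power_self] de_pos by (intro O_add O_1) auto
  let ?I = "ideal_inverse K A"
  have act: "ideal_act ?I ` \<R> = {axis_root \<O> 1}"
    using A(1) by (simp add: A(3) axis_root_def ideal_act_root_at fractional_inverse
        ideal_mult_commute[of ?I A] ideal_mult_inverse)
  have sys: "{axis_root \<O> 1} \<in> distinguished_systems G"
    using distinguished_systems_ideal_act[OF distinguished monomial_group_subset_GL fractional_inverse[OF A(1)]]
    unfolding act .
  have "ideal_family d e \<O> \<O> \<O>" using fractional_O by (simp add: ideal_family_def)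
  moreover have "normalized_family d e \<O> \<O> \<O>"
    unfolding normalized_family_def integral_def relatively_prime_def
    using zdO zqO fractional_O submodule_O
    by (auto simp: ideal_dvd_iff submodule_principal principal_subset gen_submod)
  ultimately have ex: "normal_form {axis_root \<O> 1}"
    unfolding normal_form_def using fam[OF fractional_O fractional_O fractional_O] by metis
  show ?thesis
  proof (rule ex1I[of _ "{axis_root \<O> 1}"])
    show "genus_member {axis_root \<O> 1} \<and> normal_form {axis_root \<O> 1}"
      unfolding genus_member_def using ex sys act fractional_inverse[OF A(1)] by metis
  next
    fix \<S> assume "genus_member \<S> \<and> normal_form \<S>"
    then obtain X B\<^sub>0 B\<^sub>1 where X: "ideal_family d e X B\<^sub>0 B\<^sub>1" "normalized_family d e X B\<^sub>0 B\<^sub>1"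
      "\<S> = family_system d e X B\<^sub>0 B\<^sub>1" unfolding normal_form_def by blast
    have frac: "fractional X" "fractional B\<^sub>0" "fractional B\<^sub>1" using X(1) by (auto simp: ideal_family_def)
    note sub = fractional_submodule[OF frac(1)]
    have "X \<subseteq> \<O>" and "ideal_dvd K X (principal K (1 - zeta d))"
      using X(2) A(2) by (auto simp: normalized_family_def integral_def)
    then have "1 - zeta d \<in> X"
      using frac(1) sub by (simp add: ideal_dvd_iff submodule_principal principal_subset)
    then have "inverse (1 - zeta d) * (1 - zeta d) \<in> X" by (rule submod_scale[OF sub unit(1)])
    then have one: "1 \<in> X" using unit(2) by simp
    have "\<O> \<subseteq> X" using submod_scale[OF sub _ one] by fastforce
    then have "X = \<O>" using \<open>X \<subseteq> \<O>\<close> by blast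
    then show "\<S> = {axis_root \<O> 1}" using X(3) fam[OF frac] by simp
  qed
qed

lemma unique_family_system:
  assumes r: "r \<ge> 2" and deg: "\<not> degenerate d e r"
  shows "\<exists>!\<S>. genus_member \<S> \<and> normal_form \<S>"
proof -
  let ?\<zeta> = "zeta (d * e)"
  have r12: "1 \<in> {1..r}" "2 \<in> {1..r}" "(1::nat) \<noteq> 2" using r by auto
  obtain B\<^sub>0 B\<^sub>1 where B: "fractional B\<^sub>0" "fractional B\<^sub>1"
    and even: "\<And>j m n. even j \<Longrightarrow> m \<in> {1..r} \<Longrightarrow> n \<in> {1..r} \<Longrightarrow> m \<noteq> n \<Longrightarrow> swap_root B\<^sub>0 m n (?\<zeta> ^ j) \<in> \<R>"
    and odd: "\<And>j m n. odd j \<Longrightarrow> m \<in> {1..r} \<Longrightarrow> n \<in> {1..r} \<Longrightarrow> m \<noteq> n \<Longrightarrow> swap_root B\<^sub>1 m n (?\<zeta> ^ j) \<in> \<R>"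
    and single: "r \<ge> 3 \<or> odd e \<Longrightarrow> B\<^sub>0 = B\<^sub>1"
    by (rule swap_roots[OF r]) blast
  have "\<exists>A. fractional A \<and> (\<forall>m. d > 1 \<longrightarrow> m \<in> {1..r} \<longrightarrow> axis_root A m \<in> \<R>)"
  proof (cases "d > 1")
    case True
    then obtain A where "fractional A" "\<And>m. m \<in> {1..r} \<Longrightarrow> axis_root A m \<in> \<R>"
      by (rule axis_roots) (use r in auto)
    then show ?thesis by blast
  \<comment> \<open>For \<open>d = 1\<close> the ideal is a dummy, chosen to be the unit
    ideal.\<close>
  qed (use fractional_O in blast)
  then obtain A where A: "fractional A" and axes: "\<And>m. d > 1 \<Longrightarrow> m \<in> {1..r} \<Longrightarrow> axis_root A m \<in> \<R>"
    by blast
  \<comment> \<open>\<open>D\<close> is the greatest common divisor of the two ideals, and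
    \<open>C\<close> the factor that makes them coprime.\<close>
  define D where "D = ideal_gen (B\<^sub>0 \<union> B\<^sub>1)"
  have D: "fractional D" unfolding D_def by (rule fractional_Un[OF B])
  define C where "C = ideal_inverse K D"
  have C: "fractional C" unfolding C_def by (rule fractional_inverse[OF D])
  have one12: "swap_root B\<^sub>0 1 2 1 \<in> \<R>" "swap_root B\<^sub>1 1 2 ?\<zeta> \<in> \<R>"
    using even[of 0 1 2] odd[of 1 1 2] r12 by simp_all
  have act_swap: "ideal_act X (swap_root B m n x) = swap_root (X \<star> B) m n x"
    if "fractional X" "fractional B" for X B m n x
    using that by (simp add: swap_root_def ideal_act_root_at)
  have act_axis: "ideal_act X (axis_root B m) = axis_root (X \<star> B) m"
    if "fractional X" "fractional B" for X B m
    using that by (simp add: axis_root_def ideal_act_root_at)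
  have sysC: "ideal_act C ` \<R> \<in> distinguished_systems G"
    by (rule distinguished_systems_ideal_act[OF distinguished monomial_group_subset_GL C])
  \<comment> \<open>The scaled system is distinguished as well, so the results about systems apply
    to it.\<close>
  interpret S: monomial_system K sV sW pr r eV eW d e "ideal_act C ` \<R>"
    by unfold_locales (rule sysC)
  have CB: "fractional (C \<star> B\<^sub>0)" "fractional (C \<star> B\<^sub>1)" "fractional (C \<star> A)"
    using A B C by (auto intro: fractional_mult)
  have C_swap: "swap_root (C \<star> X) m n x \<in> ideal_act C ` \<R>" if "swap_root X m n x \<in> \<R>" "fractional X" for X m n x
    using imageI[OF that(1), of "ideal_act C"] act_swap[OF C that(2)] by simp
  have C_axis: "axis_root (C \<star> A) m \<in> ideal_act C ` \<R>" if "d > 1" "m \<in> {1..r}" for m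
    using imageI[OF axes[OF that], of "ideal_act C"] act_axis[OF C A] by simp
  have "ideal_gen (C \<star> B\<^sub>0 \<union> C \<star> B\<^sub>1) = C \<star> D"
    unfolding D_def by (rule ideal_mult_Un[symmetric])
  also have "\<dots> = \<O>" unfolding C_def ideal_mult_commute[of "ideal_inverse K D" D] by (rule ideal_mult_inverse[OF D])
  finally have cop: "ideal_gen (C \<star> B\<^sub>0 \<union> C \<star> B\<^sub>1) = \<O>" .
  have norm: "ideal_family d e (C \<star> A) (C \<star> B\<^sub>0) (C \<star> B\<^sub>1) \<and> normalized_family d e (C \<star> A) (C \<star> B\<^sub>0) (C \<star> B\<^sub>1)"
    by (rule S.ideal_family_and_normalized[OF CB r deg C_swap[OF one12(1) B(1)] C_swap[OF one12(2) B(2)]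
          C_axis[OF _ r12(1)] _ cop]) (use single in auto)
  have fam: "ideal_act C ` \<R> = family_system d e (C \<star> A) (C \<star> B\<^sub>0) (C \<star> B\<^sub>1)"
  proof (rule S.system_eq_family[OF CB(3,1,2)])
    show "axis_root (C \<star> A) m \<in> ideal_act C ` \<R>" if "d > 1" "m \<in> {1..r}" for m
      by (rule C_axis[OF that])
    show "swap_root (if even j then C \<star> B\<^sub>0 else C \<star> B\<^sub>1) m n (?\<zeta> ^ j) \<in> ideal_act C ` \<R>"
      if "m \<in> {1..r}" "n \<in> {1..r}" "m \<noteq> n" for j m n
      using C_swap[OF even[OF _ that] B(1), of j] C_swap[OF odd[OF _ that] B(2), of j] by simp
  qed
  show ?thesis
  proof (rule ex1I[of _ "ideal_act C ` \<R>"])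
    show "genus_member (ideal_act C ` \<R>) \<and> normal_form (ideal_act C ` \<R>)"
      unfolding genus_member_def normal_form_def using C sysC norm fam by blast
  next
    fix \<S> assume "genus_member \<S> \<and> normal_form \<S>"
    then obtain E X Y\<^sub>0 Y\<^sub>1 where E: "fractional E" "\<S> \<in> distinguished_systems G" "\<S> = ideal_act E ` \<R>"
      and X: "ideal_family d e X Y\<^sub>0 Y\<^sub>1" "normalized_family d e X Y\<^sub>0 Y\<^sub>1" "\<S> = family_system d e X Y\<^sub>0 Y\<^sub>1"
      unfolding genus_member_def normal_form_def by blast
    have frac: "fractional X" "fractional Y\<^sub>0" "fractional Y\<^sub>1" using X(1) by (auto simp: ideal_family_def)
    interpret T: monomial_system K sV sW pr r eV eW d e \<S>
      by unfold_locales (rule E(2))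
    have EB: "fractional (E \<star> B\<^sub>0)" "fractional (E \<star> B\<^sub>1)" using B E by (auto intro: fractional_mult)
    have E_swap: "swap_root (E \<star> Z) m n x \<in> \<S>" if "swap_root Z m n x \<in> \<R>" "fractional Z" for Z m n x
      using imageI[OF that(1), of "ideal_act E"] act_swap[OF E(1) that(2)] E(3) by simp
    \<comment> \<open>The exponents 0 and 1 represent both parities and lie below
      \<open>d * e\<close>, so the family lists them.\<close>
    have Y_swap: "swap_root (if even j then Y\<^sub>0 else Y\<^sub>1) 1 2 (?\<zeta> ^ j) \<in> \<S>" if "j < d * e" for j
      unfolding X(3) family_system_conv[OF frac] using that r12 by (intro UnI2 CollectI exI[of _ j] exI[of _ 1] exI[of _ 2]) auto
    have "E \<star> B\<^sub>0 = Y\<^sub>0"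
    proof (rule T.swap_root_unique[OF _ _ EB(1) frac(2) r12])
      show "swap_root (E \<star> B\<^sub>0) 1 2 1 \<in> \<S>" by (rule E_swap[OF one12(1) B(1)])
      show "swap_root Y\<^sub>0 1 2 1 \<in> \<S>" using Y_swap[of 0] de_pos by simp
    qed simp
    moreover have "E \<star> B\<^sub>1 = Y\<^sub>1"
    proof (rule T.swap_root_unique[OF _ _ EB(2) frac(3) r12])
      show "swap_root (E \<star> B\<^sub>1) 1 2 ?\<zeta> \<in> \<S>" by (rule E_swap[OF one12(2) B(2)])
      show "swap_root Y\<^sub>1 1 2 ?\<zeta> \<in> \<S>" using Y_swap[of 1] de_gt_1 by simp
    qed (rule zeta_power_self[OF de_pos])
    moreover have "ideal_gen (Y\<^sub>0 \<union> Y\<^sub>1) = \<O>"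
      using X(2) by (simp add: normalized_family_def relatively_prime_def)
    \<comment> \<open>The action of \<open>E\<close> multiplies both ideals and hence their sum,
      which has to become the unit ideal; this determines \<open>E\<close>.\<close>
    ultimately have "E \<star> D = \<O>" unfolding D_def ideal_mult_Un by simp
    then have "D \<star> E = \<O>" unfolding ideal_mult_commute[of E D] .
    then have "E = C"
      unfolding C_def using ideal_inverse_unique fractional_submodule[OF E(1)] fractional_subset_K[OF E(1)] by blast
    then show "\<S> = ideal_act C ` \<R>" using E(3) by simp
  qed
qed

end

theorem theorem5p13:
  fixes K :: "complex set"
    and sV :: "complex \<Rightarrow> 'v::ab_group_add \<Rightarrow> 'v"
    and sW :: "complex \<Rightarrow> 'w::ab_group_add \<Rightarrow> 'w"
    and pr :: "'v \<Rightarrow> 'w \<Rightarrow> complex"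
    and eV :: "nat \<Rightarrow> 'v" and eW :: "nat \<Rightarrow> 'w"
    and d e r :: nat
  assumes "hermitian_pairing_basis K sV sW pr r eV eW"
    and "d \<ge> 1" and "e \<ge> 1" and "r \<ge> 1" and "d * e > 1" and "r = 1 \<Longrightarrow> d \<noteq> 1"
    and "zeta (d * e) \<in> K"
    and "\<not> degenerate d e r"
  shows "\<forall>\<G> \<in> hermitian_pairing_basis.genera K sV sW pr r eV eW
                 (hermitian_pairing_basis.monomial_group K sV r eV d e).
           \<exists>!\<R>. \<R> \<in> \<G> \<and>
             (\<exists>A B\<^sub>0 B\<^sub>1.
                hermitian_pairing_basis.ideal_family K r d e A B\<^sub>0 B\<^sub>1 \<and>
                hermitian_pairing_basis.normalized_family K d e A B\<^sub>0 B\<^sub>1 \<and>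
                \<R> = hermitian_pairing_basis.family_system K sV sW r eV eW d e A B\<^sub>0 B\<^sub>1)"
proof
  interpret hermitian_pairing_basis K sV sW pr r eV eW by fact
  interpret monomial_setting K sV sW pr r eV eW d e
    by unfold_locales (use assms in auto)
  fix \<G> assume "\<G> \<in> genera G"
  then obtain \<R> where \<R>: "\<R> \<in> distinguished_systems G" "\<G> = same_genus G `` {\<R>}"
    by (auto simp: genera_def elim: quotientE)
  interpret monomial_system K sV sW pr r eV eW d e \<R>
    by unfold_locales (rule \<R>(1))
  \<comment> \<open>A genus is the class of one distinguished system, so its members are the ideal
    multiples of that representative.\<close>
  have mem: "\<S> \<in> \<G> \<longleftrightarrow> genus_member \<S>" for \<S>
    using \<R> by (auto simp: same_genus_def genus_member_def)
  have "\<exists>!\<S>. genus_member \<S> \<and> normal_form \<S>"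
  proof (cases "r = 1")
    case True
    then show ?thesis using assms(8) by (rule unique_family_system_rank_one)
  next
    case False
    then have "r \<ge> 2" using assms(4) by simp
    then show ?thesis using assms(8) by (rule unique_family_system)
  qed
  then show "\<exists>!\<S>. \<S> \<in> \<G> \<and> (\<exists>A B\<^sub>0 B\<^sub>1. ideal_family d e A B\<^sub>0 B\<^sub>1 \<and>
      normalized_family d e A B\<^sub>0 B\<^sub>1 \<and> \<S> = family_system d e A B\<^sub>0 B\<^sub>1)"
    unfolding mem normal_form_def .
qed

end
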